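(* Let $\mathcal{F}$ be a fusion system on a finite $p$-group $S$, let $\mathcal{X}$ be an $\mathcal{F}$-overconjugacy closed collection of subgroups of $S$, and let $k$ be a commutative ring with identity. For $Q\le S$ and $V$ a simple $k\mathrm{Out}_{\mathcal{F}}(Q)$-module, the simple Mackey functor $S_{Q,V}$ for $\mathcal{F}$ over $k$ vanishes outside of $\mathcal{X}$ (i.e. $S_{Q,V}(P)=0$ for all $P\le S$ with $P\notin\mathcal{X}$) and restricts to a simple object $S_{Q,V}|_{\mathcal{O}(\mathcal{X})}$ in $\mathsf{Mack}^{\mathcal{X}}_k(\mathcal{F})$ if and only if $Q$ belongs to $\mathcal{X}$. Moreover, all simple objects in $\mathsf{Mack}^{\mathcal{X}}_k(\mathcal{F})$ arise this way (up to isomorphism).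
   Context: A fusion system $\mathcal{F}$ on a finite $p$-group $S$ is a category whose objects are all subgroups of $S$, whose morphisms are injective group homomorphisms (composed as usual), such that $\mathrm{Hom}_{\mathcal{F}}(P,Q)$ contains all maps $c_x|_P\colon P\to Q$, $u\mapsto xux^{-1}$, with $x\in S$ and $xPx^{-1}\le Q$, and such that each $\varphi\in \mathrm{Hom}_{\mathcal{F}}(P,Q)$ factors as an $\mathcal{F}$-isomorphism $P\to\varphi(P)$ followed by the inclusion. Subgroups are $\mathcal{F}$-conjugate if they are isomorphic in $\mathcal{F}$. $\mathcal{X}$ is $\mathcal{F}$-overconjugacy closed if whenever $\varphi\colon P\to Q$ is a morphism in $\mathcal{F}$ and $P\in\mathcal{X}$, then $Q\in\mathcal{X}$. $\mathrm{Out}_{\mathcal{F}}(Q)=\mathrm{Aut}_{\mathcal{F}}(Q)/\mathrm{Inn}(Q)$. The orbit category $\mathcal{O}(\mathcal{F})$ has as objects all subgroups of $S$ and morphisms $\mathrm{Inn}(Q)\backslash\mathrm{Hom}_{\mathcal{F}}(P,Q)$; $[\varphi]$ is the class of $\varphi$; $\mathcal{O}(\mathcal{X})$ is the full subcategory on $\mathcal{X}$. For $Q\le P$, $\iota_Q^P$ is the inclusion; ${}^xR=xRx^{-1}$ and $c_x(u)=xux^{-1}$. An $\mathcal{X}$-restricted Mackey functor for $\mathcal{F}$ over $k$ is a pair $M=(M^*,M_* )\colon\mathcal{O}(\mathcal{X})\to k\text{-}\mathsf{Mod}$ such that: (1) $M^*$ is contravariant, $M_*$ is covariant, and $M^*(P)=M_*(P)=:M(P)$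 for all $P\in\mathcal{X}$; (2) $M^*([\alpha])=M_*([\alpha]^{-1})$ for every isomorphism $[\alpha]$ in $\mathcal{O}(\mathcal{X})$; (3) for all $Q,R\le P$ in $\mathcal{X}$, $$M^*([\iota^P_Q])\circ M_*([\iota^P_R])=\sum_{x} M_*([\iota^Q_{Q\cap{}^xR}])\circ M^*([\iota^{{}^xR}_{Q\cap{}^xR}])\circ M_*([c_x|_R]),$$ where $x$ runs over those representatives of the double cosets $Q\backslash P/R$ with $Q\cap{}^xR\in\mathcal{X}$. Morphisms $M\to N$ are families of $k$-linear maps $M(P)\to N(P)$, $P\in\mathcal{X}$, natural for both the contravariant and covariant parts. $\mathsf{Mack}^{\mathcal{X}}_k(\mathcal{F})$ is the resulting category; it is abelian, with kernels and cokernels constructed objectwise. When $\mathcal{X}$ consists of all subgroups of $S$ one speaks of Mackey functors for $\mathcal{F}$ over $k$, forming $\mathsf{Mack}_k(\mathcal{F})$. Notation: $\mathrm{r}^P_Q=M^*([\iota_Q^P])$, $\mathrm{t}^P_Q=M_*([\iota_Q^P])$, and $\mathrm{iso}(\varphi)=M_*([\varphi])$ for isomorphisms $\varphi$. These determine $M$: for $\varphi\colon P\to Q$ with induced isomorphism $\overline\varphi\colon P\to\varphi(P)$, $M^*([\varphi])=\mathrm{iso}(\overline\varphi^{-1})\circ\mathrm{r}^Q_{\varphi(P)}$ and $M_*([\varphi])=\mathrm{t}^Q_{\varphi(P)}\circ\mathrm{iso}(\overline\varphi)$. The simple Mackey functor $S_{Q,V}\in\mathsf{Mack}_k(\mathcal{F})$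 ($Q\le S$, $V$ a simple $k\mathrm{Out}_{\mathcal{F}}(Q)$-module) is defined as follows (following P. Webb). For each $\mathcal{F}$-conjugate $L$ of $Q$ fix an $\mathcal{F}$-isomorphism $\alpha_L\colon Q\to L$, and let ${}^{\alpha_L}V$ be $V$ with $\mathrm{Out}_{\mathcal{F}}(L)$ acting by $[\varphi]\cdot v=[\alpha_L^{-1}\varphi\alpha_L]v$. An $\mathcal{F}$-isomorphism $\gamma\colon L_1\to L_2$ between $\mathcal{F}$-conjugates of $Q$ induces $\gamma_*\colon {}^{\alpha_{L_1}}V\to{}^{\alpha_{L_2}}V$, $v\mapsto[\alpha_{L_2}^{-1}\gamma\alpha_{L_1}]v$. For $L\le P$, $N_P(L)$ acts on ${}^{\alpha_L}V$ via the conjugation map $N_P(L)\to\mathrm{Out}_{\mathcal{F}}(L)$; for $H\le K\le N_P(L)$, $\mathrm{tr}_H^K(v)=\sum_{g\in K/H}g v$ is the relative trace on $H$-fixed vectors. For $P\le S$ choose representatives $L$ of the $P$-conjugacy classes of subgroups of $P$ that are $\mathcal{F}$-conjugate to $Q$ and set $S_{Q,V}(P)=\bigoplus_L\mathrm{tr}_L^{N_P(L)}({}^{\alpha_L}V)$. If $L'\le P$ is $\mathcal{F}$-conjugate to $Q$ and ${}^gL'=L$ is its representative ($g\in P$), identify $\mathrm{tr}_{L'}^{N_P(L')}({}^{\alpha_{L'}}V)$ with the summand of $L$ via $(c_g)_*$ (independent of $g$). With these identifications: for an isomorphism $\varphi\colon P\to R$, $\mathrm{iso}(\varphi)$ maps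 the summand of $L$ to that of $\varphi(L)$ by $(\varphi|_L)_*$; for $R\le P$, $\mathrm{t}^P_R$ maps the summand of $L'\le R$ to the summand of $L'\le P$ by $v\mapsto\mathrm{tr}_{N_R(L')}^{N_P(L')}(v)$; and $\mathrm{r}^P_R$ maps $v$ in the summand of $L\le P$ to $\bigoplus_i (c_{p_i})_*v$, where $L'_i={}^{p_i}L$ ($p_i\in P$) are the chosen representatives of the $R$-conjugacy classes of $P$-conjugates of $L$ lying in $R$ (and to $0$ if there are none). *)

theory Defs
  imports
    "HOL-Algebra.Group_Action"
    "HOL-Algebra.Module"
    "HOL-Computational_Algebra.Primes"
begin

section \<open>Fusion systems\<close>

definition cj :: "('g, 'z) monoid_scheme \<Rightarrow> 'g \<Rightarrow> 'g \<Rightarrow> 'g"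
  where "cj S x u = x \<otimes>\<^bsub>S\<^esub> u \<otimes>\<^bsub>S\<^esub> inv\<^bsub>S\<^esub> x"

text \<open>
  A fusion system is given by its morphism sets: \<open>F P Q\<close> is \<open>Hom\<^sub>F(P, Q)\<close>, meaningful only for
  subgroups \<open>P\<close>, \<open>Q\<close> of \<open>S\<close>. Morphisms out of \<open>P\<close> are extensional on \<open>P\<close>, so that equality of
  morphisms with given source and target is equality in HOL; composition is \<open>compose P\<close>.
\<close>

type_synonym 'g homs = "'g set \<Rightarrow> 'g set \<Rightarrow> ('g \<Rightarrow> 'g) set"

definition inv_map :: "'g set \<Rightarrow> ('g \<Rightarrow> 'g) \<Rightarrow> 'g \<Rightarrow> 'g"
  where "inv_map P \<phi> = restrict (inv_into P \<phi>) (\<phi> ` P)"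

definition fus_iso :: "'g homs \<Rightarrow> 'g set \<Rightarrow> 'g set \<Rightarrow> ('g \<Rightarrow> 'g) set"
  where "fus_iso F P Q =
    {\<phi> \<in> F P Q. \<exists>\<psi> \<in> F Q P. compose P \<psi> \<phi> = (\<lambda>u\<in>P. u) \<and> compose Q \<phi> \<psi> = (\<lambda>u\<in>Q. u)}"

text \<open>Identities and inclusions are the conjugation morphisms for \<open>x = \<one>\<close>.\<close>

locale fusion_system = group S for S (structure) +
  fixes p :: nat and F :: "'a homs"
  assumes prime_p: "prime p"
    and p_group: "\<exists>n. order S = p ^ n"
    and hom_mon: "\<lbrakk>subgroup P S; subgroup Q S; \<phi> \<in> F P Q\<rbrakk>
      \<Longrightarrow> \<phi> \<in> mon (S\<lparr>carrier := P\<rparr>) (S\<lparr>carrier := Q\<rparr>) \<inter> extensional P"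
    and hom_comp: "\<lbrakk>subgroup P S; subgroup Q S; subgroup R S; \<phi> \<in> F P Q; \<psi> \<in> F Q R\<rbrakk>
      \<Longrightarrow> compose P \<psi> \<phi> \<in> F P R"
    and hom_conj: "\<lbrakk>subgroup P S; subgroup Q S; x \<in> carrier S; cj S x ` P \<subseteq> Q\<rbrakk>
      \<Longrightarrow> restrict (cj S x) P \<in> F P Q"
    and hom_factor: "\<lbrakk>subgroup P S; subgroup Q S; \<phi> \<in> F P Q\<rbrakk> \<Longrightarrow> \<phi> \<in> fus_iso F P (\<phi> ` P)"

definition fus_conj :: "('g, 'z) monoid_scheme \<Rightarrow> 'g homs \<Rightarrow> 'g set \<Rightarrow> 'g set \<Rightarrow> bool"
  where "fus_conj S F Q L \<longleftrightarrow> subgroup Q S \<and> subgroup L S \<and> fus_iso F Q L \<noteq> {}"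

definition overconjugacy_closed :: "('g, 'z) monoid_scheme \<Rightarrow> 'g homs \<Rightarrow> 'g set set \<Rightarrow> bool"
  where "overconjugacy_closed S F X \<longleftrightarrow>
    (\<forall>P\<in>X. subgroup P S) \<and> (\<forall>P\<in>X. \<forall>Q. subgroup Q S \<and> F P Q \<noteq> {} \<longrightarrow> Q \<in> X)"

definition Inn :: "('g, 'z) monoid_scheme \<Rightarrow> 'g set \<Rightarrow> ('g \<Rightarrow> 'g) set"
  where "Inn S Q = (\<lambda>x. restrict (cj S x) Q) ` Q"

definition fus_Aut :: "'g homs \<Rightarrow> 'g set \<Rightarrow> ('g \<Rightarrow> 'g) monoid"
  where "fus_Aut F Q = \<lparr>carrier = F Q Q, monoid.mult = compose Q, one = (\<lambda>u\<in>Q. u)\<rparr>"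

definition fus_Out :: "('g, 'z) monoid_scheme \<Rightarrow> 'g homs \<Rightarrow> 'g set \<Rightarrow> ('g \<Rightarrow> 'g) set monoid"
  where "fus_Out S F Q = fus_Aut F Q Mod Inn S Q"


section \<open>The orbit category\<close>

definition orbit_class ::
    "('g, 'z) monoid_scheme \<Rightarrow> 'g set \<Rightarrow> 'g set \<Rightarrow> ('g \<Rightarrow> 'g) \<Rightarrow> ('g \<Rightarrow> 'g) set"
  where "orbit_class S P Q \<phi> = (\<lambda>\<iota>. compose P \<iota> \<phi>) ` Inn S Q"

definition orbit_hom ::
    "('g, 'z) monoid_scheme \<Rightarrow> 'g homs \<Rightarrow> 'g set \<Rightarrow> 'g set \<Rightarrow> ('g \<Rightarrow> 'g) set set"
  where "orbit_hom S F P Q = orbit_class S P Q ` F P Q"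

text \<open>
  \<open>Inn(R) \<psi> Inn(Q) \<phi> = Inn(R) \<psi> \<phi>\<close>, so the composite of two classes is the set of all composites
  of their members.
\<close>

definition orbit_comp :: "'g set \<Rightarrow> ('g \<Rightarrow> 'g) set \<Rightarrow> ('g \<Rightarrow> 'g) set \<Rightarrow> ('g \<Rightarrow> 'g) set"
  where "orbit_comp P b a = {compose P \<psi> \<phi> | \<psi> \<phi>. \<psi> \<in> b \<and> \<phi> \<in> a}"

definition orbit_incl :: "('g, 'z) monoid_scheme \<Rightarrow> 'g set \<Rightarrow> 'g set \<Rightarrow> ('g \<Rightarrow> 'g) set"
  where "orbit_incl S Q P = orbit_class S Q P (\<lambda>u\<in>Q. u)"

abbreviation orbit_id :: "('g, 'z) monoid_scheme \<Rightarrow> 'g set \<Rightarrow> ('g \<Rightarrow> 'g) set"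
  where "orbit_id S P \<equiv> orbit_incl S P P"


section \<open>Modules\<close>

definition lin_maps ::
    "('k, 'y) ring_scheme \<Rightarrow> ('k, 'a, 'm) module_scheme \<Rightarrow> ('k, 'b, 'n) module_scheme \<Rightarrow> ('a \<Rightarrow> 'b) set"
  where "lin_maps k A B = {f \<in> hom (add_monoid A) (add_monoid B).
    \<forall>a\<in>carrier k. \<forall>x\<in>carrier A. f (a \<odot>\<^bsub>A\<^esub> x) = a \<odot>\<^bsub>B\<^esub> f x}"

text \<open>A \<open>kG\<close>-module is a \<open>k\<close>-module with a \<open>k\<close>-linear action of \<open>G\<close>.\<close>

definition kG_module ::
    "('k, 'y) ring_scheme \<Rightarrow> ('h, 'z) monoid_scheme \<Rightarrow> ('k, 'v) module \<Rightarrow> ('h \<Rightarrow> 'v \<Rightarrow> 'v) \<Rightarrow> bool"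
  where "kG_module k G V \<rho> \<longleftrightarrow>
    module k V \<and> group_action G (carrier V) \<rho> \<and> (\<forall>g\<in>carrier G. \<rho> g \<in> lin_maps k V V)"

definition simple_kG_module ::
    "('k, 'y) ring_scheme \<Rightarrow> ('h, 'z) monoid_scheme \<Rightarrow> ('k, 'v) module \<Rightarrow> ('h \<Rightarrow> 'v \<Rightarrow> 'v) \<Rightarrow> bool"
  where "simple_kG_module k G V \<rho> \<longleftrightarrow>
    kG_module k G V \<rho> \<and> carrier V \<noteq> {\<zero>\<^bsub>V\<^esub>} \<and>
    (\<forall>W. submodule W k V \<and> (\<forall>g\<in>carrier G. \<forall>w\<in>W. \<rho> g w \<in> W)
      \<longrightarrow> W = {\<zero>\<^bsub>V\<^esub>} \<or> W = carrier V)"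


section \<open>Restricted Mackey functors\<close>

text \<open>
  For a class \<open>c\<close> of morphisms \<open>P \<rightarrow> Q\<close>, \<open>con M P Q c\<close> is \<open>M\<^sup>*(c) : M(Q) \<rightarrow> M(P)\<close> and \<open>cov M P Q c\<close>
  is \<open>M\<^sub>*(c) : M(P) \<rightarrow> M(Q)\<close>. Everything below looks only at objects and morphisms of \<open>\<O>(X)\<close> and at
  elements of carriers; thus the restriction of a functor to \<open>\<O>(X)\<close> is the same record,
  considered relative to \<open>X\<close>.
\<close>

record ('g, 'k, 'm) mackey =
  obj :: "'g set \<Rightarrow> ('k, 'm) module"
  con :: "'g set \<Rightarrow> 'g set \<Rightarrow> ('g \<Rightarrow> 'g) set \<Rightarrow> 'm \<Rightarrow> 'm"
  cov :: "'g set \<Rightarrow> 'g set \<Rightarrow> ('g \<Rightarrow> 'g) set \<Rightarrow> 'm \<Rightarrow> 'm"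

definition double_coset_reps ::
    "('g, 'z) monoid_scheme \<Rightarrow> 'g set \<Rightarrow> 'g set \<Rightarrow> 'g set \<Rightarrow> 'g set \<Rightarrow> bool"
  where "double_coset_reps S Q P R T \<longleftrightarrow>
    T \<subseteq> P \<and> (\<forall>y\<in>P. \<exists>!x. x \<in> T \<and> y \<in> (Q #>\<^bsub>S\<^esub> x) <#>\<^bsub>S\<^esub> R)"

locale mackey_functor =
  fixes k :: "'k ring" and S :: "'g monoid" and F :: "'g homs" and X :: "'g set set"
    and M :: "('g, 'k, 'm) mackey"
  assumes obj_module: "P \<in> X \<Longrightarrow> module k (obj M P)"
    and con_linear: "\<lbrakk>P \<in> X; Q \<in> X; c \<in> orbit_hom S F P Q\<rbrakk>
      \<Longrightarrow> con M P Q c \<in> lin_maps k (obj M Q) (obj M P)"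
    and cov_linear: "\<lbrakk>P \<in> X; Q \<in> X; c \<in> orbit_hom S F P Q\<rbrakk>
      \<Longrightarrow> cov M P Q c \<in> lin_maps k (obj M P) (obj M Q)"
    and con_id: "\<lbrakk>P \<in> X; m \<in> carrier (obj M P)\<rbrakk> \<Longrightarrow> con M P P (orbit_id S P) m = m"
    and cov_id: "\<lbrakk>P \<in> X; m \<in> carrier (obj M P)\<rbrakk> \<Longrightarrow> cov M P P (orbit_id S P) m = m"
    and con_comp: "\<lbrakk>P \<in> X; Q \<in> X; R \<in> X; a \<in> orbit_hom S F P Q; b \<in> orbit_hom S F Q R;
        m \<in> carrier (obj M R)\<rbrakk>
      \<Longrightarrow> con M P R (orbit_comp P b a) m = con M P Q a (con M Q R b m)"
    and cov_comp: "\<lbrakk>P \<in> X; Q \<in> X; R \<in> X; a \<in> orbit_hom S F P Q; b \<in> orbit_hom S F Q R;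
        m \<in> carrier (obj M P)\<rbrakk>
      \<Longrightarrow> cov M P R (orbit_comp P b a) m = cov M Q R b (cov M P Q a m)"
    and con_iso: "\<lbrakk>P \<in> X; Q \<in> X; a \<in> orbit_hom S F P Q; b \<in> orbit_hom S F Q P;
        orbit_comp P b a = orbit_id S P; orbit_comp Q a b = orbit_id S Q;
        m \<in> carrier (obj M Q)\<rbrakk>
      \<Longrightarrow> con M P Q a m = cov M Q P b m"
    and mackey_formula: "\<lbrakk>P \<in> X; Q \<in> X; R \<in> X; Q \<subseteq> P; R \<subseteq> P; double_coset_reps S Q P R T;
        m \<in> carrier (obj M R)\<rbrakk>
      \<Longrightarrow> con M Q P (orbit_incl S Q P) (cov M R P (orbit_incl S R P) m) =
        (\<Oplus>\<^bsub>obj M Q\<^esub> x \<in> {x \<in> T. Q \<inter> cj S x ` R \<in> X}.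
          cov M (Q \<inter> cj S x ` R) Q (orbit_incl S (Q \<inter> cj S x ` R) Q)
            (con M (Q \<inter> cj S x ` R) (cj S x ` R) (orbit_incl S (Q \<inter> cj S x ` R) (cj S x ` R))
              (cov M R (cj S x ` R) (orbit_class S R (cj S x ` R) (restrict (cj S x) R)) m)))"

definition mackey_mor ::
    "'k ring \<Rightarrow> 'g monoid \<Rightarrow> 'g homs \<Rightarrow> 'g set set \<Rightarrow> ('g, 'k, 'm) mackey \<Rightarrow> ('g, 'k, 'n) mackey
      \<Rightarrow> ('g set \<Rightarrow> 'm \<Rightarrow> 'n) \<Rightarrow> bool"
  where "mackey_mor k S F X M N \<eta> \<longleftrightarrow>
    (\<forall>P\<in>X. \<eta> P \<in> lin_maps k (obj M P) (obj N P)) \<and>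
    (\<forall>P\<in>X. \<forall>Q\<in>X. \<forall>c\<in>orbit_hom S F P Q.
      (\<forall>m\<in>carrier (obj M Q). \<eta> P (con M P Q c m) = con N P Q c (\<eta> Q m)) \<and>
      (\<forall>m\<in>carrier (obj M P). \<eta> Q (cov M P Q c m) = cov N P Q c (\<eta> P m)))"

definition mackey_iso ::
    "'k ring \<Rightarrow> 'g monoid \<Rightarrow> 'g homs \<Rightarrow> 'g set set \<Rightarrow> ('g, 'k, 'm) mackey \<Rightarrow> ('g, 'k, 'n) mackey
      \<Rightarrow> ('g set \<Rightarrow> 'm \<Rightarrow> 'n) \<Rightarrow> bool"
  where "mackey_iso k S F X M N \<eta> \<longleftrightarrow> mackey_mor k S F X M N \<eta> \<and>
    (\<exists>\<theta>. mackey_mor k S F X N M \<theta> \<and>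
      (\<forall>P\<in>X. \<forall>m\<in>carrier (obj M P). \<theta> P (\<eta> P m) = m) \<and>
      (\<forall>P\<in>X. \<forall>n\<in>carrier (obj N P). \<eta> P (\<theta> P n) = n))"

text \<open>
  Monomorphisms are tested against functors with values in the type of the source. This is no
  restriction: kernels are constructed objectwise, so the kernel of \<open>\<eta>\<close> has values in that type.
\<close>

definition mackey_mono ::
    "'k ring \<Rightarrow> 'g monoid \<Rightarrow> 'g homs \<Rightarrow> 'g set set \<Rightarrow> ('g, 'k, 'm) mackey \<Rightarrow> ('g, 'k, 'n) mackey
      \<Rightarrow> ('g set \<Rightarrow> 'm \<Rightarrow> 'n) \<Rightarrow> bool"
  where "mackey_mono k S F X M N \<eta> \<longleftrightarrow> mackey_mor k S F X M N \<eta> \<and>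
    (\<forall>(T :: ('g, 'k, 'm) mackey) f g.
      mackey_functor k S F X T \<and> mackey_mor k S F X T M f \<and> mackey_mor k S F X T M g \<and>
      (\<forall>P\<in>X. \<forall>t\<in>carrier (obj T P). \<eta> P (f P t) = \<eta> P (g P t))
      \<longrightarrow> (\<forall>P\<in>X. \<forall>t\<in>carrier (obj T P). f P t = g P t))"

definition mackey_zero :: "'g set set \<Rightarrow> ('g, 'k, 'm) mackey \<Rightarrow> bool"
  where "mackey_zero X M \<longleftrightarrow> (\<forall>P\<in>X. carrier (obj M P) = {\<zero>\<^bsub>obj M P\<^esub>})"

text \<open>
  A simple object is a nonzero object whose only subobjects are zero and itself. Subobjects may be
  taken with values in the type of \<open>M\<close>, since every monomorphism into \<open>M\<close> is isomorphic to the
  inclusion of its (objectwise) image.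
\<close>

definition mackey_simple ::
    "'k ring \<Rightarrow> 'g monoid \<Rightarrow> 'g homs \<Rightarrow> 'g set set \<Rightarrow> ('g, 'k, 'm) mackey \<Rightarrow> bool"
  where "mackey_simple k S F X M \<longleftrightarrow>
    mackey_functor k S F X M \<and> \<not> mackey_zero X M \<and>
    (\<forall>(N :: ('g, 'k, 'm) mackey) \<eta>.
      mackey_functor k S F X N \<and> mackey_mono k S F X N M \<eta>
      \<longrightarrow> mackey_zero X N \<or> mackey_iso k S F X N M \<eta>)"


section \<open>The functors \<open>S\<^bsub>Q,V\<^esub>\<close>\<close>

text \<open>
  The choices entering the construction: \<open>\<alpha> L : Q \<rightarrow> L\<close> for every \<open>F\<close>-conjugate \<open>L\<close> of \<open>Q\<close>, and for
  every \<open>P\<close> a set \<open>reps P\<close> of representatives of the \<open>P\<close>-conjugacy classes of subgroups of \<open>P\<close> that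
  are \<open>F\<close>-conjugate to \<open>Q\<close>.
\<close>

definition webb_choice ::
    "('g, 'z) monoid_scheme \<Rightarrow> 'g homs \<Rightarrow> 'g set \<Rightarrow> ('g set \<Rightarrow> 'g \<Rightarrow> 'g) \<Rightarrow> ('g set \<Rightarrow> 'g set set) \<Rightarrow> bool"
  where "webb_choice S F Q \<alpha> reps \<longleftrightarrow>
    (\<forall>L. fus_conj S F Q L \<longrightarrow> \<alpha> L \<in> fus_iso F Q L) \<and>
    (\<forall>P. subgroup P S \<longrightarrow>
      (\<forall>L\<in>reps P. L \<subseteq> P \<and> fus_conj S F Q L) \<and>
      (\<forall>L. L \<subseteq> P \<and> fus_conj S F Q L \<longrightarrow> (\<exists>!L'. L' \<in> reps P \<and> (\<exists>g\<in>P. cj S g ` L = L'))))"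

locale webb_construction =
  fixes S :: "'g monoid" and F :: "'g homs" and Q :: "'g set"
    and V :: "('k, 'v) module" and \<rho> :: "('g \<Rightarrow> 'g) set \<Rightarrow> 'v \<Rightarrow> 'v"
    and \<alpha> :: "'g set \<Rightarrow> 'g \<Rightarrow> 'g" and reps :: "'g set \<Rightarrow> 'g set set"
begin

text \<open>
  \<open>push L\<^sub>1 L\<^sub>2 \<gamma>\<close> is \<open>\<gamma>\<^sub>*\<close>, \<open>v \<mapsto> [\<alpha>\<^bsub>L\<^sub>2\<^esub>\<inverse> \<gamma> \<alpha>\<^bsub>L\<^sub>1\<^esub>] v\<close>. For \<open>L\<^sub>1 = L\<^sub>2 = L\<close> this is the
  action of \<open>Out\<^sub>F(L)\<close> on \<open>V\<close> twisted by \<open>\<alpha> L\<close>.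
\<close>

definition push :: "'g set \<Rightarrow> 'g set \<Rightarrow> ('g \<Rightarrow> 'g) \<Rightarrow> 'v \<Rightarrow> 'v"
  where "push L1 L2 \<gamma> =
    \<rho> (Inn S Q #>\<^bsub>fus_Aut F Q\<^esub> compose Q (inv_map Q (\<alpha> L2)) (compose Q \<gamma> (\<alpha> L1)))"

definition cpush :: "'g set \<Rightarrow> 'g \<Rightarrow> 'v \<Rightarrow> 'v"
  where "cpush L g = push L (cj S g ` L) (restrict (cj S g) L)"

definition nrm :: "'g set \<Rightarrow> 'g set \<Rightarrow> 'g set"
  where "nrm P L = P \<inter> normalizer S L"

text \<open>For \<open>g\<close> in \<open>nrm P L\<close>, \<open>cpush L g\<close> is the action of \<open>g\<close> on the twisted module of \<open>L\<close>.\<close>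

definition fixed :: "'g set \<Rightarrow> 'g set \<Rightarrow> 'v set"
  where "fixed L H = {v \<in> carrier V. \<forall>h\<in>H. cpush L h v = v}"

definition tr :: "'g set \<Rightarrow> 'g set \<Rightarrow> 'g set \<Rightarrow> 'v \<Rightarrow> 'v"
  where "tr L H K v = (\<Oplus>\<^bsub>V\<^esub> C \<in> (\<lambda>g. g <#\<^bsub>S\<^esub> H) ` K. cpush L (SOME g. g \<in> C) v)"

definition summand :: "'g set \<Rightarrow> 'g set \<Rightarrow> 'v set"
  where "summand P L = tr L L (nrm P L) ` fixed L L"

text \<open>The fields \<open>mult\<close> and \<open>one\<close> of a module record carry no meaning.\<close>

definition smod :: "'g set \<Rightarrow> ('k, 'g set \<Rightarrow> 'v) module"
  where "smod P = \<lparr>carrier = (\<Pi>\<^sub>E L\<in>reps P. summand P L), monoid.mult = undefined, one = undefined,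
    zero = (\<lambda>L\<in>reps P. \<zero>\<^bsub>V\<^esub>), add = (\<lambda>f g. \<lambda>L\<in>reps P. f L \<oplus>\<^bsub>V\<^esub> g L),
    smult = (\<lambda>a f. \<lambda>L\<in>reps P. a \<odot>\<^bsub>V\<^esub> f L)\<rparr>"

text \<open>
  \<open>emb P L\<close> sends \<open>v\<close> in \<open>summand P L\<close>, for any \<open>L \<le> P\<close> that is \<open>F\<close>-conjugate to \<open>Q\<close>, to the element of
  \<open>smod P\<close> with which it is identified, supported on the representative of \<open>L\<close>.
\<close>

definition to_rep :: "'g set \<Rightarrow> 'g set \<Rightarrow> 'g"
  where "to_rep P L = (SOME g. g \<in> P \<and> cj S g ` L \<in> reps P)"

definition emb :: "'g set \<Rightarrow> 'g set \<Rightarrow> 'v \<Rightarrow> 'g set \<Rightarrow> 'v"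
  where "emb P L v =
    (\<lambda>L'\<in>reps P. if L' = cj S (to_rep P L) ` L then cpush L (to_rep P L) v else \<zero>\<^bsub>V\<^esub>)"

definition siso :: "'g set \<Rightarrow> 'g set \<Rightarrow> ('g \<Rightarrow> 'g) \<Rightarrow> ('g set \<Rightarrow> 'v) \<Rightarrow> 'g set \<Rightarrow> 'v"
  where "siso P R \<phi> f =
    (\<Oplus>\<^bsub>smod R\<^esub> L \<in> reps P. emb R (\<phi> ` L) (push L (\<phi> ` L) (restrict \<phi> L) (f L)))"

definition stransfer :: "'g set \<Rightarrow> 'g set \<Rightarrow> ('g set \<Rightarrow> 'v) \<Rightarrow> 'g set \<Rightarrow> 'v"
  where "stransfer P R f = (\<Oplus>\<^bsub>smod P\<^esub> L \<in> reps R. emb P L (tr L (nrm R L) (nrm P L) (f L)))"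

definition srestr :: "'g set \<Rightarrow> 'g set \<Rightarrow> ('g set \<Rightarrow> 'v) \<Rightarrow> 'g set \<Rightarrow> 'v"
  where "srestr P R f = (\<Oplus>\<^bsub>smod R\<^esub> L \<in> reps P. (\<lambda>L'\<in>reps R.
    if \<exists>g\<in>P. cj S g ` L = L' then cpush L (SOME g. g \<in> P \<and> cj S g ` L = L') (f L) else \<zero>\<^bsub>V\<^esub>))"

definition simple_mackey :: "('g, 'k, 'g set \<Rightarrow> 'v) mackey"
  where "simple_mackey = \<lparr>obj = smod,
    con = (\<lambda>P R c. let \<phi> = (SOME \<phi>. \<phi> \<in> c) in
      siso (\<phi> ` P) P (inv_map P \<phi>) \<circ> srestr R (\<phi> ` P)),
    cov = (\<lambda>P R c. let \<phi> = (SOME \<phi>. \<phi> \<in> c) in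
      stransfer R (\<phi> ` P) \<circ> siso P (\<phi> ` P) \<phi>)\<rparr>"

end

abbreviation "simple_mackey \<equiv> webb_construction.simple_mackey"

context fusion_system
begin

lemma webb_choice_exists:
  "\<exists>\<alpha> reps. webb_choice S F Q \<alpha> reps"
proof -
  define \<alpha> where "\<alpha> L = (SOME \<phi>. \<phi> \<in> fus_iso F Q L)" for L
  define A where "A P = {L. L \<subseteq> P \<and> fus_conj S F Q L}" for P
  define r where "r P L = (SOME L'. L' \<in> A P \<and> (\<exists>g\<in>P. cj S g ` L = L'))" for P L
  define reps where "reps P = r P ` A P" for P
  have cj_cj: "cj S g ` cj S h ` L = cj S (g \<otimes> h) ` L"
    if "g \<in> carrier S" "h \<in> carrier S" "L \<subseteq> carrier S" for g h L
    unfolding image_image using that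
    by (intro image_cong) (auto simp: cj_def m_assoc inv_mult_group subset_iff)
  have cj_one: "cj S \<one> ` L = L" if "L \<subseteq> carrier S" for L
    using that by (auto simp: cj_def image_iff subset_iff)
  have "(\<forall>L\<in>reps P. L \<subseteq> P \<and> fus_conj S F Q L) \<and>
      (\<forall>L. L \<subseteq> P \<and> fus_conj S F Q L \<longrightarrow> (\<exists>!L'. L' \<in> reps P \<and> (\<exists>g\<in>P. cj S g ` L = L')))"
    if P: "subgroup P S" for P
  proof -
    interpret P: subgroup P S by fact
    have sub: "L \<subseteq> carrier S" if "L \<in> A P" for L
      using that P.subset by (auto simp: A_def)
    have r: "r P L \<in> A P \<and> (\<exists>g\<in>P. cj S g ` L = r P L)" if "L \<in> A P" for L
    proof -
      have "L \<in> A P \<and> (\<exists>g\<in>P. cj S g ` L = L)"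
        using that cj_one[OF sub[OF that]] P.one_closed by (intro conjI bexI[of _ \<one>])
      then show ?thesis unfolding r_def by (rule someI)
    qed
    have conj_r: "r P (cj S g ` L) = r P L" if "L \<in> A P" "g \<in> P" for L g
    proof -
      have "(\<exists>h\<in>P. cj S h ` cj S g ` L = L') \<longleftrightarrow> (\<exists>h\<in>P. cj S h ` L = L')" for L'
      proof
        assume "\<exists>h\<in>P. cj S h ` cj S g ` L = L'"
        then obtain h where "h \<in> P" "cj S h ` cj S g ` L = L'" by blast
        then show "\<exists>h\<in>P. cj S h ` L = L'"
          using that sub by (intro bexI[of _ "h \<otimes> g"]) (auto simp: cj_cj)
      next
        assume "\<exists>h\<in>P. cj S h ` L = L'"
        then obtain h where h: "h \<in> P" "cj S h ` L = L'" by blast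
        have "cj S (h \<otimes> inv g) ` cj S g ` L = cj S (h \<otimes> inv g \<otimes> g) ` L"
          using that h sub by (intro cj_cj) auto
        also have "h \<otimes> inv g \<otimes> g = h"
          using that h by (simp add: m_assoc)
        finally show "\<exists>h\<in>P. cj S h ` cj S g ` L = L'"
          using that h by (intro bexI[of _ "h \<otimes> inv g"]) auto
      qed
      then show ?thesis by (simp add: r_def)
    qed
    show ?thesis
    proof (intro conjI ballI allI impI)
      fix L assume "L \<in> reps P"
      then show "L \<subseteq> P" "fus_conj S F Q L"
        using r by (auto simp: reps_def A_def)
    next
      fix L assume "L \<subseteq> P \<and> fus_conj S F Q L"
      then have L: "L \<in> A P" by (simp add: A_def)
      show "\<exists>!L'. L' \<in> reps P \<and> (\<exists>g\<in>P. cj S g ` L = L')"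
      proof (rule ex1I[of _ "r P L"])
        show "r P L \<in> reps P \<and> (\<exists>g\<in>P. cj S g ` L = r P L)"
          using r[OF L] L by (auto simp: reps_def)
      next
        fix L' assume L': "L' \<in> reps P \<and> (\<exists>g\<in>P. cj S g ` L = L')"
        then obtain K where K: "K \<in> A P" "L' = r P K" by (auto simp: reps_def)
        then obtain h where "h \<in> P" "cj S h ` K = L'" using r[OF K(1)] by auto
        then have "r P L' = r P K" using conj_r[OF K(1)] by auto
        moreover have "r P L' = r P L" using conj_r[OF L] L' by auto
        ultimately show "L' = r P L" using K by simp
      qed
    qed
  qed
  moreover have "\<alpha> L \<in> fus_iso F Q L" if "fus_conj S F Q L" for L
    using that by (simp add: \<alpha>_def fus_conj_def some_in_eq)
  ultimately have "webb_choice S F Q \<alpha> reps"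
    unfolding webb_choice_def by simp
  then show ?thesis by (intro exI)
qed

end

end

theory Submission
  imports Defs
begin

text \<open>
  For a \<open>k Out\<^sub>F(Q)\<close>-module \<open>V\<close>, the functions \<open>f\<close> on \<open>Hom\<^sub>F(Q, P)\<close> with values in \<open>V\<close> that are
  equivariant under \<open>Aut\<^sub>F(Q)\<close> and invariant under \<open>P\<close> form a Mackey functor: restriction along
  \<open>\<alpha>\<close> is \<open>f \<mapsto> f(\<alpha> _)\<close>, and transfer is extension by zero followed by a sum over cosets. Evaluation at
  the identity identifies its value at \<open>Q\<close> with \<open>V\<close>. A nonzero subfunctor is nonzero at \<open>Q\<close>, so for
  simple \<open>V\<close> it contains the subfunctor generated by the value at \<open>Q\<close>, which is therefore simple;
  evaluation at the chosen isomorphisms \<open>\<alpha> L\<close> identifies the latter with \<open>S\<^bsub>Q,V\<^esub>\<close>.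

  Conversely, let \<open>M\<close> be simple, \<open>Q\<close> of least order with \<open>M(Q) \<noteq> 0\<close>, and \<open>V = M(Q)\<close>. Then
  \<open>m \<mapsto> (\<phi> \<mapsto> M\<^sup>*(\<phi>) m)\<close> is a morphism from \<open>M\<close> to that functor, because minimality of \<open>Q\<close> leaves only the
  terms with \<open>\<phi>(Q)\<close> contained in a conjugate of the image of \<open>\<alpha>\<close> in the Mackey formula for
  \<open>M\<^sup>*(\<phi>) M\<^sub>*(\<alpha>)\<close>. It is injective on \<open>M(Q)\<close>, hence injective, and its image is the generated subfunctor.
\<close>

section \<open>Linear maps and submodules\<close>

text \<open>Webb's formulas depend on the choices \<open>\<alpha>\<close> and \<open>reps\<close>;
  checking the Mackey axioms for them directly would mean checking independence of choices at every
  step. The functions on \<open>F Q P\<close> involve no choice: their axioms are identities between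
  sums over cosets, mostly instances of one splitting rule. The axioms for S_{Q,V}, and even the
  module axioms for its values, are then transported along a bijection. Evaluation at
  \<open>\<alpha> L\<close> hits Webb's summand because in a transfer from Q, evaluated there, only
  cosets inside the normaliser of L contribute, and these add up to the relative trace.
  Overconjugacy closure enters above all through one fact: if Q lies in X, a subgroup outside X
  receives no morphism from Q. This kills the double cosets that the restricted Mackey formula
  omits, and the values outside X. The generated subfunctor is stable under restriction because a
  subgroup smaller than Q receives no morphism from Q either. For the only-if half, S_{Q,V} is
  nonzero at Q, so vanishing outside X puts Q into X.\<close>

lemma lin_mapsI:
  assumes "\<And>x. x \<in> carrier A \<Longrightarrow> f x \<in> carrier B"
    and "\<And>x y. \<lbrakk>x \<in> carrier A; y \<in> carrier A\<rbrakk> \<Longrightarrow> f (x \<oplus>\<^bsub>A\<^esub> y) = f x \<oplus>\<^bsub>B\<^esub> f y"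
    and "\<And>a x. \<lbrakk>a \<in> carrier k; x \<in> carrier A\<rbrakk> \<Longrightarrow> f (a \<odot>\<^bsub>A\<^esub> x) = a \<odot>\<^bsub>B\<^esub> f x"
  shows "f \<in> lin_maps k A B"
  using assms by (auto simp: lin_maps_def hom_def)

lemma lin_mapsD:
  assumes "f \<in> lin_maps k A B"
  shows "x \<in> carrier A \<Longrightarrow> f x \<in> carrier B"
    and "\<lbrakk>x \<in> carrier A; y \<in> carrier A\<rbrakk> \<Longrightarrow> f (x \<oplus>\<^bsub>A\<^esub> y) = f x \<oplus>\<^bsub>B\<^esub> f y"
    and "\<lbrakk>a \<in> carrier k; x \<in> carrier A\<rbrakk> \<Longrightarrow> f (a \<odot>\<^bsub>A\<^esub> x) = a \<odot>\<^bsub>B\<^esub> f x"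
  using assms by (auto simp: lin_maps_def hom_def)

lemma lin_maps_zero:
  assumes "module k A" "module k B" "f \<in> lin_maps k A B"
  shows "f \<zero>\<^bsub>A\<^esub> = \<zero>\<^bsub>B\<^esub>"
proof -
  interpret A: module k A by fact
  interpret B: module k B by fact
  have "f \<zero>\<^bsub>A\<^esub> \<oplus>\<^bsub>B\<^esub> f \<zero>\<^bsub>A\<^esub> = f \<zero>\<^bsub>A\<^esub>"
    using lin_mapsD(2)[OF assms(3), of "\<zero>\<^bsub>A\<^esub>" "\<zero>\<^bsub>A\<^esub>"] by simp
  then show ?thesis
    using lin_mapsD(1)[OF assms(3), of "\<zero>\<^bsub>A\<^esub>"] by (metis A.zero_closed B.add.l_cancel_one')
qed

lemma lin_maps_finsum:
  assumes "module k A" "module k B" "f \<in> lin_maps k A B" "h \<in> I \<rightarrow> carrier A"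
  shows "f (\<Oplus>\<^bsub>A\<^esub> i\<in>I. h i) = (\<Oplus>\<^bsub>B\<^esub> i\<in>I. f (h i))"
proof -
  interpret A: module k A by fact
  interpret B: module k B by fact
  show ?thesis
    using assms(4)
  proof (induction I rule: infinite_finite_induct)
    case (insert x I)
    then have "(\<lambda>i. f (h i)) \<in> I \<rightarrow> carrier B" "h \<in> I \<rightarrow> carrier A" "h x \<in> carrier A"
      using lin_mapsD(1)[OF assms(3)] by auto
    with insert show ?case
      by (simp add: lin_mapsD[OF assms(3)] A.finsum_closed)
  \<comment> \<open>For an infinite index set both sums are zero by convention.\<close>
  qed (auto simp: lin_maps_zero[OF assms(1-3)] A.finsum_infinite B.finsum_infinite)
qed

lemma lin_maps_a_inv:
  assumes "module k A" "module k B" "f \<in> lin_maps k A B" "x \<in> carrier A"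
  shows "f (\<ominus>\<^bsub>A\<^esub> x) = \<ominus>\<^bsub>B\<^esub> f x"
proof -
  interpret A: module k A by fact
  interpret B: module k B by fact
  have "f (\<ominus>\<^bsub>A\<^esub> x) \<oplus>\<^bsub>B\<^esub> f x = \<zero>\<^bsub>B\<^esub>"
    using assms(4) lin_maps_zero[OF assms(1-3)]
    by (simp add: A.l_neg flip: lin_mapsD(2)[OF assms(3)])
  then show ?thesis
    using B.minus_equality lin_mapsD(1)[OF assms(3)] assms(4) by (metis A.a_inv_closed)
qed

text \<open>Negation is multiplication by the scalar -1, so closure under it follows from closure
  under scalars.\<close>

lemma submodule_of_closed:
  assumes "module k A" "W \<subseteq> carrier A" "\<zero>\<^bsub>A\<^esub> \<in> W"
    and "\<And>x y. \<lbrakk>x \<in> W; y \<in> W\<rbrakk> \<Longrightarrow> x \<oplus>\<^bsub>A\<^esub> y \<in> W"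
    and "\<And>a x. \<lbrakk>a \<in> carrier k; x \<in> W\<rbrakk> \<Longrightarrow> a \<odot>\<^bsub>A\<^esub> x \<in> W"
  shows "submodule W k A"
proof -
  interpret A: module k A by fact
  have "\<ominus>\<^bsub>A\<^esub> x \<in> W" if "x \<in> W" for x
  proof -
    have "\<ominus>\<^bsub>A\<^esub> x = (\<ominus>\<^bsub>k\<^esub> \<one>\<^bsub>k\<^esub>) \<odot>\<^bsub>A\<^esub> x"
      using that assms(2) A.smult_l_minus[of "\<one>\<^bsub>k\<^esub>" x] by auto
    then show ?thesis using that assms(5) by simp
  qed
  then show ?thesis using assms by (intro A.submoduleI) auto
qed

lemma submoduleD:
  assumes "module k A" "submodule W k A"
  shows "W \<subseteq> carrier A" "\<zero>\<^bsub>A\<^esub> \<in> W"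
    and "\<And>x y. \<lbrakk>x \<in> W; y \<in> W\<rbrakk> \<Longrightarrow> x \<oplus>\<^bsub>A\<^esub> y \<in> W"
    and "\<And>a x. \<lbrakk>a \<in> carrier k; x \<in> W\<rbrakk> \<Longrightarrow> a \<odot>\<^bsub>A\<^esub> x \<in> W"
    and "\<And>x. x \<in> W \<Longrightarrow> \<ominus>\<^bsub>A\<^esub> x \<in> W"
  using module.submoduleE[OF assms] submodule.axioms(1)[OF assms(2), THEN subgroup.one_closed] by auto

lemma submodule_zero:
  assumes "module k A"
  shows "submodule {\<zero>\<^bsub>A\<^esub>} k A"
proof -
  interpret A: module k A by fact
  show ?thesis by (rule submodule_of_closed[OF assms]) auto
qed

lemma submodule_incl_lin:
  assumes "module k A" "submodule W k A"
  shows "module k (A\<lparr>carrier := W\<rparr>)" "(\<lambda>x. x) \<in> lin_maps k (A\<lparr>carrier := W\<rparr>) A"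
  using submodule.submodule_is_module[OF assms(2,1)] submoduleD[OF assms]
  by (auto intro!: lin_mapsI)

text \<open>The two sums live in different records. The inclusion is linear, and linear maps commute
  with finite sums.\<close>

lemma submodule_finsum:
  assumes "module k A" "submodule W k A" "h \<in> I \<rightarrow> W"
  shows "(\<Oplus>\<^bsub>A\<lparr>carrier := W\<rparr>\<^esub> i\<in>I. h i) = (\<Oplus>\<^bsub>A\<^esub> i\<in>I. h i)"
  using lin_maps_finsum[OF submodule_incl_lin(1)[OF assms(1,2)] assms(1)
      submodule_incl_lin(2)[OF assms(1,2)], of h I] assms(3) by simp

lemma submodule_finsum_closed:
  assumes "module k A" "submodule W k A" "h \<in> I \<rightarrow> W"
  shows "(\<Oplus>\<^bsub>A\<^esub> i\<in>I. h i) \<in> W"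
proof -
  interpret W: module k "A\<lparr>carrier := W\<rparr>" by (rule submodule_incl_lin[OF assms(1,2)])
  show ?thesis
    using W.finsum_closed[of h I] assms(3) submodule_finsum[OF assms] by simp
qed

lemma kernel_submodule:
  assumes "module k A" "module k B" "f \<in> lin_maps k A B" "submodule W k B"
  shows "submodule {x \<in> carrier A. f x \<in> W} k A"
proof -
  interpret A: module k A by fact
  interpret B: module k B by fact
  note W = submoduleD[OF assms(2,4)]
  show ?thesis
    by (rule submodule_of_closed[OF assms(1)])
      (auto simp: lin_mapsD[OF assms(3)] lin_maps_zero[OF assms(1-3)] W)
qed

lemma image_submodule:
  assumes "module k A" "module k B" "f \<in> lin_maps k A B" "submodule W k A"
  shows "submodule (f ` W) k B"
proof -
  interpret A: module k A by fact
  interpret B: module k B by fact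
  note W = submoduleD[OF assms(1,4)]
  note f = lin_mapsD[OF assms(3)]
  show ?thesis
  proof (rule submodule_of_closed[OF assms(2)])
    show "f ` W \<subseteq> carrier B" using W f by auto
    show "\<zero>\<^bsub>B\<^esub> \<in> f ` W" using W(2) lin_maps_zero[OF assms(1-3)] by (metis imageI)
  next
    fix x y assume "x \<in> f ` W" "y \<in> f ` W"
    then obtain x' y' where "x' \<in> W" "y' \<in> W" "x = f x'" "y = f y'" by auto
    then show "x \<oplus>\<^bsub>B\<^esub> y \<in> f ` W"
      using W(1,3) f(2)[of x' y', symmetric] by auto
  next
    fix a x assume a: "a \<in> carrier k" and "x \<in> f ` W"
    then obtain x' where "x' \<in> W" "x = f x'" by auto
    then show "a \<odot>\<^bsub>B\<^esub> x \<in> f ` W"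
      using W(1,4) f(3)[of a x', symmetric] a by auto
  qed
qed

lemma lin_maps_inj_on:
  assumes "module k A" "module k B" "f \<in> lin_maps k A B"
    and "\<And>x. \<lbrakk>x \<in> carrier A; f x = \<zero>\<^bsub>B\<^esub>\<rbrakk> \<Longrightarrow> x = \<zero>\<^bsub>A\<^esub>"
  shows "inj_on f (carrier A)"
proof (rule inj_onI)
  interpret A: module k A by fact
  interpret B: module k B by fact
  fix x y assume xy: "x \<in> carrier A" "y \<in> carrier A" "f x = f y"
  have "f (x \<oplus>\<^bsub>A\<^esub> \<ominus>\<^bsub>A\<^esub> y) = \<zero>\<^bsub>B\<^esub>"
    using xy lin_mapsD[OF assms(3)] lin_maps_a_inv[OF assms(1-3)] by (simp add: B.r_neg)
  then have "x \<oplus>\<^bsub>A\<^esub> \<ominus>\<^bsub>A\<^esub> y = \<zero>\<^bsub>A\<^esub>" using assms(4) xy by simp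
  then show "x = y" using xy by (metis A.add.inv_closed A.minus_equality A.minus_minus A.add.m_comm)
qed


section \<open>Morphisms of a fusion system\<close>

context fusion_system
begin

abbreviation "sbg P \<equiv> subgroup P S"

lemma sbgD:
  assumes "sbg P"
  shows "x \<in> P \<Longrightarrow> x \<in> carrier S" "\<one> \<in> P" "\<lbrakk>x \<in> P; y \<in> P\<rbrakk> \<Longrightarrow> x \<otimes> y \<in> P" "x \<in> P \<Longrightarrow> inv x \<in> P"
    "P \<subseteq> carrier S"
  using assms by (auto simp: subgroup_def)

lemma finite_S: "finite (carrier S)"
proof -
  obtain n where "order S = p ^ n" using p_group by blast
  then have "card (carrier S) \<noteq> 0"
    using prime_p by (simp add: order_def prime_gt_0_nat)
  then show ?thesis using card_ge_0_finite by blast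
qed

lemma finite_sbg: "sbg P \<Longrightarrow> finite P"
  using finite_S finite_subset sbgD(5) by blast

lemma cj_closed [simp]: "\<lbrakk>x \<in> carrier S; u \<in> carrier S\<rbrakk> \<Longrightarrow> cj S x u \<in> carrier S"
  by (simp add: cj_def)

lemma cj_cj: "\<lbrakk>x \<in> carrier S; y \<in> carrier S; u \<in> carrier S\<rbrakk> \<Longrightarrow> cj S x (cj S y u) = cj S (x \<otimes> y) u"
  by (simp add: cj_def m_assoc inv_mult_group)

lemma cj_one [simp]: "u \<in> carrier S \<Longrightarrow> cj S \<one> u = u"
  by (simp add: cj_def)

lemma cj_inv_cj [simp]:
  "\<lbrakk>x \<in> carrier S; u \<in> carrier S\<rbrakk> \<Longrightarrow> cj S (inv x) (cj S x u) = u"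
  "\<lbrakk>x \<in> carrier S; u \<in> carrier S\<rbrakk> \<Longrightarrow> cj S x (cj S (inv x) u) = u"
  by (simp_all add: cj_cj)

lemma cj_mem: "\<lbrakk>sbg P; x \<in> P; u \<in> P\<rbrakk> \<Longrightarrow> cj S x u \<in> P"
  by (simp add: cj_def sbgD)

lemma cj_image_cj: "\<lbrakk>x \<in> carrier S; y \<in> carrier S; A \<subseteq> carrier S\<rbrakk> \<Longrightarrow> cj S x ` cj S y ` A = cj S (x \<otimes> y) ` A"
  unfolding image_image by (intro image_cong) (auto simp: cj_cj)

lemma cj_image_one: "A \<subseteq> carrier S \<Longrightarrow> cj S \<one> ` A = A"
  by (auto simp: image_iff subset_iff)

lemma cj_image_self: "\<lbrakk>sbg P; x \<in> P\<rbrakk> \<Longrightarrow> cj S x ` P = P"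
proof
  assume P: "sbg P" "x \<in> P"
  show "cj S x ` P \<subseteq> P" using P cj_mem by auto
  show "P \<subseteq> cj S x ` P"
  proof
    fix u assume "u \<in> P"
    then show "u \<in> cj S x ` P"
      using P by (intro image_eqI[of _ _ "cj S (inv x) u"]) (auto simp: sbgD cj_mem)
  qed
qed

lemma cj_image_mono:
  "\<lbrakk>sbg P; x \<in> P; A \<subseteq> P\<rbrakk> \<Longrightarrow> cj S x ` A \<subseteq> P"
  using cj_mem by auto

lemma cj_image_inv: "\<lbrakk>x \<in> carrier S; A \<subseteq> carrier S\<rbrakk> \<Longrightarrow> cj S (inv x) ` cj S x ` A = A"
  "\<lbrakk>x \<in> carrier S; A \<subseteq> carrier S\<rbrakk> \<Longrightarrow> cj S x ` cj S (inv x) ` A = A"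
  by (simp_all add: cj_image_cj cj_image_one)

lemma hom_mem: "\<lbrakk>sbg P; sbg R; \<phi> \<in> F P R; u \<in> P\<rbrakk> \<Longrightarrow> \<phi> u \<in> R"
  using hom_mon[of P R \<phi>] by (auto simp: mon_def hom_def)

lemma hom_image: "\<lbrakk>sbg P; sbg R; \<phi> \<in> F P R\<rbrakk> \<Longrightarrow> \<phi> ` P \<subseteq> R"
  using hom_mem by auto

lemma hom_mult': "\<lbrakk>sbg P; sbg R; \<phi> \<in> F P R; u \<in> P; v \<in> P\<rbrakk> \<Longrightarrow> \<phi> (u \<otimes> v) = \<phi> u \<otimes> \<phi> v"
  using hom_mon[of P R \<phi>] by (auto simp: mon_def hom_def)

lemma hom_inj: "\<lbrakk>sbg P; sbg R; \<phi> \<in> F P R\<rbrakk> \<Longrightarrow> inj_on \<phi> P"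
  using hom_mon[of P R \<phi>] by (auto simp: mon_def)

lemma endo_image: "\<lbrakk>sbg P; \<phi> \<in> F P P\<rbrakk> \<Longrightarrow> \<phi> ` P = P"
  using hom_image[of P P \<phi>] hom_inj[of P P \<phi>] finite_sbg[of P] by (metis endo_inj_surj)

lemma hom_ext: "\<lbrakk>sbg P; sbg R; \<phi> \<in> F P R\<rbrakk> \<Longrightarrow> \<phi> \<in> extensional P"
  using hom_mon[of P R \<phi>] by auto

lemma hom_group_hom:
  assumes "sbg P" "sbg R" "\<phi> \<in> F P R"
  shows "group_hom (S\<lparr>carrier := P\<rparr>) (S\<lparr>carrier := R\<rparr>) \<phi>"
  using hom_mon[OF assms] assms(1,2)
  by (auto simp: group_hom_def group_hom_axioms_def mon_def subgroup.subgroup_is_group)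

lemma hom_inv': "\<lbrakk>sbg P; sbg R; \<phi> \<in> F P R; u \<in> P\<rbrakk> \<Longrightarrow> \<phi> (inv u) = inv (\<phi> u)"
  using group_hom.hom_inv[OF hom_group_hom, of P R \<phi> u] by (simp add: m_inv_consistent hom_mem)

lemma hom_cj: "\<lbrakk>sbg P; sbg R; \<phi> \<in> F P R; x \<in> P; u \<in> P\<rbrakk> \<Longrightarrow> \<phi> (cj S x u) = cj S (\<phi> x) (\<phi> u)"
  by (simp add: cj_def hom_mult' hom_inv' sbgD)

lemma hom_image_sbg: "\<lbrakk>sbg P; sbg R; \<phi> \<in> F P R; sbg A; A \<subseteq> P\<rbrakk> \<Longrightarrow> sbg (\<phi> ` A)"
proof -
  assume *: "sbg P" "sbg R" "\<phi> \<in> F P R" "sbg A" "A \<subseteq> P"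
  have 1: "\<phi> \<one> = \<one>"
    using group_hom.hom_one[OF hom_group_hom[OF *(1-3)]] by simp
  show ?thesis
  proof
    show "\<phi> ` A \<subseteq> carrier S" using * hom_mem sbgD by blast
    show "\<one> \<in> \<phi> ` A" using 1 * sbgD by (metis imageI)
  next
    fix x y assume "x \<in> \<phi> ` A" "y \<in> \<phi> ` A"
    then obtain x' y' where "x' \<in> A" "y' \<in> A" "x = \<phi> x'" "y = \<phi> y'" by auto
    then show "x \<otimes> y \<in> \<phi> ` A"
      using hom_mult'[OF *(1-3), of x' y'] * sbgD(3)[OF *(4)] by (metis imageI subsetD)
  next
    fix x assume "x \<in> \<phi> ` A"
    then obtain x' where "x' \<in> A" "x = \<phi> x'" by auto
    then show "inv x \<in> \<phi> ` A"
      using hom_inv'[OF *(1-3), of x'] * sbgD(4)[OF *(4)] by (metis imageI subsetD)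
  qed
qed

lemma cj_image_sbg: "\<lbrakk>sbg P; x \<in> carrier S\<rbrakk> \<Longrightarrow> sbg (cj S x ` P)"
proof -
  assume P: "sbg P" "x \<in> carrier S"
  have "restrict (cj S x) P \<in> F P (carrier S)"
    using P by (intro hom_conj) (auto simp: subgroup_self sbgD)
  then have "sbg (restrict (cj S x) P ` P)"
    using P by (intro hom_image_sbg[of P "carrier S"]) (auto simp: subgroup_self)
  then show ?thesis by simp
qed

lemma hom_incl: "\<lbrakk>sbg P; sbg R; P \<subseteq> R\<rbrakk> \<Longrightarrow> (\<lambda>u\<in>P. u) \<in> F P R"
proof -
  assume *: "sbg P" "sbg R" "P \<subseteq> R"
  have "cj S \<one> ` P \<subseteq> R" using * by (simp add: cj_image_one sbgD)
  then have "restrict (cj S \<one>) P \<in> F P R" using * by (intro hom_conj) auto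
  also have "restrict (cj S \<one>) P = (\<lambda>u\<in>P. u)"
    using * by (intro restrict_ext) (auto simp: sbgD)
  finally show ?thesis .
qed

lemma hom_iso_image: "\<lbrakk>sbg P; sbg R; \<phi> \<in> F P R\<rbrakk> \<Longrightarrow> \<phi> \<in> F P (\<phi> ` P)"
  using hom_factor[of P R \<phi>] by (auto simp: fus_iso_def)

text \<open>Factor through the image and include the image in the new target: a morphism does not
  remember its target beyond the fact that it contains the image.\<close>

lemma hom_change: "\<lbrakk>sbg P; sbg R; \<phi> \<in> F P R; sbg A; \<phi> ` P \<subseteq> A\<rbrakk> \<Longrightarrow> \<phi> \<in> F P A"
proof -
  assume *: "sbg P" "sbg R" "\<phi> \<in> F P R" "sbg A" "\<phi> ` P \<subseteq> A"
  have sb: "sbg (\<phi> ` P)" using * hom_image_sbg by blast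
  have "compose P (\<lambda>u\<in>\<phi> ` P. u) \<phi> \<in> F P A"
    using * sb hom_iso_image[OF *(1-3)] hom_incl[OF sb *(4,5)] by (intro hom_comp[of P "\<phi> ` P" A]) auto
  also have "compose P (\<lambda>u\<in>\<phi> ` P. u) \<phi> = \<phi>"
    using hom_ext[OF *(1-3)] by (intro extensionalityI[of _ P]) (auto simp: compose_def)
  finally show ?thesis .
qed

text \<open>The factorisation axiom yields some inverse inside \<open>F\<close>. Extensionality
  forces it to be the concrete \<open>inv_map\<close>, so inverses can be used below without a
  choice.\<close>

lemma hom_inv_map:
  assumes "sbg P" "sbg R" "\<phi> \<in> F P R"
  shows "inv_map P \<phi> \<in> F (\<phi> ` P) P" "compose P (inv_map P \<phi>) \<phi> = (\<lambda>u\<in>P. u)"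
    "compose (\<phi> ` P) \<phi> (inv_map P \<phi>) = (\<lambda>u\<in>\<phi> ` P. u)" "u \<in> P \<Longrightarrow> inv_map P \<phi> (\<phi> u) = u"
    "inv_map P \<phi> ` \<phi> ` P = P"
proof -
  note inj = hom_inj[OF assms]
  obtain \<psi> where \<psi>: "\<psi> \<in> F (\<phi> ` P) P" "compose P \<psi> \<phi> = (\<lambda>u\<in>P. u)"
    using hom_factor[OF assms] by (auto simp: fus_iso_def)
  have sb: "sbg (\<phi> ` P)" using assms hom_image_sbg by blast
  have "\<psi> = inv_map P \<phi>"
  proof (rule extensionalityI[of _ "\<phi> ` P"])
    show "\<psi> \<in> extensional (\<phi> ` P)" using hom_ext[OF sb assms(1) \<psi>(1)] .
    show "inv_map P \<phi> \<in> extensional (\<phi> ` P)" by (simp add: inv_map_def)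
    fix y assume "y \<in> \<phi> ` P"
    then obtain u where "u \<in> P" "y = \<phi> u" by auto
    moreover from this have "\<psi> (\<phi> u) = u" using fun_cong[OF \<psi>(2), of u] by (simp add: compose_def)
    ultimately show "\<psi> y = inv_map P \<phi> y" using inj by (simp add: inv_map_def)
  qed
  then show "inv_map P \<phi> \<in> F (\<phi> ` P) P" "compose P (inv_map P \<phi>) \<phi> = (\<lambda>u\<in>P. u)" using \<psi> by auto
  show "compose (\<phi> ` P) \<phi> (inv_map P \<phi>) = (\<lambda>u\<in>\<phi> ` P. u)"
    by (auto simp: compose_def restrict_def inv_map_def f_inv_into_f fun_eq_iff)
  show *: "inv_map P \<phi> (\<phi> u) = u" if "u \<in> P" for u using inj that by (simp add: inv_map_def)
  show "inv_map P \<phi> ` \<phi> ` P = P" using * by (auto simp: image_iff)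
qed

lemma compose_assoc':
  "\<phi> ` P \<subseteq> R \<Longrightarrow> compose P \<chi> (compose P \<psi> \<phi>) = compose P (compose R \<chi> \<psi>) \<phi>"
  by (auto simp: compose_def restrict_def fun_eq_iff)

lemma compose_restrict: "\<phi> ` P \<subseteq> R \<Longrightarrow> compose P (restrict \<psi> R) \<phi> = compose P \<psi> \<phi>"
  by (auto simp: compose_def restrict_def fun_eq_iff)

lemma compose_id: "\<phi> \<in> extensional P \<Longrightarrow> compose P \<phi> (\<lambda>u\<in>P. u) = \<phi>"
  by (auto simp: compose_def restrict_def fun_eq_iff extensional_def)

lemma compose_incl: "\<lbrakk>\<phi> \<in> extensional P; \<phi> ` P \<subseteq> R\<rbrakk> \<Longrightarrow> compose P (\<lambda>u\<in>R. u) \<phi> = \<phi>"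
  by (auto simp: compose_def restrict_def fun_eq_iff extensional_def)

lemma compose_cj_compose:
  "\<lbrakk>x \<in> carrier S; y \<in> carrier S; \<phi> ` P \<subseteq> carrier S\<rbrakk>
    \<Longrightarrow> compose P (cj S x) (compose P (cj S y) \<phi>) = compose P (cj S (x \<otimes> y)) \<phi>"
  by (auto simp: compose_def restrict_def fun_eq_iff cj_cj)

lemma compose_cj_one: "\<lbrakk>\<phi> \<in> extensional P; \<phi> ` P \<subseteq> carrier S\<rbrakk> \<Longrightarrow> compose P (cj S \<one>) \<phi> = \<phi>"
  by (auto simp: compose_def restrict_def fun_eq_iff extensional_def)

lemma compose_image: "compose P \<psi> \<phi> ` P = \<psi> ` \<phi> ` P"
  by (auto simp: compose_def)

lemma hom_comp_cj:
  assumes "sbg P" "sbg R" "\<phi> \<in> F P R" "sbg A" "x \<in> carrier S" "cj S x ` \<phi> ` P \<subseteq> A"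
  shows "compose P (cj S x) \<phi> \<in> F P A"
proof -
  have sb: "sbg (\<phi> ` P)" using assms hom_image_sbg by blast
  have "compose P (restrict (cj S x) (\<phi> ` P)) \<phi> \<in> F P A"
    using assms sb by (intro hom_comp[of P "\<phi> ` P" A] hom_iso_image[of P R] hom_conj) auto
  then show ?thesis by (simp add: compose_restrict)
qed

lemma hom_comp_cj': "\<lbrakk>sbg P; sbg R; \<phi> \<in> F P R; x \<in> R\<rbrakk> \<Longrightarrow> compose P (cj S x) \<phi> \<in> F P R"
  using hom_comp_cj[of P R \<phi> R x] sbgD(1)[of R x] cj_image_mono[of R x "\<phi> ` P"] hom_image by blast

lemma hom_comp_cj_hom:
  assumes "sbg P" "sbg R" "sbg T" "\<phi> \<in> F P R" "\<psi> \<in> F R T" "x \<in> R"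
  shows "compose P \<psi> (compose P (cj S x) \<phi>) = compose P (cj S (\<psi> x)) (compose P \<psi> \<phi>)"
  using assms by (intro ext) (simp add: compose_def hom_cj hom_mem)


section \<open>The orbit category\<close>

lemma orbit_class_eq:
  assumes "sbg P" "sbg R" "\<phi> \<in> F P R"
  shows "orbit_class S P R \<phi> = (\<lambda>x. compose P (cj S x) \<phi>) ` R"
  unfolding orbit_class_def Inn_def image_image
  using hom_image[OF assms] by (intro image_cong) (auto simp: compose_restrict)

lemma orbit_class_self: "\<lbrakk>sbg P; sbg R; \<phi> \<in> F P R\<rbrakk> \<Longrightarrow> \<phi> \<in> orbit_class S P R \<phi>"
proof -
  assume *: "sbg P" "sbg R" "\<phi> \<in> F P R"
  have "compose P (cj S \<one>) \<phi> = \<phi>"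
    using * hom_mem by (intro compose_cj_one hom_ext[of P R]) (auto simp: sbgD)
  then show ?thesis using * sbgD(2)[of R] by (force simp: orbit_class_eq image_iff)
qed

lemma orbit_class_cj:
  assumes "sbg P" "sbg R" "\<phi> \<in> F P R" "x \<in> R"
  shows "orbit_class S P R (compose P (cj S x) \<phi>) = orbit_class S P R \<phi>"
proof -
  have im: "\<phi> ` P \<subseteq> carrier S" using assms hom_image sbgD(5) by blast
  have "orbit_class S P R (compose P (cj S x) \<phi>) = (\<lambda>y. compose P (cj S y) (compose P (cj S x) \<phi>)) ` R"
    using assms by (simp add: orbit_class_eq hom_comp_cj')
  also have "\<dots> = (\<lambda>y. compose P (cj S (y \<otimes> x)) \<phi>) ` R"
    using assms im by (intro image_cong) (auto simp: compose_cj_compose sbgD)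
  also have "\<dots> = (\<lambda>y. compose P (cj S y) \<phi>) ` R"
  proof -
    have "(\<lambda>y. y \<otimes> x) ` R = R"
    proof
      show "(\<lambda>y. y \<otimes> x) ` R \<subseteq> R" using assms sbgD by auto
      show "R \<subseteq> (\<lambda>y. y \<otimes> x) ` R"
        using assms by (intro subsetI, rule_tac x = "xa \<otimes> inv x" in image_eqI) (auto simp: sbgD m_assoc)
    qed
    then show ?thesis using image_image[of "\<lambda>y. compose P (cj S y) \<phi>" "\<lambda>y. y \<otimes> x" R] by simp
  qed
  finally show ?thesis using assms by (simp add: orbit_class_eq)
qed

lemma orbit_homE:
  assumes "c \<in> orbit_hom S F P R"
  obtains \<phi> where "\<phi> \<in> F P R" "c = orbit_class S P R \<phi>"
  using assms by (auto simp: orbit_hom_def)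

lemma orbit_homI: "\<phi> \<in> F P R \<Longrightarrow> orbit_class S P R \<phi> \<in> orbit_hom S F P R"
  by (simp add: orbit_hom_def)

lemma orbit_class_eqD:
  assumes "sbg P" "sbg R" "\<phi> \<in> F P R" "\<psi> \<in> F P R" "orbit_class S P R \<phi> = orbit_class S P R \<psi>"
  obtains x where "x \<in> R" "\<phi> = compose P (cj S x) \<psi>"
  using orbit_class_self[OF assms(1-3)] assms by (auto simp: orbit_class_eq)

text \<open>The concrete functors below select a representative of a class by SOME. The selected
  morphism differs from the given one only by conjugation with an element of the target, which the
  functors ignore.\<close>

lemma orbit_class_some:
  assumes "sbg P" "sbg R" "\<phi> \<in> F P R"
  obtains x where "x \<in> R" "(SOME \<psi>. \<psi> \<in> orbit_class S P R \<phi>) = compose P (cj S x) \<phi>"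
proof -
  have "(SOME \<psi>. \<psi> \<in> orbit_class S P R \<phi>) \<in> orbit_class S P R \<phi>"
    using orbit_class_self[OF assms] by (rule someI[of "\<lambda>\<psi>. \<psi> \<in> orbit_class S P R \<phi>"])
  then show ?thesis using that assms by (auto simp: orbit_class_eq)
qed

text \<open>An inner automorphism c_x of the middle object moves past \<psi> as conjugation by
  \<psi>(x), and the class of \<psi> absorbs it.\<close>

lemma orbit_comp_class:
  assumes "sbg P" "sbg R" "sbg T" "\<phi> \<in> F P R" "\<psi> \<in> F R T"
  shows "orbit_comp P (orbit_class S R T \<psi>) (orbit_class S P R \<phi>) = orbit_class S P T (compose P \<psi> \<phi>)"
proof -
  have im: "\<psi> ` \<phi> ` P \<subseteq> carrier S" "\<psi> ` R \<subseteq> carrier S" "\<phi> ` P \<subseteq> R"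
    using assms hom_image sbgD(5) by blast+
  have c: "compose P \<psi> \<phi> \<in> F P T" using assms hom_comp by blast
  have *: "compose P (compose R (cj S y) \<psi>) (compose P (cj S x) \<phi>)
      = compose P (cj S (y \<otimes> \<psi> x)) (compose P \<psi> \<phi>)" if "x \<in> R" "y \<in> T" for x y
  proof -
    have "compose P (cj S x) \<phi> ` P \<subseteq> R"
      using im that assms cj_image_mono[of R x "\<phi> ` P"] by (simp add: compose_image)
    then have "compose P (compose R (cj S y) \<psi>) (compose P (cj S x) \<phi>)
        = compose P (cj S y) (compose P \<psi> (compose P (cj S x) \<phi>))"
      by (simp add: compose_assoc')
    also have "\<dots> = compose P (cj S y) (compose P (cj S (\<psi> x)) (compose P \<psi> \<phi>))"
      using assms that by (simp add: hom_comp_cj_hom)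
    also have "\<dots> = compose P (cj S (y \<otimes> \<psi> x)) (compose P \<psi> \<phi>)"
      using im that assms sbgD(1)[of T] hom_mem[of R T \<psi> x]
      by (intro compose_cj_compose) (auto simp: compose_image)
    finally show ?thesis .
  qed
  have "orbit_comp P (orbit_class S R T \<psi>) (orbit_class S P R \<phi>)
    = {compose P (cj S (y \<otimes> \<psi> x)) (compose P \<psi> \<phi>) | y x. y \<in> T \<and> x \<in> R}"
    (is "?A = ?B")
  proof (rule Set.set_eqI)
    fix \<chi>
    have "\<chi> \<in> ?A \<longleftrightarrow> (\<exists>y\<in>T. \<exists>x\<in>R. \<chi> = compose P (compose R (cj S y) \<psi>) (compose P (cj S x) \<phi>))"
      using assms unfolding orbit_comp_def by (simp only: orbit_class_eq) blast
    also have "\<dots> \<longleftrightarrow> (\<exists>y\<in>T. \<exists>x\<in>R. \<chi> = compose P (cj S (y \<otimes> \<psi> x)) (compose P \<psi> \<phi>))"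
      by (intro bex_cong refl) (simp add: *)
    finally show "\<chi> \<in> ?A \<longleftrightarrow> \<chi> \<in> ?B" by blast
  qed
  also have "\<dots> = (\<lambda>y. compose P (cj S y) (compose P \<psi> \<phi>)) ` T"
  proof
    show "{compose P (cj S (y \<otimes> \<psi> x)) (compose P \<psi> \<phi>) | y x. y \<in> T \<and> x \<in> R}
        \<subseteq> (\<lambda>y. compose P (cj S y) (compose P \<psi> \<phi>)) ` T"
      using hom_mem[OF assms(2,3,5)] sbgD(3)[OF assms(3)] by auto
    \<comment> \<open>For the reverse inclusion the inner automorphism of the middle object is taken
      trivial.\<close>
    have "\<psi> \<one> = \<one>"
      using group_hom.hom_one[OF hom_group_hom[OF assms(2,3,5)]] by simp
    then have "y = y \<otimes> \<psi> \<one>" if "y \<in> T" for y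
      using that sbgD(1)[OF assms(3)] by simp
    then show "(\<lambda>y. compose P (cj S y) (compose P \<psi> \<phi>)) ` T
        \<subseteq> {compose P (cj S (y \<otimes> \<psi> x)) (compose P \<psi> \<phi>) | y x. y \<in> T \<and> x \<in> R}"
      using sbgD(2)[OF assms(2)] by (auto 4 3 intro: arg_cong[where f = "\<lambda>y. compose P (cj S y) (compose P \<psi> \<phi>)"])
  qed
  finally show ?thesis using assms c by (simp add: orbit_class_eq)
qed

end

section \<open>Mackey functors and their subfunctors\<close>

text \<open>B is a bare record here. Its zero is just a field, so preservation of zero does not
  follow from additivity and is a hypothesis. The lemma serves for records such as
  \<open>smod\<close>, whose closure properties are not evident from their definition.\<close>

lemma module_transport:
  assumes A: "module k A" and f: "f \<in> lin_maps k A B" and bij: "bij_betw f (carrier A) (carrier B)"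
    and zero: "f \<zero>\<^bsub>A\<^esub> = \<zero>\<^bsub>B\<^esub>"
  shows "module k B"
proof -
  interpret A: module k A by fact
  have im: "carrier B = f ` carrier A" using bij by (simp add: bij_betw_def)
  note [simp] = lin_mapsD(2,3)[OF f, symmetric]
  have B: "\<zero>\<^bsub>B\<^esub> \<in> carrier B" using zero im by (metis A.M.zero_closed imageI)
  show ?thesis
  proof (rule moduleI)
    show "cring k" by (rule A.R.is_cring)
    show "abelian_group B"
    proof (rule abelian_groupI)
      fix x assume "x \<in> carrier B"
      then obtain x' where x': "x' \<in> carrier A" "x = f x'" using im by auto
      then show "\<exists>y\<in>carrier B. y \<oplus>\<^bsub>B\<^esub> x = \<zero>\<^bsub>B\<^esub>"
        using im zero by (intro bexI[of _ "f (\<ominus>\<^bsub>A\<^esub> x')"]) (auto simp: A.M.l_neg)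
      show "\<zero>\<^bsub>B\<^esub> \<oplus>\<^bsub>B\<^esub> x = x" using x' by (simp flip: zero)
    qed (use im B A.M.a_assoc A.M.a_comm in \<open>auto simp: A.M.a_assoc A.M.a_comm\<close>)
  qed (use im in \<open>auto simp: A.smult_l_distr A.smult_r_distr A.smult_assoc1\<close>)
qed

definition subfunctor ::
    "'k ring \<Rightarrow> 'g monoid \<Rightarrow> 'g homs \<Rightarrow> 'g set set \<Rightarrow> ('g, 'k, 'm) mackey \<Rightarrow> ('g set \<Rightarrow> 'm set) \<Rightarrow> bool"
  where "subfunctor k S F X M N \<longleftrightarrow>
    (\<forall>P\<in>X. submodule (N P) k (obj M P)) \<and>
    (\<forall>P\<in>X. \<forall>R\<in>X. \<forall>\<phi>\<in>F P R.
      (\<forall>m\<in>N R. con M P R (orbit_class S P R \<phi>) m \<in> N P) \<and>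
      (\<forall>m\<in>N P. cov M P R (orbit_class S P R \<phi>) m \<in> N R))"

definition sub_mackey :: "('g, 'k, 'm) mackey \<Rightarrow> ('g set \<Rightarrow> 'm set) \<Rightarrow> ('g, 'k, 'm) mackey"
  where "sub_mackey M N = M\<lparr>obj := \<lambda>P. (obj M P)\<lparr>carrier := N P\<rparr>\<rparr>"

lemma sub_mackey_simps [simp]:
  "obj (sub_mackey M N) P = (obj M P)\<lparr>carrier := N P\<rparr>"
  "con (sub_mackey M N) = con M" "cov (sub_mackey M N) = cov M"
  by (simp_all add: sub_mackey_def)

lemma mackey_morI:
  assumes "\<And>P. P \<in> X \<Longrightarrow> \<eta> P \<in> lin_maps k (obj M P) (obj N P)"
    and "\<And>P R \<phi> m. \<lbrakk>P \<in> X; R \<in> X; \<phi> \<in> F P R; m \<in> carrier (obj M R)\<rbrakk>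
      \<Longrightarrow> \<eta> P (con M P R (orbit_class S P R \<phi>) m) = con N P R (orbit_class S P R \<phi>) (\<eta> R m)"
    and "\<And>P R \<phi> m. \<lbrakk>P \<in> X; R \<in> X; \<phi> \<in> F P R; m \<in> carrier (obj M P)\<rbrakk>
      \<Longrightarrow> \<eta> R (cov M P R (orbit_class S P R \<phi>) m) = cov N P R (orbit_class S P R \<phi>) (\<eta> P m)"
  shows "mackey_mor k S F X M N \<eta>"
  using assms unfolding mackey_mor_def orbit_hom_def by blast

lemma mackey_morD:
  assumes "mackey_mor k S F X M N \<eta>"
  shows "P \<in> X \<Longrightarrow> \<eta> P \<in> lin_maps k (obj M P) (obj N P)"
    and "\<lbrakk>P \<in> X; R \<in> X; \<phi> \<in> F P R; m \<in> carrier (obj M R)\<rbrakk>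
      \<Longrightarrow> \<eta> P (con M P R (orbit_class S P R \<phi>) m) = con N P R (orbit_class S P R \<phi>) (\<eta> R m)"
    and "\<lbrakk>P \<in> X; R \<in> X; \<phi> \<in> F P R; m \<in> carrier (obj M P)\<rbrakk>
      \<Longrightarrow> \<eta> R (cov M P R (orbit_class S P R \<phi>) m) = cov N P R (orbit_class S P R \<phi>) (\<eta> P m)"
  using assms unfolding mackey_mor_def orbit_hom_def by blast+

lemma mackey_mor_comp:
  assumes "mackey_mor k S F X L M \<eta>" "mackey_mor k S F X M N \<theta>"
  shows "mackey_mor k S F X L N (\<lambda>P m. \<theta> P (\<eta> P m))"
proof (rule mackey_morI)
  fix P assume P: "P \<in> X"
  note 1 = lin_mapsD[OF mackey_morD(1)[OF assms(1) P]] lin_mapsD[OF mackey_morD(1)[OF assms(2) P]]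
  show "(\<lambda>m. \<theta> P (\<eta> P m)) \<in> lin_maps k (obj L P) (obj N P)"
    by (rule lin_mapsI) (simp_all add: 1)
qed (simp_all add: mackey_morD[OF assms(1)] mackey_morD[OF assms(2)] lin_mapsD(1)[OF mackey_morD(1)[OF assms(1)]])

lemma mackey_iso_sym:
  assumes "mackey_iso k S F X M N \<eta>"
  obtains \<theta> where "mackey_iso k S F X N M \<theta>"
  using assms unfolding mackey_iso_def by blast

lemma mackey_iso_trans:
  assumes "mackey_iso k S F X L M \<eta>" "mackey_iso k S F X M N \<theta>"
  shows "mackey_iso k S F X L N (\<lambda>P m. \<theta> P (\<eta> P m))"
proof -
  obtain \<eta>' where \<eta>': "mackey_mor k S F X M L \<eta>'"
      "\<And>P m. \<lbrakk>P \<in> X; m \<in> carrier (obj L P)\<rbrakk> \<Longrightarrow> \<eta>' P (\<eta> P m) = m"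
      "\<And>P m. \<lbrakk>P \<in> X; m \<in> carrier (obj M P)\<rbrakk> \<Longrightarrow> \<eta> P (\<eta>' P m) = m"
    and \<eta>: "mackey_mor k S F X L M \<eta>" using assms(1) unfolding mackey_iso_def by blast
  obtain \<theta>' where \<theta>': "mackey_mor k S F X N M \<theta>'"
      "\<And>P m. \<lbrakk>P \<in> X; m \<in> carrier (obj M P)\<rbrakk> \<Longrightarrow> \<theta>' P (\<theta> P m) = m"
      "\<And>P m. \<lbrakk>P \<in> X; m \<in> carrier (obj N P)\<rbrakk> \<Longrightarrow> \<theta> P (\<theta>' P m) = m"
    and \<theta>: "mackey_mor k S F X M N \<theta>" using assms(2) unfolding mackey_iso_def by blast
  note c = lin_mapsD(1)[OF mackey_morD(1)]
  show ?thesis unfolding mackey_iso_def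
    using mackey_mor_comp[OF \<eta> \<theta>] mackey_mor_comp[OF \<theta>'(1) \<eta>'(1)]
    by (intro conjI exI[of _ "\<lambda>P m. \<eta>' P (\<theta>' P m)"])
      (auto simp: \<eta>'(2,3) \<theta>'(2,3) c[OF \<eta>] c[OF \<theta>'(1)])
qed

lemma mackey_iso_bij:
  assumes "mackey_iso k S F X M N \<eta>" "P \<in> X"
  shows "bij_betw (\<eta> P) (carrier (obj M P)) (carrier (obj N P))"
proof -
  obtain \<eta>' where \<eta>': "mackey_mor k S F X N M \<eta>'"
      "\<And>P m. \<lbrakk>P \<in> X; m \<in> carrier (obj M P)\<rbrakk> \<Longrightarrow> \<eta>' P (\<eta> P m) = m"
      "\<And>P m. \<lbrakk>P \<in> X; m \<in> carrier (obj N P)\<rbrakk> \<Longrightarrow> \<eta> P (\<eta>' P m) = m"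
    and \<eta>: "mackey_mor k S F X M N \<eta>" using assms(1) unfolding mackey_iso_def by blast
  note c = lin_mapsD(1)[OF mackey_morD(1)]
  show ?thesis
    using assms(2) by (intro bij_betw_byWitness[of _ "\<eta>' P"]) (auto simp: \<eta>' c[OF \<eta>] c[OF \<eta>'(1)])
qed

text \<open>Linearity and naturality of the inverse hold because they hold after applying \<eta>,
  which is injective on the carriers of M.\<close>

lemma mackey_iso_of_bij:
  assumes "mackey_mor k S F X M N \<eta>"
    and "\<And>P. P \<in> X \<Longrightarrow> bij_betw (\<eta> P) (carrier (obj M P)) (carrier (obj N P))"
    and M: "mackey_functor k S F X M"
  shows "mackey_iso k S F X M N \<eta>"
proof -
  define \<theta> where "\<theta> P = inv_into (carrier (obj M P)) (\<eta> P)" for P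
  have 1: "\<theta> P (\<eta> P m) = m" if "P \<in> X" "m \<in> carrier (obj M P)" for P m
    using assms(2)[OF that(1)] that(2) by (simp add: \<theta>_def bij_betw_def)
  have 2: "\<eta> P (\<theta> P m) = m" "\<theta> P m \<in> carrier (obj M P)" if "P \<in> X" "m \<in> carrier (obj N P)" for P m
    using assms(2)[OF that(1)] that(2) by (auto simp: \<theta>_def bij_betw_def f_inv_into_f inv_into_into)
  note \<eta> = mackey_morD[OF assms(1)]
  interpret M: mackey_functor k S F X M by fact
  have "mackey_mor k S F X N M \<theta>"
  proof (rule mackey_morI)
    fix P assume P: "P \<in> X"
    interpret A: module k "obj M P" by (rule M.obj_module[OF P])
    show "\<theta> P \<in> lin_maps k (obj N P) (obj M P)"
    proof (rule lin_mapsI)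
      fix x y assume xy: "x \<in> carrier (obj N P)" "y \<in> carrier (obj N P)"
      then have "\<eta> P (\<theta> P x \<oplus>\<^bsub>obj M P\<^esub> \<theta> P y) = x \<oplus>\<^bsub>obj N P\<^esub> y"
        by (simp add: lin_mapsD(2)[OF \<eta>(1)[OF P]] 2 P)
      then show "\<theta> P (x \<oplus>\<^bsub>obj N P\<^esub> y) = \<theta> P x \<oplus>\<^bsub>obj M P\<^esub> \<theta> P y"
        using 1[OF P, of "\<theta> P x \<oplus>\<^bsub>obj M P\<^esub> \<theta> P y"] 2 xy P by simp
    next
      fix a x assume ax: "a \<in> carrier k" "x \<in> carrier (obj N P)"
      then have "\<eta> P (a \<odot>\<^bsub>obj M P\<^esub> \<theta> P x) = a \<odot>\<^bsub>obj N P\<^esub> x"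
        by (simp add: lin_mapsD(3)[OF \<eta>(1)[OF P]] 2 P)
      then show "\<theta> P (a \<odot>\<^bsub>obj N P\<^esub> x) = a \<odot>\<^bsub>obj M P\<^esub> \<theta> P x"
        using 1[OF P, of "a \<odot>\<^bsub>obj M P\<^esub> \<theta> P x"] 2 ax P by simp
    qed (simp add: 2 P)
  next
    fix P R \<phi> m assume *: "P \<in> X" "R \<in> X" "\<phi> \<in> F P R" "m \<in> carrier (obj N R)"
    have cl: "con M P R (orbit_class S P R \<phi>) (\<theta> R m) \<in> carrier (obj M P)"
      using lin_mapsD(1)[OF M.con_linear[OF *(1,2)]] * 2 by (auto simp: orbit_hom_def)
    have "\<eta> P (con M P R (orbit_class S P R \<phi>) (\<theta> R m)) = con N P R (orbit_class S P R \<phi>) m"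
      using * 2 by (simp add: \<eta>(2))
    then show "\<theta> P (con N P R (orbit_class S P R \<phi>) m) = con M P R (orbit_class S P R \<phi>) (\<theta> R m)"
      using 1[OF *(1) cl] by simp
  next
    fix P R \<phi> m assume *: "P \<in> X" "R \<in> X" "\<phi> \<in> F P R" "m \<in> carrier (obj N P)"
    have cl: "cov M P R (orbit_class S P R \<phi>) (\<theta> P m) \<in> carrier (obj M R)"
      using lin_mapsD(1)[OF M.cov_linear[OF *(1,2)]] * 2 by (auto simp: orbit_hom_def)
    have "\<eta> R (cov M P R (orbit_class S P R \<phi>) (\<theta> P m)) = cov N P R (orbit_class S P R \<phi>) m"
      using * 2 by (simp add: \<eta>(3))
    then show "\<theta> R (cov N P R (orbit_class S P R \<phi>) m) = cov M P R (orbit_class S P R \<phi>) (\<theta> P m)"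
      using 1[OF *(2) cl] by simp
  qed
  then show ?thesis unfolding mackey_iso_def using assms(1) 1 2 by blast
qed

locale fusion_collection = fusion_system S p F for S :: "'a monoid" (structure) and p F +
  fixes X :: "'a set set"
  assumes closed: "overconjugacy_closed S F X"
begin

lemma X_sbg: "P \<in> X \<Longrightarrow> sbg P"
  using closed by (auto simp: overconjugacy_closed_def)

lemma X_up: "\<lbrakk>P \<in> X; \<phi> \<in> F P R; sbg R\<rbrakk> \<Longrightarrow> R \<in> X"
  using closed unfolding overconjugacy_closed_def by blast

lemma X_mono: "\<lbrakk>P \<in> X; P \<subseteq> R; sbg R\<rbrakk> \<Longrightarrow> R \<in> X"
  using X_up[OF _ hom_incl[of P R]] X_sbg by blast

lemma X_image: "\<lbrakk>P \<in> X; sbg R; \<phi> \<in> F P R\<rbrakk> \<Longrightarrow> \<phi> ` P \<in> X"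
  using X_up[OF _ hom_iso_image[of P R \<phi>]] hom_image_sbg[of P R \<phi> P] X_sbg by blast

lemma cj_hom: "\<lbrakk>sbg P; x \<in> carrier S\<rbrakk> \<Longrightarrow> restrict (cj S x) P \<in> F P (cj S x ` P)"
  by (intro hom_conj cj_image_sbg) auto

lemma X_cj: "\<lbrakk>P \<in> X; x \<in> carrier S\<rbrakk> \<Longrightarrow> cj S x ` P \<in> X"
  using X_up[OF _ cj_hom[of P x]] X_sbg cj_image_sbg by blast

lemma dcr_subset: "\<lbrakk>double_coset_reps S A P B T; x \<in> T\<rbrakk> \<Longrightarrow> x \<in> P"
  by (auto simp: double_coset_reps_def)

end

abbreviation (in fusion_system) "mcon M P R \<phi> \<equiv> con M P R (orbit_class S P R \<phi>)"
abbreviation (in fusion_system) "mcov M P R \<phi> \<equiv> cov M P R (orbit_class S P R \<phi>)"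
abbreviation (in fusion_system) "incl P \<equiv> (\<lambda>u\<in>P. u)"

abbreviation (in fusion_system) "mackey_term M A B x m \<equiv>
  mcov M (A \<inter> cj S x ` B) A (incl (A \<inter> cj S x ` B))
    (mcon M (A \<inter> cj S x ` B) (cj S x ` B) (incl (A \<inter> cj S x ` B))
      (mcov M B (cj S x ` B) (restrict (cj S x) B) m))"

text \<open>Brings the axioms from orbit classes down to representatives. Only the axiom on
  isomorphisms takes work: a pair of mutually inverse classes [\<phi>], [\<psi>] has to be reduced
  to a bijective \<phi> together with its genuine inverse.\<close>

lemma (in fusion_collection) mackey_functorI:
  fixes M :: "('a, 'k, 'm) mackey"
  assumes obj: "\<And>P. P \<in> X \<Longrightarrow> module k (obj M P)"
    and con: "\<And>P R \<phi>. \<lbrakk>P \<in> X; R \<in> X; \<phi> \<in> F P R\<rbrakk> \<Longrightarrow> mcon M P R \<phi> \<in> lin_maps k (obj M R) (obj M P)"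
    and cov: "\<And>P R \<phi>. \<lbrakk>P \<in> X; R \<in> X; \<phi> \<in> F P R\<rbrakk> \<Longrightarrow> mcov M P R \<phi> \<in> lin_maps k (obj M P) (obj M R)"
    and con_id: "\<And>P m. \<lbrakk>P \<in> X; m \<in> carrier (obj M P)\<rbrakk> \<Longrightarrow> mcon M P P (incl P) m = m"
    and cov_id: "\<And>P m. \<lbrakk>P \<in> X; m \<in> carrier (obj M P)\<rbrakk> \<Longrightarrow> mcov M P P (incl P) m = m"
    and con_comp: "\<And>P R T \<phi> \<psi> m. \<lbrakk>P \<in> X; R \<in> X; T \<in> X; \<phi> \<in> F P R; \<psi> \<in> F R T; m \<in> carrier (obj M T)\<rbrakk>
      \<Longrightarrow> mcon M P T (compose P \<psi> \<phi>) m = mcon M P R \<phi> (mcon M R T \<psi> m)"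
    and cov_comp: "\<And>P R T \<phi> \<psi> m. \<lbrakk>P \<in> X; R \<in> X; T \<in> X; \<phi> \<in> F P R; \<psi> \<in> F R T; m \<in> carrier (obj M P)\<rbrakk>
      \<Longrightarrow> mcov M P T (compose P \<psi> \<phi>) m = mcov M R T \<psi> (mcov M P R \<phi> m)"
    and iso: "\<And>P R \<phi> m. \<lbrakk>P \<in> X; R \<in> X; \<phi> \<in> F P R; \<phi> ` P = R; m \<in> carrier (obj M R)\<rbrakk>
      \<Longrightarrow> mcon M P R \<phi> m = mcov M R P (inv_map P \<phi>) m"
    and mackey: "\<And>P A B T m. \<lbrakk>P \<in> X; A \<in> X; B \<in> X; A \<subseteq> P; B \<subseteq> P; double_coset_reps S A P B T;
        m \<in> carrier (obj M B)\<rbrakk>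
      \<Longrightarrow> mcon M A P (incl A) (mcov M B P (incl B) m) =
        (\<Oplus>\<^bsub>obj M A\<^esub> x \<in> {x \<in> T. A \<inter> cj S x ` B \<in> X}.
          mackey_term M A B x m)"
  shows "mackey_functor k S F X M"
proof (rule mackey_functor.intro)
  fix P Q c assume "P \<in> X" "Q \<in> X" "c \<in> orbit_hom S F P Q"
  then show "con M P Q c \<in> lin_maps k (obj M Q) (obj M P)"
    "cov M P Q c \<in> lin_maps k (obj M P) (obj M Q)"
    using con cov by (auto elim: orbit_homE)
next
  fix P Q R a b m assume *: "P \<in> X" "Q \<in> X" "R \<in> X" "a \<in> orbit_hom S F P Q" "b \<in> orbit_hom S F Q R"
  obtain \<phi> where \<phi>: "\<phi> \<in> F P Q" "a = orbit_class S P Q \<phi>" using * by (auto elim: orbit_homE)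
  obtain \<psi> where \<psi>: "\<psi> \<in> F Q R" "b = orbit_class S Q R \<psi>" using * by (auto elim: orbit_homE)
  show "con M P R (orbit_comp P b a) m = con M P Q a (con M Q R b m)" if "m \<in> carrier (obj M R)"
    using * \<phi> \<psi> that con_comp by (simp add: orbit_comp_class X_sbg)
  show "cov M P R (orbit_comp P b a) m = cov M Q R b (cov M P Q a m)" if "m \<in> carrier (obj M P)"
    using * \<phi> \<psi> that cov_comp by (simp add: orbit_comp_class X_sbg)
next
  fix P Q a b m assume *: "P \<in> X" "Q \<in> X" "a \<in> orbit_hom S F P Q" "b \<in> orbit_hom S F Q P"
    and ab: "orbit_comp P b a = orbit_id S P" "orbit_comp Q a b = orbit_id S Q"
    and m: "m \<in> carrier (obj M Q)"
  obtain \<phi> where \<phi>: "\<phi> \<in> F P Q" "a = orbit_class S P Q \<phi>" using * by (auto elim: orbit_homE)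
  obtain \<psi> where \<psi>: "\<psi> \<in> F Q P" "b = orbit_class S Q P \<psi>" using * by (auto elim: orbit_homE)
  have sb: "sbg P" "sbg Q" using * X_sbg by auto
  have "orbit_class S P P (compose P \<psi> \<phi>) = orbit_class S P P (incl P)"
    using ab(1) \<phi> \<psi> sb by (simp add: orbit_comp_class orbit_incl_def)
  \<comment> \<open>The composite \<psi> \<phi> represents the identity of P, hence is conjugation
    by some x in P.\<close>
  then obtain x where x: "x \<in> P" "compose P \<psi> \<phi> = compose P (cj S x) (incl P)"
    using sb hom_comp[OF sb(1,2,1) \<phi>(1) \<psi>(1)] hom_incl[OF sb(1) sb(1)] orbit_class_eqD[OF sb(1,1)]
    by (metis subset_refl)
  \<comment> \<open>Injections in both directions between finite groups force equal orders, so
    \<phi> is onto and \<psi> is its inverse followed by c_x.\<close>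
  have card: "card (\<phi> ` P) = card P" "card (\<psi> ` Q) = card Q"
    using hom_inj[OF sb \<phi>(1)] hom_inj[OF sb(2,1) \<psi>(1)] by (auto intro: card_image)
  have "card P \<le> card Q" "card Q \<le> card P"
    using hom_image[OF sb \<phi>(1)] hom_image[OF sb(2,1) \<psi>(1)] card card_mono[OF finite_sbg[OF sb(1)]]
      card_mono[OF finite_sbg[OF sb(2)]] by metis+
  then have im: "\<phi> ` P = Q"
    using hom_image[OF sb \<phi>(1)] card finite_sbg[OF sb(2)] by (intro card_subset_eq) auto
  have iQ: "inv_map P \<phi> \<in> F Q P" using hom_inv_map[OF sb \<phi>(1)] im by simp
  have "\<psi> = compose Q (cj S x) (inv_map P \<phi>)"
  proof (rule extensionalityI[of _ Q])
    show "\<psi> \<in> extensional Q" using hom_ext[OF sb(2,1) \<psi>(1)] .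
    show "compose Q (cj S x) (inv_map P \<phi>) \<in> extensional Q" by simp
    fix v assume "v \<in> Q"
    then obtain u where u: "u \<in> P" "v = \<phi> u" using im by auto
    then show "\<psi> v = compose Q (cj S x) (inv_map P \<phi>) v"
      using fun_cong[OF x(2), of u] \<open>v \<in> Q\<close> hom_inv_map(4)[OF sb \<phi>(1)] by (simp add: compose_def)
  qed
  then have "orbit_class S Q P \<psi> = orbit_class S Q P (inv_map P \<phi>)"
    using x sb iQ by (simp add: orbit_class_cj)
  then show "con M P Q a m = cov M Q P b m"
    using iso[OF *(1,2) \<phi>(1) im m] \<phi> \<psi> by simp
qed (use obj con_id cov_id mackey in \<open>auto simp: orbit_incl_def\<close>)

section \<open>The axioms on representatives, subfunctors, and simplicity\<close>

locale mackey_on = fusion_collection S p F X + M: mackey_functor k S F X M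
  for S :: "'a monoid" (structure) and p F X and k :: "'k ring" and M :: "('a, 'k, 'm) mackey"
begin

lemma mcon_lin: "\<lbrakk>P \<in> X; R \<in> X; \<phi> \<in> F P R\<rbrakk> \<Longrightarrow> mcon M P R \<phi> \<in> lin_maps k (obj M R) (obj M P)"
  by (simp add: M.con_linear orbit_homI)

lemma mcov_lin: "\<lbrakk>P \<in> X; R \<in> X; \<phi> \<in> F P R\<rbrakk> \<Longrightarrow> mcov M P R \<phi> \<in> lin_maps k (obj M P) (obj M R)"
  by (simp add: M.cov_linear orbit_homI)

lemma mcon_closed: "\<lbrakk>P \<in> X; R \<in> X; \<phi> \<in> F P R; m \<in> carrier (obj M R)\<rbrakk> \<Longrightarrow> mcon M P R \<phi> m \<in> carrier (obj M P)"
  using lin_mapsD(1)[OF mcon_lin] by blast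

lemma mcov_closed: "\<lbrakk>P \<in> X; R \<in> X; \<phi> \<in> F P R; m \<in> carrier (obj M P)\<rbrakk> \<Longrightarrow> mcov M P R \<phi> m \<in> carrier (obj M R)"
  using lin_mapsD(1)[OF mcov_lin] by blast

lemma mcon_zero: "\<lbrakk>P \<in> X; R \<in> X; \<phi> \<in> F P R\<rbrakk> \<Longrightarrow> mcon M P R \<phi> \<zero>\<^bsub>obj M R\<^esub> = \<zero>\<^bsub>obj M P\<^esub>"
  using lin_maps_zero[OF M.obj_module M.obj_module mcon_lin] by blast

lemma mcov_zero: "\<lbrakk>P \<in> X; R \<in> X; \<phi> \<in> F P R\<rbrakk> \<Longrightarrow> mcov M P R \<phi> \<zero>\<^bsub>obj M P\<^esub> = \<zero>\<^bsub>obj M R\<^esub>"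
  using lin_maps_zero[OF M.obj_module M.obj_module mcov_lin] by blast

lemma mcon_id: "\<lbrakk>P \<in> X; m \<in> carrier (obj M P)\<rbrakk> \<Longrightarrow> mcon M P P (incl P) m = m"
  using M.con_id by (simp add: orbit_incl_def)

lemma mcov_id: "\<lbrakk>P \<in> X; m \<in> carrier (obj M P)\<rbrakk> \<Longrightarrow> mcov M P P (incl P) m = m"
  using M.cov_id by (simp add: orbit_incl_def)

lemma mcon_comp: "\<lbrakk>P \<in> X; R \<in> X; T \<in> X; \<phi> \<in> F P R; \<psi> \<in> F R T; m \<in> carrier (obj M T)\<rbrakk>
    \<Longrightarrow> mcon M P R \<phi> (mcon M R T \<psi> m) = mcon M P T (compose P \<psi> \<phi>) m"
  using M.con_comp[of P R T "orbit_class S P R \<phi>" "orbit_class S R T \<psi>" m]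
  by (simp add: orbit_comp_class X_sbg orbit_homI)

lemma mcov_comp: "\<lbrakk>P \<in> X; R \<in> X; T \<in> X; \<phi> \<in> F P R; \<psi> \<in> F R T; m \<in> carrier (obj M P)\<rbrakk>
    \<Longrightarrow> mcov M R T \<psi> (mcov M P R \<phi> m) = mcov M P T (compose P \<psi> \<phi>) m"
  using M.cov_comp[of P R T "orbit_class S P R \<phi>" "orbit_class S R T \<psi>" m]
  by (simp add: orbit_comp_class X_sbg orbit_homI)

lemma mcon_iso:
  assumes "P \<in> X" "R \<in> X" "\<phi> \<in> F P R" "\<phi> ` P = R" "m \<in> carrier (obj M R)"
  shows "mcon M P R \<phi> m = mcov M R P (inv_map P \<phi>) m"
proof -
  note sb = X_sbg[OF assms(1)] X_sbg[OF assms(2)]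
  note i = hom_inv_map[OF sb assms(3)]
  show ?thesis
    using assms i sb
    by (intro M.con_iso) (auto simp: orbit_homI orbit_comp_class orbit_incl_def)
qed

lemma mackey_formula':
  assumes "P \<in> X" "A \<in> X" "B \<in> X" "A \<subseteq> P" "B \<subseteq> P" "double_coset_reps S A P B T" "m \<in> carrier (obj M B)"
  shows "mcon M A P (incl A) (mcov M B P (incl B) m) =
        (\<Oplus>\<^bsub>obj M A\<^esub> x \<in> {x \<in> T. A \<inter> cj S x ` B \<in> X}.
          mackey_term M A B x m)"
  using M.mackey_formula[OF assms] by (simp add: orbit_incl_def)

lemma subfunctorD:
  assumes "subfunctor k S F X M N"
  shows "P \<in> X \<Longrightarrow> submodule (N P) k (obj M P)" "P \<in> X \<Longrightarrow> N P \<subseteq> carrier (obj M P)"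
    and "\<lbrakk>P \<in> X; R \<in> X; \<phi> \<in> F P R; m \<in> N R\<rbrakk> \<Longrightarrow> mcon M P R \<phi> m \<in> N P"
    and "\<lbrakk>P \<in> X; R \<in> X; \<phi> \<in> F P R; m \<in> N P\<rbrakk> \<Longrightarrow> mcov M P R \<phi> m \<in> N R"
  using assms submoduleD(1)[OF M.obj_module] unfolding subfunctor_def by blast+

lemma subfunctor_mackey:
  assumes N: "subfunctor k S F X M N"
  shows "mackey_functor k S F X (sub_mackey M N)"
proof (rule mackey_functorI)
  note D = subfunctorD[OF N]
  note sub = subsetD[OF D(2)]
  fix P assume P: "P \<in> X"
  show "module k (obj (sub_mackey M N) P)"
    using submodule_incl_lin(1)[OF M.obj_module[OF P] D(1)[OF P]] by simp
  fix R \<phi> assume R: "R \<in> X" "\<phi> \<in> F P R"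
  show "mcon (sub_mackey M N) P R \<phi> \<in> lin_maps k (obj (sub_mackey M N) R) (obj (sub_mackey M N) P)"
    using P R D lin_mapsD[OF mcon_lin[OF P R]] sub by (auto intro!: lin_mapsI)
  show "mcov (sub_mackey M N) P R \<phi> \<in> lin_maps k (obj (sub_mackey M N) P) (obj (sub_mackey M N) R)"
    using P R D lin_mapsD[OF mcov_lin[OF P R]] sub by (auto intro!: lin_mapsI)
  fix m
  show "mcon (sub_mackey M N) P R \<phi> m = mcov (sub_mackey M N) R P (inv_map P \<phi>) m"
    if "\<phi> ` P = R" "m \<in> carrier (obj (sub_mackey M N) R)"
    using that P R sub by (simp add: mcon_iso)
  fix T \<psi> assume T: "T \<in> X" "\<psi> \<in> F R T"
  show "mcon (sub_mackey M N) P T (compose P \<psi> \<phi>) m = mcon (sub_mackey M N) P R \<phi> (mcon (sub_mackey M N) R T \<psi> m)"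
    if "m \<in> carrier (obj (sub_mackey M N) T)"
    using P R T sub that by (simp add: mcon_comp)
  show "mcov (sub_mackey M N) P T (compose P \<psi> \<phi>) m = mcov (sub_mackey M N) R T \<psi> (mcov (sub_mackey M N) P R \<phi> m)"
    if "m \<in> carrier (obj (sub_mackey M N) P)"
    using P R T sub that by (simp add: mcov_comp)
next
  note sub = subsetD[OF subfunctorD(2)[OF N]]
  fix P m assume "P \<in> X" "m \<in> carrier (obj (sub_mackey M N) P)"
  then show "mcon (sub_mackey M N) P P (incl P) m = m" "mcov (sub_mackey M N) P P (incl P) m = m"
    using sub by (simp_all add: mcon_id mcov_id)
next
  note D = subfunctorD[OF N]
  fix P A B T m
  assume *: "P \<in> X" "A \<in> X" "B \<in> X" "A \<subseteq> P" "B \<subseteq> P" "double_coset_reps S A P B T"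
    and m: "m \<in> carrier (obj (sub_mackey M N) B)"
  have m': "m \<in> N B" "m \<in> carrier (obj M B)" using m D(2)[OF *(3)] by auto
  \<comment> \<open>Each term of the Mackey sum already lies in the subobject, so the sum may be
    computed there or in M with the same result.\<close>
  have cl: "mackey_term M A B x m \<in> N A"
    if x: "x \<in> {x \<in> T. A \<inter> cj S x ` B \<in> X}" for x
  proof -
    have xS: "x \<in> carrier S" using x * dcr_subset sbgD(1) X_sbg by blast
    have cX: "cj S x ` B \<in> X" using X_cj * xS by blast
    have h: "restrict (cj S x) B \<in> F B (cj S x ` B)" using cj_hom X_sbg * xS by blast
    have i: "incl (A \<inter> cj S x ` B) \<in> F (A \<inter> cj S x ` B) A"
      "incl (A \<inter> cj S x ` B) \<in> F (A \<inter> cj S x ` B) (cj S x ` B)"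
      using x * cX by (auto intro!: hom_incl X_sbg)
    show ?thesis
      using x * cX h i m' by (intro D(3,4)) auto
  qed
  show "mcon (sub_mackey M N) A P (incl A) (mcov (sub_mackey M N) B P (incl B) m) =
        (\<Oplus>\<^bsub>obj (sub_mackey M N) A\<^esub> x \<in> {x \<in> T. A \<inter> cj S x ` B \<in> X}.
          mackey_term (sub_mackey M N) A B x m)"
    using mackey_formula'[OF * m'(2)] cl
      submodule_finsum[OF M.obj_module[OF *(2)] D(1)[OF *(2)],
        of _ "{x \<in> T. A \<inter> cj S x ` B \<in> X}"] by (simp add: Pi_iff)
qed

end

text \<open>The source of all subfunctors to which simplicity is applied: kernels, preimages of the
  generated subfunctor, and preimages of functions with values in a given submodule.\<close>

lemma (in fusion_collection) preimage_subfunctor: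
  assumes M: "mackey_functor k S F X M" and N: "mackey_functor k S F X N"
    and \<eta>: "mackey_mor k S F X M N \<eta>" and W: "subfunctor k S F X N W"
  shows "subfunctor k S F X M (\<lambda>P. {m \<in> carrier (obj M P). \<eta> P m \<in> W P})"
proof -
  interpret M: mackey_on S p F X k M using M by (simp add: mackey_on_def fusion_collection_axioms)
  interpret N: mackey_on S p F X k N using N by (simp add: mackey_on_def fusion_collection_axioms)
  show ?thesis
    unfolding subfunctor_def
    using N.subfunctorD[OF W] mackey_morD[OF \<eta>]
    by (auto intro!: kernel_submodule M.M.obj_module N.M.obj_module M.mcon_closed M.mcov_closed)
qed

lemma (in fusion_collection) image_subfunctor:
  assumes M: "mackey_functor k S F X M" and N: "mackey_functor k S F X N"
    and \<eta>: "mackey_mor k S F X M N \<eta>" and W: "subfunctor k S F X M W"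
  shows "subfunctor k S F X N (\<lambda>P. \<eta> P ` W P)"
proof -
  interpret M: mackey_on S p F X k M using M by (simp add: mackey_on_def fusion_collection_axioms)
  interpret N: mackey_on S p F X k N using N by (simp add: mackey_on_def fusion_collection_axioms)
  note W = M.subfunctorD[OF W]
  note \<eta> = mackey_morD[OF \<eta>]
  have "mcon N P R \<phi> (\<eta> R m) \<in> \<eta> P ` W P" if "P \<in> X" "R \<in> X" "\<phi> \<in> F P R" "m \<in> W R" for P R \<phi> m
    using \<eta>(2)[OF that(1-3), of m] that W(2)[OF that(2)] W(3)[OF that] by (metis imageI subsetD)
  moreover have "mcov N P R \<phi> (\<eta> P m) \<in> \<eta> R ` W R" if "P \<in> X" "R \<in> X" "\<phi> \<in> F P R" "m \<in> W P" for P R \<phi> m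
    using \<eta>(3)[OF that(1-3), of m] that W(2)[OF that(1)] W(4)[OF that] by (metis imageI subsetD)
  moreover have "submodule (\<eta> P ` W P) k (obj N P)" if "P \<in> X" for P
    using that by (intro image_submodule[OF M.M.obj_module N.M.obj_module \<eta>(1) W(1)])
  ultimately show ?thesis unfolding subfunctor_def by auto
qed

context mackey_on
begin

lemma zero_subfunctor: "subfunctor k S F X M (\<lambda>P. {\<zero>\<^bsub>obj M P\<^esub>})"
  unfolding subfunctor_def using submodule_zero[OF M.obj_module] by (auto simp: mcon_zero mcov_zero)

lemma carrier_subfunctor: "subfunctor k S F X M (\<lambda>P. carrier (obj M P))"
  unfolding subfunctor_def using module.carrier_is_submodule[OF M.obj_module]
  by (auto simp: mcon_closed mcov_closed)

lemma sub_mackey_incl: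
  assumes N: "subfunctor k S F X M N"
  shows "mackey_mor k S F X (sub_mackey M N) M (\<lambda>P m. m)"
  using submodule_incl_lin(2)[OF M.obj_module] subfunctorD[OF N]
  by (intro mackey_morI) auto

text \<open>The kernel of \<open>\<eta>\<close> is a subfunctor; its inclusion and the zero map have the same composite with \<open>\<eta>\<close>.\<close>

lemma mono_inj:
  assumes M': "mackey_functor k S F X M'" and \<eta>: "mackey_mono k S F X M M' \<eta>" and P: "P \<in> X"
  shows "inj_on (\<eta> P) (carrier (obj M P))"
proof -
  interpret M': mackey_on S p F X k M' using M' by (simp add: mackey_on_def fusion_collection_axioms)
  have \<eta>m: "mackey_mor k S F X M M' \<eta>" using \<eta> by (simp add: mackey_mono_def)
  define K where "K P = {m \<in> carrier (obj M P). \<eta> P m \<in> {\<zero>\<^bsub>obj M' P\<^esub>}}" for P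
  have K: "subfunctor k S F X M K"
    unfolding K_def by (rule preimage_subfunctor[OF M.mackey_functor_axioms M' \<eta>m M'.zero_subfunctor])
  note KD = subfunctorD[OF K]
  have Kz: "\<zero>\<^bsub>obj M P\<^esub> \<in> K P" if "P \<in> X" for P
    using submoduleD(2)[OF M.obj_module[OF that] KD(1)[OF that]] .
  have zmor: "mackey_mor k S F X (sub_mackey M K) M (\<lambda>P m. \<zero>\<^bsub>obj M P\<^esub>)"
  proof (rule mackey_morI)
    fix P assume P: "P \<in> X"
    interpret A: module k "obj M P" by (rule M.obj_module[OF P])
    show "(\<lambda>m. \<zero>\<^bsub>obj M P\<^esub>) \<in> lin_maps k (obj (sub_mackey M K) P) (obj M P)"
      by (rule lin_mapsI) auto
  qed (simp_all add: mcon_zero mcov_zero)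
  have eta0: "\<eta> P \<zero>\<^bsub>obj M P\<^esub> = \<zero>\<^bsub>obj M' P\<^esub>" if "P \<in> X" for P
    using lin_maps_zero[OF M.obj_module M'.M.obj_module mackey_morD(1)[OF \<eta>m]] that by blast
  have "\<forall>P\<in>X. \<forall>t\<in>carrier (obj (sub_mackey M K) P). t = \<zero>\<^bsub>obj M P\<^esub>"
  proof -
    have *: "mackey_functor k S F X (sub_mackey M K) \<and> mackey_mor k S F X (sub_mackey M K) M (\<lambda>P m. m) \<and>
      mackey_mor k S F X (sub_mackey M K) M (\<lambda>P m. \<zero>\<^bsub>obj M P\<^esub>) \<and>
      (\<forall>P\<in>X. \<forall>t\<in>carrier (obj (sub_mackey M K) P). \<eta> P t = \<eta> P \<zero>\<^bsub>obj M P\<^esub>)"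
      using subfunctor_mackey[OF K] sub_mackey_incl[OF K] zmor eta0 by (auto simp: K_def)
    show ?thesis
      using conjunct2[OF \<eta>[unfolded mackey_mono_def], rule_format, OF *] by blast
  qed
  then have "m = \<zero>\<^bsub>obj M P\<^esub>" if "m \<in> carrier (obj M P)" "\<eta> P m = \<zero>\<^bsub>obj M' P\<^esub>" for m
    using that P by (auto simp: K_def)
  then show ?thesis
    using lin_maps_inj_on[OF M.obj_module[OF P] M'.M.obj_module[OF P] mackey_morD(1)[OF \<eta>m P]] by blast
qed

text \<open>Trades monomorphisms for families of submodules. The inclusion of a subfunctor is a
  monomorphism. Conversely a monomorphism is injective at every object by \<open>mono_inj\<close>,
  hence an isomorphism onto its image, and the image is a subfunctor.\<close>

lemma simple_iff:
  "mackey_simple k S F X M \<longleftrightarrow> \<not> mackey_zero X M \<and>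
    (\<forall>N. subfunctor k S F X M N \<longrightarrow>
      (\<forall>P\<in>X. N P = {\<zero>\<^bsub>obj M P\<^esub>}) \<or> (\<forall>P\<in>X. N P = carrier (obj M P)))"
proof (intro iffI conjI allI impI)
  assume "mackey_simple k S F X M"
  then show "\<not> mackey_zero X M" by (simp add: mackey_simple_def)
next
  fix N assume s: "mackey_simple k S F X M" and N: "subfunctor k S F X M N"
  have "mackey_mono k S F X (sub_mackey M N) M (\<lambda>P m. m)"
    using sub_mackey_incl[OF N] by (auto simp: mackey_mono_def)
  then consider "mackey_zero X (sub_mackey M N)" | "mackey_iso k S F X (sub_mackey M N) M (\<lambda>P m. m)"
    using s subfunctor_mackey[OF N] unfolding mackey_simple_def by blast
  then show "(\<forall>P\<in>X. N P = {\<zero>\<^bsub>obj M P\<^esub>}) \<or> (\<forall>P\<in>X. N P = carrier (obj M P))"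
  proof cases
    case 1
    then show ?thesis by (simp add: mackey_zero_def)
  next
    case 2
    then show ?thesis using mackey_iso_bij[OF 2] by (simp add: bij_betw_def)
  qed
next
  assume *: "\<not> mackey_zero X M \<and> (\<forall>N. subfunctor k S F X M N \<longrightarrow>
      (\<forall>P\<in>X. N P = {\<zero>\<^bsub>obj M P\<^esub>}) \<or> (\<forall>P\<in>X. N P = carrier (obj M P)))"
  have "mackey_zero X N \<or> mackey_iso k S F X N M \<eta>"
    if N: "mackey_functor k S F X N" and \<eta>: "mackey_mono k S F X N M \<eta>"
    for N :: "('a, 'k, 'm) mackey" and \<eta>
  proof -
    interpret N: mackey_on S p F X k N using N by (simp add: mackey_on_def fusion_collection_axioms)
    have \<eta>m: "mackey_mor k S F X N M \<eta>" using \<eta> by (simp add: mackey_mono_def)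
    note inj = N.mono_inj[OF M.mackey_functor_axioms \<eta>]
    have im: "subfunctor k S F X M (\<lambda>P. \<eta> P ` carrier (obj N P))"
      by (rule image_subfunctor[OF N M.mackey_functor_axioms \<eta>m N.carrier_subfunctor])
    have eta0: "\<eta> P \<zero>\<^bsub>obj N P\<^esub> = \<zero>\<^bsub>obj M P\<^esub>" if "P \<in> X" for P
      using lin_maps_zero[OF N.M.obj_module M.obj_module mackey_morD(1)[OF \<eta>m]] that by blast
    have z: "\<zero>\<^bsub>obj N P\<^esub> \<in> carrier (obj N P)" if "P \<in> X" for P
      using submoduleD(2)[OF N.M.obj_module N.subfunctorD(1)[OF N.carrier_subfunctor]] that by blast
    consider "\<forall>P\<in>X. \<eta> P ` carrier (obj N P) = {\<zero>\<^bsub>obj M P\<^esub>}"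
      | "\<forall>P\<in>X. \<eta> P ` carrier (obj N P) = carrier (obj M P)"
      using conjunct2[OF *] im by blast
    then show ?thesis
    proof cases
      case 1
      have "carrier (obj N P) = {\<zero>\<^bsub>obj N P\<^esub>}" if P: "P \<in> X" for P
      proof -
        have "n = \<zero>\<^bsub>obj N P\<^esub>" if n: "n \<in> carrier (obj N P)" for n
        proof -
          have "\<eta> P n \<in> {\<zero>\<^bsub>obj M P\<^esub>}" using 1 P n by blast
          then show ?thesis using inj_onD[OF inj[OF P] _ n z[OF P]] eta0[OF P] by simp
        qed
        then show ?thesis using z[OF P] by blast
      qed
      then show ?thesis by (simp add: mackey_zero_def)
    next
      case 2
      then show ?thesis using mackey_iso_of_bij[OF \<eta>m _ N] inj by (simp add: bij_betw_def)
    qed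
  qed
  then show "mackey_simple k S F X M"
    using * M.mackey_functor_axioms unfolding mackey_simple_def by blast
qed

text \<open>N is only a record with operations. Since each element of N comes from M and \<eta>
  commutes with all operations, every axiom is the image of the same axiom in M. This is how Webb's
  formulas are seen to define a Mackey functor.\<close>

lemma mackey_transport:
  fixes N :: "('a, 'k, 'n) mackey"
  assumes \<eta>: "mackey_mor k S F X M N \<eta>"
    and bij: "\<And>P. P \<in> X \<Longrightarrow> bij_betw (\<eta> P) (carrier (obj M P)) (carrier (obj N P))"
    and zero: "\<And>P. P \<in> X \<Longrightarrow> \<eta> P \<zero>\<^bsub>obj M P\<^esub> = \<zero>\<^bsub>obj N P\<^esub>"
  shows "mackey_functor k S F X N"
proof -
  note E = mackey_morD[OF \<eta>]
  have ob: "module k (obj N P)" if "P \<in> X" for P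
    using module_transport[OF M.obj_module E(1) bij zero] that by blast
  have im: "\<exists>m'\<in>carrier (obj M P). m = \<eta> P m'" if "P \<in> X" "m \<in> carrier (obj N P)" for P m
    using bij[OF that(1)] that(2) by (auto simp: bij_betw_def)
  note lin = lin_mapsD[OF E(1)]
  show ?thesis
  proof (rule mackey_functorI)
    fix P R \<phi> assume *: "P \<in> X" "R \<in> X" "\<phi> \<in> F P R"
    interpret A: module k "obj M P" by (rule M.obj_module[OF *(1)])
    interpret B: module k "obj M R" by (rule M.obj_module[OF *(2)])
    note C = lin_mapsD[OF mcon_lin[OF *]]  lin_mapsD[OF mcov_lin[OF *]]
    note E' = E(2,3)[OF *, symmetric]
    note lin' = lin(1)[OF *(1)] lin(1)[OF *(2)]
    note lin'' = lin(2,3)[OF *(1)] lin(2,3)[OF *(2)]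
    show "mcon N P R \<phi> \<in> lin_maps k (obj N R) (obj N P)"
    proof (rule lin_mapsI)
      fix x assume "x \<in> carrier (obj N R)"
      then obtain x' where x': "x' \<in> carrier (obj M R)" "x = \<eta> R x'" using im * by blast
      then show "mcon N P R \<phi> x \<in> carrier (obj N P)"
        using C lin' by (simp add: E')
      fix a assume "a \<in> carrier k"
      then show "mcon N P R \<phi> (a \<odot>\<^bsub>obj N R\<^esub> x) = a \<odot>\<^bsub>obj N P\<^esub> mcon N P R \<phi> x"
        using x' C lin' by (simp add: E' lin''[symmetric])
    next
      fix x y assume "x \<in> carrier (obj N R)" "y \<in> carrier (obj N R)"
      then obtain x' y' where "x' \<in> carrier (obj M R)" "x = \<eta> R x'" "y' \<in> carrier (obj M R)" "y = \<eta> R y'"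
        using im * by metis
      then show "mcon N P R \<phi> (x \<oplus>\<^bsub>obj N R\<^esub> y) = mcon N P R \<phi> x \<oplus>\<^bsub>obj N P\<^esub> mcon N P R \<phi> y"
        using C lin' by (simp add: E' lin''[symmetric])
    qed
    show "mcov N P R \<phi> \<in> lin_maps k (obj N P) (obj N R)"
    proof (rule lin_mapsI)
      fix x assume "x \<in> carrier (obj N P)"
      then obtain x' where x': "x' \<in> carrier (obj M P)" "x = \<eta> P x'" using im * by blast
      then show "mcov N P R \<phi> x \<in> carrier (obj N R)"
        using C lin' by (simp add: E')
      fix a assume "a \<in> carrier k"
      then show "mcov N P R \<phi> (a \<odot>\<^bsub>obj N P\<^esub> x) = a \<odot>\<^bsub>obj N R\<^esub> mcov N P R \<phi> x"
        using x' C lin' by (simp add: E' lin''[symmetric])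
    next
      fix x y assume "x \<in> carrier (obj N P)" "y \<in> carrier (obj N P)"
      then obtain x' y' where "x' \<in> carrier (obj M P)" "x = \<eta> P x'" "y' \<in> carrier (obj M P)" "y = \<eta> P y'"
        using im * by metis
      then show "mcov N P R \<phi> (x \<oplus>\<^bsub>obj N P\<^esub> y) = mcov N P R \<phi> x \<oplus>\<^bsub>obj N R\<^esub> mcov N P R \<phi> y"
        using C lin' by (simp add: E' lin''[symmetric])
    qed
    fix m assume i: "\<phi> ` P = R" and "m \<in> carrier (obj N R)"
    then obtain m' where "m' \<in> carrier (obj M R)" "m = \<eta> R m'" using im * by blast
    then show "mcon N P R \<phi> m = mcov N R P (inv_map P \<phi>) m"
      using * i mcon_iso hom_inv_map(1)[OF X_sbg X_sbg, of P R \<phi>] by (simp flip: E(2,3))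
  next
    fix P m assume *: "P \<in> X" "m \<in> carrier (obj N P)"
    then obtain m' where m': "m' \<in> carrier (obj M P)" "m = \<eta> P m'" using im by blast
    have "incl P \<in> F P P" using * hom_incl X_sbg by simp
    then show "mcon N P P (incl P) m = m" "mcov N P P (incl P) m = m"
      using * m' by (simp_all add: mcon_id mcov_id flip: E(2,3))
  next
    fix P R T \<phi> \<psi> m assume *: "P \<in> X" "R \<in> X" "T \<in> X" "\<phi> \<in> F P R" "\<psi> \<in> F R T" "m \<in> carrier (obj N T)"
    then obtain m' where m': "m' \<in> carrier (obj M T)" "m = \<eta> T m'" using im by blast
    have "compose P \<psi> \<phi> \<in> F P T" using * hom_comp[of P R T] X_sbg by simp
    then show "mcon N P T (compose P \<psi> \<phi>) m = mcon N P R \<phi> (mcon N R T \<psi> m)"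
      using * m' by (simp add: mcon_comp mcon_closed flip: E(2,3))
  next
    fix P R T \<phi> \<psi> m assume *: "P \<in> X" "R \<in> X" "T \<in> X" "\<phi> \<in> F P R" "\<psi> \<in> F R T" "m \<in> carrier (obj N P)"
    then obtain m' where m': "m' \<in> carrier (obj M P)" "m = \<eta> P m'" using im by blast
    have "compose P \<psi> \<phi> \<in> F P T" using * hom_comp[of P R T] X_sbg by simp
    then show "mcov N P T (compose P \<psi> \<phi>) m = mcov N R T \<psi> (mcov N P R \<phi> m)"
      using * m' by (simp add: mcov_comp mcov_closed flip: E(2,3))
  next
    fix P A B T m
    assume *: "P \<in> X" "A \<in> X" "B \<in> X" "A \<subseteq> P" "B \<subseteq> P" "double_coset_reps S A P B T"
      and m: "m \<in> carrier (obj N B)"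
    then obtain m' where m': "m' \<in> carrier (obj M B)" "m = \<eta> B m'" using im by blast
    let ?I = "{x \<in> T. A \<inter> cj S x ` B \<in> X}"
    let ?t = "\<lambda>x. mackey_term M A B x m'"
    let ?t' = "\<lambda>x. mackey_term N A B x m"
    have t: "?t x \<in> carrier (obj M A) \<and> ?t' x = \<eta> A (?t x)" if x: "x \<in> ?I" for x
    proof -
      have xS: "x \<in> carrier S" using x * dcr_subset sbgD(1) X_sbg by blast
      have cX: "cj S x ` B \<in> X" using X_cj * xS by blast
      have h: "restrict (cj S x) B \<in> F B (cj S x ` B)" using cj_hom X_sbg * xS by blast
      have i: "incl (A \<inter> cj S x ` B) \<in> F (A \<inter> cj S x ` B) A"
        "incl (A \<inter> cj S x ` B) \<in> F (A \<inter> cj S x ` B) (cj S x ` B)"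
        using x * cX by (auto intro!: hom_incl X_sbg)
      show ?thesis using x * cX h i m' by (simp add: mcov_closed mcon_closed flip: E(2,3))
    qed
    have ii: "incl A \<in> F A P" "incl B \<in> F B P" using * by (auto intro!: hom_incl X_sbg)
    then have "mcon N A P (incl A) (mcov N B P (incl B) m) = \<eta> A (mcon M A P (incl A) (mcov M B P (incl B) m'))"
      using * m' by (simp add: mcov_closed flip: E(2,3))
    also have "\<dots> = (\<Oplus>\<^bsub>obj N A\<^esub> x \<in> ?I. \<eta> A (?t x))"
      unfolding mackey_formula'[OF * m'(1)] using t * 
      by (intro lin_maps_finsum[OF M.obj_module ob E(1)]) auto
    also have "\<dots> = (\<Oplus>\<^bsub>obj N A\<^esub> x \<in> ?I. ?t' x)"
    proof -
      interpret NA: module k "obj N A" by (rule ob[OF *(2)])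
      show ?thesis using t lin(1)[OF *(2)] by (intro NA.finsum_cong') auto
    qed
    finally show "mcon N A P (incl A) (mcov N B P (incl B) m) = (\<Oplus>\<^bsub>obj N A\<^esub> x \<in> ?I. ?t' x)" .
  qed (use ob in auto)
qed

text \<open>Taking preimages turns a subfunctor of N into one of M, and \<eta>, being onto, recovers
  the subfunctor from its preimage.\<close>

lemma simple_transport:
  fixes N :: "('a, 'k, 'n) mackey"
  assumes s: "mackey_simple k S F X M"
    and N: "mackey_functor k S F X N" and \<eta>: "mackey_mor k S F X M N \<eta>"
    and bij: "\<And>P. P \<in> X \<Longrightarrow> bij_betw (\<eta> P) (carrier (obj M P)) (carrier (obj N P))"
  shows "mackey_simple k S F X N"
proof -
  interpret N: mackey_on S p F X k N using N by (simp add: mackey_on_def fusion_collection_axioms)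
  have eta0: "\<eta> P \<zero>\<^bsub>obj M P\<^esub> = \<zero>\<^bsub>obj N P\<^esub>" if "P \<in> X" for P
    using lin_maps_zero[OF M.obj_module N.M.obj_module mackey_morD(1)[OF \<eta>]] that by blast
  have im: "\<eta> P ` carrier (obj M P) = carrier (obj N P)" and inj: "inj_on (\<eta> P) (carrier (obj M P))"
    if "P \<in> X" for P using bij[OF that] by (auto simp: bij_betw_def)
  have z: "\<zero>\<^bsub>obj M P\<^esub> \<in> carrier (obj M P)" if "P \<in> X" for P
    using submoduleD(2)[OF M.obj_module subfunctorD(1)[OF carrier_subfunctor]] that by blast
  have nz: "\<not> mackey_zero X N"
  proof
    assume "mackey_zero X N"
    have "m = \<zero>\<^bsub>obj M P\<^esub>" if P: "P \<in> X" and m: "m \<in> carrier (obj M P)" for P m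
    proof -
      have "\<eta> P m \<in> {\<zero>\<^bsub>obj N P\<^esub>}"
        using \<open>mackey_zero X N\<close> im[OF P] m P unfolding mackey_zero_def by blast
      then show ?thesis using inj_onD[OF inj[OF P] _ m z[OF P]] eta0[OF P] by simp
    qed
    then have "carrier (obj M P) = {\<zero>\<^bsub>obj M P\<^esub>}" if "P \<in> X" for P
      using z[OF that] that by blast
    then show False using s simple_iff by (auto simp: mackey_zero_def)
  qed
  have "(\<forall>P\<in>X. W P = {\<zero>\<^bsub>obj N P\<^esub>}) \<or> (\<forall>P\<in>X. W P = carrier (obj N P))"
    if W: "subfunctor k S F X N W" for W
  proof -
    define U where "U P = {m \<in> carrier (obj M P). \<eta> P m \<in> W P}" for P
    have "subfunctor k S F X M U"
      unfolding U_def by (rule preimage_subfunctor[OF M.mackey_functor_axioms N \<eta> W])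
    then have *: "(\<forall>P\<in>X. U P = {\<zero>\<^bsub>obj M P\<^esub>}) \<or> (\<forall>P\<in>X. U P = carrier (obj M P))"
      using s simple_iff by blast
    have "W P = \<eta> P ` U P" if "P \<in> X" for P
      using N.subfunctorD(2)[OF W that] im[OF that] by (auto simp: U_def)
    then show ?thesis using * im eta0 by (elim disjE) simp_all
  qed
  then show ?thesis using nz N.simple_iff by blast
qed

end

section \<open>Sums over cosets\<close>

lemma (in abelian_monoid) finsum_Sigma:
  assumes "finite I" "\<And>i. i \<in> I \<Longrightarrow> finite (J i)" "\<And>i j. \<lbrakk>i \<in> I; j \<in> J i\<rbrakk> \<Longrightarrow> f (i, j) \<in> carrier G"
  shows "(\<Oplus>x \<in> Sigma I J. f x) = (\<Oplus>i \<in> I. \<Oplus>j \<in> J i. f (i, j))"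
  using assms
proof (induction I rule: finite_induct)
  case (insert x I)
  have eq: "Sigma (insert x I) J = Pair x ` J x \<union> Sigma I J" by auto
  have 1: "(\<Oplus>y \<in> Pair x ` J x. f y) = (\<Oplus>j \<in> J x. f (x, j))"
    using insert.prems by (intro finsum_reindex) (auto intro: inj_onI)
  have "(\<Oplus>y \<in> Sigma (insert x I) J. f y) = (\<Oplus>y \<in> Pair x ` J x. f y) \<oplus> (\<Oplus>y \<in> Sigma I J. f y)"
    unfolding eq using insert by (intro finsum_Un_disjoint) auto
  also have "(\<Oplus>y \<in> Sigma I J. f y) = (\<Oplus>i \<in> I. \<Oplus>j \<in> J i. f (i, j))"
    using insert by auto
  finally show ?case
    using insert unfolding 1 by (subst finsum_insert) (auto intro!: finsum_closed)
qed auto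

context fusion_system
begin

lemma inv_cancel [simp]:
  "\<lbrakk>x \<in> carrier S; y \<in> carrier S\<rbrakk> \<Longrightarrow> x \<otimes> (inv x \<otimes> y) = y"
  "\<lbrakk>x \<in> carrier S; y \<in> carrier S\<rbrakk> \<Longrightarrow> inv x \<otimes> (x \<otimes> y) = y"
  by (simp_all flip: m_assoc)

abbreviation "lcos g B \<equiv> l_coset S g B"

lemma mem_lcos: "x \<in> lcos g B \<longleftrightarrow> (\<exists>b\<in>B. x = g \<otimes> b)"
  by (auto simp: l_coset_def)

lemma lcos_eq:
  assumes "sbg B" "g \<in> carrier S" "g' \<in> carrier S"
  shows "lcos g B = lcos g' B \<longleftrightarrow> inv g \<otimes> g' \<in> B"
proof
  assume "lcos g B = lcos g' B"
  moreover have "g' \<in> lcos g' B" unfolding mem_lcos using assms sbgD(2)[OF assms(1)] by (intro bexI[of _ \<one>]) auto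
  ultimately obtain b where "b \<in> B" "g' = g \<otimes> b" unfolding mem_lcos[symmetric] by (metis mem_lcos)
  then show "inv g \<otimes> g' \<in> B" using assms sbgD(1)[OF assms(1)] by (simp add: m_assoc[symmetric])
next
  assume *: "inv g \<otimes> g' \<in> B"
  have "x \<in> lcos g B \<longleftrightarrow> x \<in> lcos g' B" for x
  proof
    assume "x \<in> lcos g B"
    then obtain b where b: "b \<in> B" "x = g \<otimes> b" by (auto simp: mem_lcos)
    have "inv (inv g \<otimes> g') \<otimes> b \<in> B" using * b assms(1) by (simp add: sbgD(3,4))
    moreover have "x = g' \<otimes> (inv (inv g \<otimes> g') \<otimes> b)"
    proof -
      show ?thesis using assms b sbgD(1)[OF assms(1)] by (simp add: inv_mult_group m_assoc)
    qed
    ultimately show "x \<in> lcos g' B" by (auto simp: mem_lcos)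
  next
    assume "x \<in> lcos g' B"
    then obtain b where b: "b \<in> B" "x = g' \<otimes> b" by (auto simp: mem_lcos)
    have "inv g \<otimes> g' \<otimes> b \<in> B" using * b assms(1) by (simp add: sbgD(3))
    moreover have "x = g \<otimes> (inv g \<otimes> g' \<otimes> b)"
    proof -
      show ?thesis using assms b sbgD(1)[OF assms(1)] by (simp add: m_assoc)
    qed
    ultimately show "x \<in> lcos g B" by (auto simp: mem_lcos)
  qed
  then show "lcos g B = lcos g' B" by auto
qed

lemma lcos_some:
  assumes "sbg B" "g \<in> carrier S"
  obtains b where "b \<in> B" "(SOME x. x \<in> lcos g B) = g \<otimes> b"
proof -
  have "g \<otimes> \<one> \<in> lcos g B" unfolding mem_lcos using sbgD(2)[OF assms(1)] by blast
  then have "(SOME x. x \<in> lcos g B) \<in> lcos g B" by (rule someI[of "\<lambda>x. x \<in> lcos g B"])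
  then show ?thesis using that by (auto simp: mem_lcos)
qed

text \<open>The sum of \<open>h\<close> over \<open>P / B\<close>, for \<open>h\<close> constant on the cosets \<open>g B\<close>.\<close>

definition csum :: "('k, 'v) module \<Rightarrow> 'a set \<Rightarrow> 'a set \<Rightarrow> ('a \<Rightarrow> 'v) \<Rightarrow> 'v"
  where "csum V P B h = (\<Oplus>\<^bsub>V\<^esub> C \<in> (\<lambda>g. lcos g B) ` P. h (SOME g. g \<in> C))"

lemma some_lcos_mem:
  assumes "sbg B" "sbg P" "B \<subseteq> P" "C \<in> (\<lambda>g. lcos g B) ` P"
  shows "(SOME g. g \<in> C) \<in> P" "lcos (SOME g. g \<in> C) B = C"
proof -
  obtain g where g: "g \<in> P" "C = lcos g B" using assms by auto
  then obtain b where b: "b \<in> B" "(SOME x. x \<in> C) = g \<otimes> b"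
    using lcos_some[OF assms(1), of g] sbgD(1)[OF assms(2)] by metis
  then show 1: "(SOME g. g \<in> C) \<in> P" using g assms sbgD(3)[OF assms(2)] by auto
  have "inv g \<otimes> (g \<otimes> b) = b" using g b sbgD(1)[OF assms(2)] assms(3) by (simp add: m_assoc[symmetric] subset_iff)
  then have "lcos g B = lcos (g \<otimes> b) B"
    using lcos_eq[OF assms(1), of g "g \<otimes> b"] g b sbgD(1)[OF assms(2)] assms(3) by auto
  then show "lcos (SOME g. g \<in> C) B = C" using g b by simp
qed

text \<open>The family r need not meet every coset: \<open>cover\<close> asks for it only where h is
  nonzero. This is what lets sums over all of P/B shrink to sums over a normaliser.\<close>

lemma csum_reindex:
  assumes V: "abelian_group V" and sb: "sbg B" "sbg P" "B \<subseteq> P"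
    and I: "\<And>i. i \<in> I \<Longrightarrow> r i \<in> P"
    and h: "\<And>g. g \<in> P \<Longrightarrow> h g \<in> carrier V"
    and inv: "\<And>g b. \<lbrakk>g \<in> P; b \<in> B\<rbrakk> \<Longrightarrow> h (g \<otimes> b) = h g"
    and inj: "\<And>i j. \<lbrakk>i \<in> I; j \<in> I; inv (r i) \<otimes> r j \<in> B\<rbrakk> \<Longrightarrow> i = j"
    and cover: "\<And>g. \<lbrakk>g \<in> P; h g \<noteq> \<zero>\<^bsub>V\<^esub>\<rbrakk> \<Longrightarrow> \<exists>i\<in>I. inv g \<otimes> r i \<in> B"
  shows "csum V P B h = (\<Oplus>\<^bsub>V\<^esub> i\<in>I. h (r i))"
proof -
  interpret V: abelian_group V by fact
  note P = sbgD(1)[OF sb(2)]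
  define H where "H C = h (SOME g. g \<in> C)" for C
  have H: "H (lcos g B) = h g" if g: "g \<in> P" for g
  proof -
    obtain b where "b \<in> B" "(SOME x. x \<in> lcos g B) = g \<otimes> b" using lcos_some[OF sb(1) P[OF g]] .
    then show ?thesis using inv g by (simp add: H_def)
  qed
  let ?c = "\<lambda>i. lcos (r i) B"
  have inj': "inj_on ?c I"
    using I inj P by (intro inj_onI) (auto simp: lcos_eq[OF sb(1)])
  have "csum V P B h = (\<Oplus>\<^bsub>V\<^esub> C \<in> (\<lambda>g. lcos g B) ` P. H C)" by (simp add: csum_def H_def)
  also have "\<dots> = (\<Oplus>\<^bsub>V\<^esub> C \<in> ?c ` I. H C)"
  proof (rule V.add.finprod_mono_neutral_cong_right)
    show "finite ((\<lambda>g. lcos g B) ` P)" using finite_sbg[OF sb(2)] by simp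
    show "?c ` I \<subseteq> (\<lambda>g. lcos g B) ` P" using I by auto
    show "H C = \<zero>\<^bsub>V\<^esub>" if C: "C \<in> (\<lambda>g. lcos g B) ` P - ?c ` I" for C
    proof (rule ccontr)
      assume "H C \<noteq> \<zero>\<^bsub>V\<^esub>"
      then obtain g i where "g \<in> P" "C = lcos g B" "i \<in> I" "inv g \<otimes> r i \<in> B" using C H cover by fastforce
      then have "C = ?c i" using lcos_eq[OF sb(1)] P I by auto
      then show False using C \<open>i \<in> I\<close> by auto
    qed
    show "H \<in> (\<lambda>g. lcos g B) ` P \<rightarrow> carrier V" using H h by auto
  qed auto
  also have "\<dots> = (\<Oplus>\<^bsub>V\<^esub> i\<in>I. H (?c i))"
    using H h I inj' by (intro V.finsum_reindex) auto
  also have "\<dots> = (\<Oplus>\<^bsub>V\<^esub> i\<in>I. h (r i))"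
    using H h I by (intro V.finsum_cong') auto
  finally show ?thesis .
qed

lemma csum_closed:
  assumes "abelian_group V" "sbg B" "sbg P" "B \<subseteq> P" "\<And>g. g \<in> P \<Longrightarrow> h g \<in> carrier V"
  shows "csum V P B h \<in> carrier V"
proof -
  interpret V: abelian_group V by fact
  show ?thesis unfolding csum_def
    using some_lcos_mem(1)[OF assms(2-4)] assms(5) by (intro V.finsum_closed) auto
qed

lemma csum_cong:
  assumes "abelian_group V" "sbg B" "sbg P" "B \<subseteq> P" "\<And>g. g \<in> P \<Longrightarrow> h' g \<in> carrier V"
    "\<And>g. g \<in> P \<Longrightarrow> h g = h' g"
  shows "csum V P B h = csum V P B h'"
proof -
  interpret V: abelian_group V by fact
  show ?thesis unfolding csum_def
    using some_lcos_mem(1)[OF assms(2-4)] assms(5,6) by (intro V.finsum_cong') auto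
qed

lemma csum_lin:
  assumes "module k V" "module k W" "f \<in> lin_maps k V W" "sbg B" "sbg P" "B \<subseteq> P" "\<And>g. g \<in> P \<Longrightarrow> h g \<in> carrier V"
  shows "f (csum V P B h) = csum W P B (\<lambda>g. f (h g))"
  unfolding csum_def
  using some_lcos_mem(1)[OF assms(4-6)] assms(7) by (intro lin_maps_finsum[OF assms(1-3)]) auto

lemma csum_add:
  assumes "abelian_group V" "sbg B" "sbg P" "B \<subseteq> P" "\<And>g. g \<in> P \<Longrightarrow> h g \<in> carrier V"
    "\<And>g. g \<in> P \<Longrightarrow> h' g \<in> carrier V"
  shows "csum V P B (\<lambda>g. h g \<oplus>\<^bsub>V\<^esub> h' g) = csum V P B h \<oplus>\<^bsub>V\<^esub> csum V P B h'"
proof -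
  interpret V: abelian_group V by fact
  show ?thesis unfolding csum_def
    using some_lcos_mem(1)[OF assms(2-4)] assms(5,6) by (intro V.finsum_addf) auto
qed

lemma csum_zero:
  assumes "abelian_group V" "sbg B" "sbg P" "B \<subseteq> P" "\<And>g. g \<in> P \<Longrightarrow> h g = \<zero>\<^bsub>V\<^esub>"
  shows "csum V P B h = \<zero>\<^bsub>V\<^esub>"
proof -
  interpret V: abelian_group V by fact
  show ?thesis unfolding csum_def
    using some_lcos_mem(1)[OF assms(2-4)] assms(5) by (intro V.add.finprod_one_eqI) auto
qed

lemma csum_self:
  assumes "abelian_group V" "sbg P" "\<And>g. g \<in> P \<Longrightarrow> h g \<in> carrier V"
    "\<And>g b. \<lbrakk>g \<in> P; b \<in> P\<rbrakk> \<Longrightarrow> h (g \<otimes> b) = h g"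
  shows "csum V P P h = h \<one>"
proof -
  interpret V: abelian_group V by fact
  have "csum V P P h = (\<Oplus>\<^bsub>V\<^esub> i\<in>{\<one>}. h i)"
    using assms sbgD[OF assms(2)] by (intro csum_reindex) auto
  then show ?thesis using assms sbgD(2)[OF assms(2)] by simp
qed

text \<open>The rule behind the coset computations below. By \<open>inj\<close>, sending a K_i to (r
  i a) B is well defined and injective and different pieces stay apart; by \<open>cover\<close> the
  pieces exhaust the support of h. Towers, translations, images, double cosets and the passage to
  normalisers are all instances.\<close>

lemma csum_Sigma:
  assumes V: "abelian_group V" and sb: "sbg B" "sbg P" "B \<subseteq> P"
    and fin: "finite I" and AK: "\<And>i. i \<in> I \<Longrightarrow> sbg (A i) \<and> sbg (K i) \<and> K i \<subseteq> A i"
    and r: "\<And>i a. \<lbrakk>i \<in> I; a \<in> A i\<rbrakk> \<Longrightarrow> r i a \<in> P"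
    and h: "\<And>g. g \<in> P \<Longrightarrow> h g \<in> carrier V"
    and inv: "\<And>g b. \<lbrakk>g \<in> P; b \<in> B\<rbrakk> \<Longrightarrow> h (g \<otimes> b) = h g"
    and inj: "\<And>i j a a'. \<lbrakk>i \<in> I; j \<in> I; a \<in> A i; a' \<in> A j\<rbrakk>
      \<Longrightarrow> inv (r i a) \<otimes> r j a' \<in> B \<longleftrightarrow> i = j \<and> inv a \<otimes> a' \<in> K i"
    and cover: "\<And>g. \<lbrakk>g \<in> P; h g \<noteq> \<zero>\<^bsub>V\<^esub>\<rbrakk> \<Longrightarrow> \<exists>i\<in>I. \<exists>a\<in>A i. inv g \<otimes> r i a \<in> B"
  shows "csum V P B h = (\<Oplus>\<^bsub>V\<^esub> i\<in>I. csum V (A i) (K i) (\<lambda>a. h (r i a)))"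
proof -
  interpret V: abelian_group V by fact
  define J where "J i = (\<lambda>g. lcos g (K i)) ` A i" for i
  define s where "s C = (SOME g. g \<in> C)" for C :: "'a set"
  have s: "s C \<in> A i" "lcos (s C) (K i) = C" if "i \<in> I" "C \<in> J i" for i C
    using some_lcos_mem[of "K i" "A i" C] AK[OF that(1)] that(2) by (auto simp: J_def s_def)
  have "csum V P B h = (\<Oplus>\<^bsub>V\<^esub> x\<in>Sigma I J. h (case x of (i, C) \<Rightarrow> r i (s C)))"
  proof (rule csum_reindex[OF V sb])
    fix x y assume xy: "x \<in> Sigma I J" "y \<in> Sigma I J"
      "inv (case x of (i, C) \<Rightarrow> r i (s C)) \<otimes> (case y of (i, C) \<Rightarrow> r i (s C)) \<in> B"
    obtain i C j D where ij: "x = (i, C)" "y = (j, D)" by (cases x, cases y)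
    then have "i = j" "inv (s C) \<otimes> s D \<in> K i" using xy inj s by auto
    moreover from this have "lcos (s C) (K i) = lcos (s D) (K i)"
      using xy ij s AK[of i] sbgD(1)[of "A i"] by (subst lcos_eq) auto
    ultimately show "x = y" using xy ij s by auto
  next
    fix g assume "g \<in> P" "h g \<noteq> \<zero>\<^bsub>V\<^esub>"
    then obtain i a where ia: "i \<in> I" "a \<in> A i" "inv g \<otimes> r i a \<in> B" using cover by blast
    \<comment> \<open>The element a supplied by \<open>cover\<close> is replaced by the one selected
      from its coset, which changes r i a only by an element of B.\<close>
    let ?C = "lcos a (K i)"
    have C: "?C \<in> J i" using ia by (auto simp: J_def)
    have sb': "sbg (A i)" "sbg (K i)" using AK ia by auto
    have "inv a \<otimes> s ?C \<in> K i"
      using s[OF ia(1) C] lcos_eq[OF sb'(2), of a "s ?C"] sbgD(1)[OF sb'(1)] ia by auto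
    then have 2: "inv (r i a) \<otimes> r i (s ?C) \<in> B" using inj[of i i a "s ?C"] ia s[OF ia(1) C] by auto
    have c: "g \<in> carrier S" "r i a \<in> carrier S" "r i (s ?C) \<in> carrier S"
      using \<open>g \<in> P\<close> r ia s[OF ia(1) C] sbgD(1)[OF sb(2)] by auto
    have "(inv g \<otimes> r i a) \<otimes> (inv (r i a) \<otimes> r i (s ?C)) = inv g \<otimes> (r i a \<otimes> inv (r i a)) \<otimes> r i (s ?C)"
      using c by (simp add: m_assoc)
    then have "inv g \<otimes> r i (s ?C) \<in> B"
      using sbgD(3)[OF sb(1) ia(3) 2] c by simp
    then show "\<exists>x\<in>Sigma I J. inv g \<otimes> (case x of (i, C) \<Rightarrow> r i (s C)) \<in> B"
      using ia C by (intro bexI[of _ "(i, ?C)"]) auto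
  qed (use r s h inv in auto)
  also have "\<dots> = (\<Oplus>\<^bsub>V\<^esub> i\<in>I. \<Oplus>\<^bsub>V\<^esub> C\<in>J i. h (r i (s C)))"
    using fin AK finite_sbg s r h by (subst V.finsum_Sigma) (auto simp: J_def)
  finally show ?thesis by (simp add: csum_def J_def s_def)
qed

text \<open>Transitivity: P/B consists of one copy of A/B for each coset in P/A, translated by the
  selected representative.\<close>

lemma csum_tower:
  assumes V: "abelian_group V" and sb: "sbg B" "sbg A" "sbg P" "B \<subseteq> A" "A \<subseteq> P"
    and h: "\<And>g. g \<in> P \<Longrightarrow> h g \<in> carrier V"
    and inv: "\<And>g b. \<lbrakk>g \<in> P; b \<in> B\<rbrakk> \<Longrightarrow> h (g \<otimes> b) = h g"
  shows "csum V P A (\<lambda>g. csum V A B (\<lambda>a. h (g \<otimes> a))) = csum V P B h"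
proof -
  define I where "I = (\<lambda>g. lcos g A) ` P"
  define s where "s C = (SOME g. g \<in> C)" for C :: "'a set"
  note P = sbgD(1)[OF sb(3)]
  have AP: "a \<in> P" if "a \<in> A" for a using that sb by auto
  have s: "s C \<in> P" "lcos (s C) A = C" if "C \<in> I" for C
    using some_lcos_mem[OF sb(2,3,5)] that by (auto simp: I_def s_def)
  have "csum V P B h = (\<Oplus>\<^bsub>V\<^esub> C\<in>I. csum V A B (\<lambda>a. h (s C \<otimes> a)))"
  proof (rule csum_Sigma[OF V sb(1,3)])
    show "B \<subseteq> P" using sb by auto
    show "finite I" using finite_sbg[OF sb(3)] by (simp add: I_def)
    show "s C \<otimes> a \<in> P" if "C \<in> I" "a \<in> A" for C a using s that sbgD(3)[OF sb(3)] AP by auto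
    show "inv (s C \<otimes> a) \<otimes> (s D \<otimes> a') \<in> B \<longleftrightarrow> C = D \<and> inv a \<otimes> a' \<in> B"
      if *: "C \<in> I" "D \<in> I" "a \<in> A" "a' \<in> A" for C D a a'
    proof -
      have c: "s C \<in> carrier S" "s D \<in> carrier S" "a \<in> carrier S" "a' \<in> carrier S"
        using * s P AP by auto
      have e: "inv (s C \<otimes> a) \<otimes> (s D \<otimes> a') = inv a \<otimes> (inv (s C) \<otimes> s D) \<otimes> a'"
        using c by (simp add: inv_mult_group m_assoc)
      show ?thesis
      proof
        assume "inv (s C \<otimes> a) \<otimes> (s D \<otimes> a') \<in> B"
        then have "inv a \<otimes> (inv (s C) \<otimes> s D) \<otimes> a' \<in> A" using e sb by auto
        then have "a \<otimes> (inv a \<otimes> (inv (s C) \<otimes> s D) \<otimes> a') \<otimes> inv a' \<in> A"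
          using * sbgD(3,4)[OF sb(2)] by auto
        moreover have "a \<otimes> (inv a \<otimes> (inv (s C) \<otimes> s D) \<otimes> a') \<otimes> inv a'
            = (a \<otimes> inv a) \<otimes> (inv (s C) \<otimes> s D) \<otimes> (a' \<otimes> inv a')"
          using c by (simp add: m_assoc)
        ultimately have "inv (s C) \<otimes> s D \<in> A" using c by simp
        then have CD: "C = D" using lcos_eq[OF sb(2) c(1,2)] s * by auto
        then show "C = D \<and> inv a \<otimes> a' \<in> B"
          using \<open>inv (s C \<otimes> a) \<otimes> (s D \<otimes> a') \<in> B\<close> e c by simp
      next
        assume "C = D \<and> inv a \<otimes> a' \<in> B"
        then show "inv (s C \<otimes> a) \<otimes> (s D \<otimes> a') \<in> B" using e c by simp
      qed
    qed
    show "\<exists>C\<in>I. \<exists>a\<in>A. inv g \<otimes> (s C \<otimes> a) \<in> B" if "g \<in> P" for g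
    proof -
      let ?C = "lcos g A"
      have C: "?C \<in> I" using that by (auto simp: I_def)
      have c: "g \<in> carrier S" "s ?C \<in> carrier S" using P s[OF C] that by auto
      have "inv (s ?C) \<otimes> g \<in> A" using s[OF C] lcos_eq[OF sb(2) c(2,1)] by simp
      moreover have "inv g \<otimes> (s ?C \<otimes> (inv (s ?C) \<otimes> g)) = \<one>"
      proof -
        have "inv g \<otimes> (s ?C \<otimes> (inv (s ?C) \<otimes> g)) = inv g \<otimes> ((s ?C \<otimes> inv (s ?C)) \<otimes> g)"
          using c by (simp add: m_assoc)
        then show ?thesis using c by simp
      qed
      ultimately show ?thesis using C sbgD(2)[OF sb(1)] by force
    qed
  qed (use sb h inv in auto)
  then show ?thesis by (simp add: csum_def I_def s_def)
qed

text \<open>Left multiplication by x permutes P/B. In \<open>csum_Sigma\<close> this is the case of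
  a single piece, indexed by the unit type.\<close>

lemma csum_translate:
  assumes V: "abelian_group V" and sb: "sbg B" "sbg P" "B \<subseteq> P" and x: "x \<in> P"
    and h: "\<And>g. g \<in> P \<Longrightarrow> h g \<in> carrier V"
    and inv: "\<And>g b. \<lbrakk>g \<in> P; b \<in> B\<rbrakk> \<Longrightarrow> h (g \<otimes> b) = h g"
  shows "csum V P B (\<lambda>g. h (x \<otimes> g)) = csum V P B h"
proof -
  interpret V: abelian_group V by fact
  note P = sbgD[OF sb(2)]
  have xS: "x \<in> carrier S" using x P by auto
  have "csum V P B h = (\<Oplus>\<^bsub>V\<^esub> i\<in>{()}. csum V P B (\<lambda>g. h (x \<otimes> g)))"
  proof (rule csum_Sigma[OF V sb])
    fix g assume g: "g \<in> P"
    have "x \<otimes> (inv x \<otimes> g) = g" using g xS P by (simp add: m_assoc[symmetric])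
    then show "\<exists>i\<in>{()}. \<exists>a\<in>P. inv g \<otimes> (x \<otimes> a) \<in> B"
      using g x P sbgD(2)[OF sb(1)] by (auto intro!: bexI[of _ "inv x \<otimes> g"])
  next
    fix a a' assume a: "a \<in> P" "a' \<in> P"
    have "inv (x \<otimes> a) \<otimes> (x \<otimes> a') = inv a \<otimes> (inv x \<otimes> x) \<otimes> a'"
      using a P(1) xS by (simp add: inv_mult_group m_assoc)
    then show "inv (x \<otimes> a) \<otimes> (x \<otimes> a') \<in> B \<longleftrightarrow> i = j \<and> inv a \<otimes> a' \<in> B" for i j :: unit
      using a P(1) xS by simp
  qed (use sb x h inv P in auto)
  then show ?thesis using csum_closed[OF V sb, of "\<lambda>g. h (x \<otimes> g)"] h x P by simp
qed

lemma csum_image: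
  assumes V: "abelian_group V" and sb: "sbg P" "sbg R" "\<phi> \<in> F P R" "sbg B" "B \<subseteq> P"
    and h: "\<And>g. g \<in> \<phi> ` P \<Longrightarrow> h g \<in> carrier V"
    and inv: "\<And>g b. \<lbrakk>g \<in> \<phi> ` P; b \<in> \<phi> ` B\<rbrakk> \<Longrightarrow> h (g \<otimes> b) = h g"
  shows "csum V (\<phi> ` P) (\<phi> ` B) h = csum V P B (\<lambda>g. h (\<phi> g))"
proof -
  interpret V: abelian_group V by fact
  note P = sbgD[OF sb(1)]
  have sb': "sbg (\<phi> ` P)" "sbg (\<phi> ` B)" using sb hom_image_sbg by auto
  have "csum V (\<phi> ` P) (\<phi> ` B) h = (\<Oplus>\<^bsub>V\<^esub> i\<in>{()}. csum V P B (\<lambda>g. h (\<phi> g)))"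
  proof (rule csum_Sigma[OF V sb'(2,1)])
    fix a a' assume a: "a \<in> P" "a' \<in> P"
    have e: "inv (\<phi> a) \<otimes> \<phi> a' = \<phi> (inv a \<otimes> a')" using a P hom_mult'[OF sb(1-3)] hom_inv'[OF sb(1-3)] by auto
    have "\<phi> (inv a \<otimes> a') \<in> \<phi> ` B \<longleftrightarrow> inv a \<otimes> a' \<in> B"
      using inj_on_image_mem_iff[OF hom_inj[OF sb(1-3)] _ sb(5), of "inv a \<otimes> a'"] a P by auto
    then show "inv (\<phi> a) \<otimes> \<phi> a' \<in> \<phi> ` B \<longleftrightarrow> i = j \<and> inv a \<otimes> a' \<in> B" for i j :: unit
      using e by simp
  next
    fix g assume "g \<in> \<phi> ` P"
    then obtain u where u: "u \<in> P" "g = \<phi> u" by auto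
    then have "inv g \<otimes> \<phi> u \<in> \<phi> ` B" using sbgD(2)[OF sb'(2)] sbgD(1)[OF sb'(1), of "\<phi> u"] by simp
    then show "\<exists>i\<in>{()}. \<exists>a\<in>P. inv g \<otimes> \<phi> a \<in> \<phi> ` B" using u by blast
  qed (use sb h inv in auto)
  moreover have "csum V P B (\<lambda>g. h (\<phi> g)) \<in> carrier V"
    using h by (intro csum_closed[OF V sb(4,1,5)]) auto
  ultimately show ?thesis by simp
qed

lemma cj_image_mem: "\<lbrakk>x \<in> carrier S; sbg B; y \<in> carrier S\<rbrakk> \<Longrightarrow> y \<in> cj S x ` B \<longleftrightarrow> inv x \<otimes> y \<otimes> x \<in> B"
proof -
  assume *: "x \<in> carrier S" "sbg B" "y \<in> carrier S"
  have "inv x \<otimes> y \<otimes> x = cj S (inv x) y" using * by (simp add: cj_def)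
  then show ?thesis
    using * sbgD(1)[OF *(2)] by (auto intro!: image_eqI[of _ _ "cj S (inv x) y"])
qed

text \<open>A acts on P/B from the left. Its orbits are the double cosets, and the stabiliser of x B
  is the intersection of A with the conjugate of B by x. This is the group theory in the Mackey
  formula.\<close>

lemma csum_double_coset:
  assumes V: "abelian_group V" and sb: "sbg A" "sbg B" "sbg P" "A \<subseteq> P" "B \<subseteq> P"
    and T: "double_coset_reps S A P B T"
    and h: "\<And>g. g \<in> P \<Longrightarrow> h g \<in> carrier V"
    and inv: "\<And>g b. \<lbrakk>g \<in> P; b \<in> B\<rbrakk> \<Longrightarrow> h (g \<otimes> b) = h g"
  shows "csum V P B h = (\<Oplus>\<^bsub>V\<^esub> x\<in>T. csum V A (A \<inter> cj S x ` B) (\<lambda>a. h (a \<otimes> x)))"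
proof (rule csum_Sigma[OF V sb(2,3,5)])
  note P = sbgD(1)[OF sb(3)]
  have TP: "T \<subseteq> P" and ex: "\<And>y. y \<in> P \<Longrightarrow> \<exists>!x. x \<in> T \<and> y \<in> (A #> x) <#> B"
    using T by (auto simp: double_coset_reps_def)
  have mem: "y \<in> (A #> x) <#> B \<longleftrightarrow> (\<exists>a\<in>A. \<exists>b\<in>B. y = a \<otimes> x \<otimes> b)" for x y
    by (auto simp: set_mult_def r_coset_def)
  show "finite T" using TP finite_sbg[OF sb(3)] finite_subset by blast
  show "sbg A \<and> sbg (A \<inter> cj S x ` B) \<and> A \<inter> cj S x ` B \<subseteq> A" if "x \<in> T" for x
    using sb TP P that by (auto intro!: subgroups_Inter_pair cj_image_sbg)
  show "a \<otimes> x \<in> P" if "x \<in> T" "a \<in> A" for x a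
    using sbgD(3)[OF sb(3)] subsetD[OF TP that(1)] subsetD[OF sb(4) that(2)] by blast
  show "inv (a \<otimes> x) \<otimes> (a' \<otimes> y) \<in> B \<longleftrightarrow> x = y \<and> inv a \<otimes> a' \<in> A \<inter> cj S x ` B"
    if *: "x \<in> T" "y \<in> T" "a \<in> A" "a' \<in> A" for x y a a'
  proof -
    have c: "x \<in> carrier S" "y \<in> carrier S" "a \<in> carrier S" "a' \<in> carrier S"
      using * TP P sb by auto
    have aA: "inv a \<otimes> a' \<in> A" using * sbgD(3,4)[OF sb(1)] by auto
    \<comment> \<open>Solving for y puts it into the double coset of x as well as its own, and
      representatives are unique.\<close>
    have xy: "x = y" if b: "inv (a \<otimes> x) \<otimes> (a' \<otimes> y) \<in> B"
    proof -
      let ?b = "inv (a \<otimes> x) \<otimes> (a' \<otimes> y)"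
      have "(inv a' \<otimes> a) \<otimes> x \<otimes> ?b = inv a' \<otimes> ((a \<otimes> x) \<otimes> inv (a \<otimes> x)) \<otimes> (a' \<otimes> y)"
        using c by (simp add: m_assoc)
      also have "\<dots> = inv a' \<otimes> (a' \<otimes> y)" using c by (subst r_inv) auto
      also have "\<dots> = y" using c by (simp add: m_assoc[symmetric])
      finally have "y \<in> (A #> x) <#> B" unfolding mem
        using * sbgD(3,4)[OF sb(1)] b by (metis (no_types))
      moreover have "y \<in> (A #> y) <#> B" unfolding mem
        using c sbgD(2)[OF sb(1)] sbgD(2)[OF sb(2)] by (intro bexI[of _ \<one>]) auto
      ultimately show "x = y" using ex[of y] * TP by blast
    qed
    have "inv (a \<otimes> x) \<otimes> (a' \<otimes> x) = inv x \<otimes> (inv a \<otimes> a') \<otimes> x"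
      using c by (simp add: inv_mult_group m_assoc)
    then have "inv (a \<otimes> x) \<otimes> (a' \<otimes> x) \<in> B \<longleftrightarrow> inv a \<otimes> a' \<in> cj S x ` B"
      using cj_image_mem[OF c(1) sb(2), of "inv a \<otimes> a'"] c by simp
    then show ?thesis using xy aA by blast
  qed
  show "\<exists>x\<in>T. \<exists>a\<in>A. inv g \<otimes> (a \<otimes> x) \<in> B" if g: "g \<in> P" for g
  proof -
    obtain x where x: "x \<in> T" "g \<in> (A #> x) <#> B" using ex[OF g] by blast
    then obtain a b where ab: "a \<in> A" "b \<in> B" "g = a \<otimes> x \<otimes> b" by (auto simp: mem)
    have c: "x \<in> carrier S" "a \<in> carrier S" "b \<in> carrier S" using x ab TP P sb by auto
    have "inv g \<otimes> (a \<otimes> x) = inv b"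
      using c ab by (simp add: inv_mult_group m_assoc inv_solve_left)
    then show ?thesis using x(1) ab(1) sbgD(4)[OF sb(2) ab(2)] by metis
  qed
qed (use h inv in auto)

end

section \<open>The functor of equivariant functions\<close>

text \<open>The action is given on automorphisms instead of on classes, with \<open>act_inn\<close>
  saying that it factors through Out_F(Q). Both uses fit this form: a module over
  \<open>fus_Out\<close>, and the value of a Mackey functor at Q with automorphisms acting
  covariantly.\<close>

locale aut_module = fusion_system S p F + V: module k V
  for S :: "'a monoid" (structure) and p F and k :: "'k ring" and V :: "('k, 'v) module" +
  fixes Q :: "'a set" and \<sigma> :: "('a \<Rightarrow> 'a) \<Rightarrow> 'v \<Rightarrow> 'v"
  assumes Q: "sbg Q"
    and act_lin: "b \<in> F Q Q \<Longrightarrow> \<sigma> b \<in> lin_maps k V V"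
    and act_id: "v \<in> carrier V \<Longrightarrow> \<sigma> (incl Q) v = v"
    and act_comp: "\<lbrakk>b \<in> F Q Q; c \<in> F Q Q; v \<in> carrier V\<rbrakk> \<Longrightarrow> \<sigma> (compose Q b c) v = \<sigma> b (\<sigma> c v)"
    and act_inn: "\<lbrakk>x \<in> Q; v \<in> carrier V\<rbrakk> \<Longrightarrow> \<sigma> (restrict (cj S x) Q) v = v"
begin

lemma abV: "abelian_group V" by (rule V.abelian_group_axioms)
lemma modV: "module k V" by (rule V.module_axioms)

abbreviation "cq g \<phi> \<equiv> compose Q (cj S g) \<phi>"

lemma act_closed: "\<lbrakk>b \<in> F Q Q; v \<in> carrier V\<rbrakk> \<Longrightarrow> \<sigma> b v \<in> carrier V"
  using lin_mapsD(1)[OF act_lin] by blast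

lemma act_zero: "b \<in> F Q Q \<Longrightarrow> \<sigma> b \<zero>\<^bsub>V\<^esub> = \<zero>\<^bsub>V\<^esub>"
  using lin_maps_zero[OF modV modV act_lin] by blast

lemma aut_image: "b \<in> F Q Q \<Longrightarrow> b ` Q = Q"
  by (rule endo_image[OF Q])

lemma aut_inv:
  assumes "b \<in> F Q Q"
  shows "inv_map Q b \<in> F Q Q" "compose Q (inv_map Q b) b = incl Q" "compose Q b (inv_map Q b) = incl Q"
  using hom_inv_map[OF Q Q assms] aut_image[OF assms] by auto

lemma act_inv:
  assumes "b \<in> F Q Q" "v \<in> carrier V"
  shows "\<sigma> (inv_map Q b) (\<sigma> b v) = v" "\<sigma> b (\<sigma> (inv_map Q b) v) = v"
  using assms aut_inv[OF assms(1)] act_id by (simp_all flip: act_comp)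

context
  fixes P assumes P: "sbg P"
begin

lemma cq_hom: "\<lbrakk>\<phi> \<in> F Q P; g \<in> P\<rbrakk> \<Longrightarrow> cq g \<phi> \<in> F Q P"
  using hom_comp_cj'[OF Q P] by blast

lemma img: "\<phi> \<in> F Q P \<Longrightarrow> \<phi> ` Q \<subseteq> carrier S" "\<phi> \<in> F Q P \<Longrightarrow> \<phi> ` Q \<subseteq> P"
  using hom_image[OF Q P] sbgD(5)[OF P] by blast+

lemma img_sbg: "\<phi> \<in> F Q P \<Longrightarrow> sbg (\<phi> ` Q)"
  using hom_image_sbg[OF Q P _ Q] by blast

lemma extQ: "\<phi> \<in> F Q P \<Longrightarrow> \<phi> \<in> extensional Q"
  using hom_ext[OF Q P] by blast

lemma cq_cq: "\<lbrakk>\<phi> \<in> F Q P; x \<in> carrier S; y \<in> carrier S\<rbrakk> \<Longrightarrow> cq x (cq y \<phi>) = cq (x \<otimes> y) \<phi>"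
  using img by (intro compose_cj_compose) auto

lemma cq_one: "\<phi> \<in> F Q P \<Longrightarrow> cq \<one> \<phi> = \<phi>"
  using img extQ by (intro compose_cj_one) auto

lemma cq_inv: "\<lbrakk>\<phi> \<in> F Q P; x \<in> carrier S\<rbrakk> \<Longrightarrow> cq (inv x) (cq x \<phi>) = \<phi>"
    "\<lbrakk>\<phi> \<in> F Q P; x \<in> carrier S\<rbrakk> \<Longrightarrow> cq x (cq (inv x) \<phi>) = \<phi>"
  by (simp_all add: cq_cq cq_one)

lemma aut_hom: "\<lbrakk>\<phi> \<in> F Q P; b \<in> F Q Q\<rbrakk> \<Longrightarrow> compose Q \<phi> b \<in> F Q P"
  using hom_comp[OF Q Q P] by blast

lemma aut_cancel: "\<lbrakk>\<phi> \<in> F Q P; b \<in> F Q Q\<rbrakk> \<Longrightarrow> compose Q (compose Q \<phi> b) (inv_map Q b) = \<phi>"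
    "\<lbrakk>\<phi> \<in> F Q P; b \<in> F Q Q\<rbrakk> \<Longrightarrow> compose Q (compose Q \<phi> (inv_map Q b)) b = \<phi>"
  using aut_inv aut_image[OF aut_inv(1)] aut_image extQ compose_assoc'[of _ Q Q \<phi>, symmetric]
  by (simp_all add: compose_id)

end

lemma compose_hom_inj:
  assumes "sbg P" "sbg R" "\<alpha> \<in> F P R" "\<phi> \<in> F Q P" "\<phi>' \<in> F Q P" "compose Q \<alpha> \<phi> = compose Q \<alpha> \<phi>'"
  shows "\<phi> = \<phi>'"
proof (rule extensionalityI[OF extQ[OF assms(1,4)] extQ[OF assms(1,5)]])
  fix u assume u: "u \<in> Q"
  have "\<alpha> (\<phi> u) = \<alpha> (\<phi>' u)" using fun_cong[OF assms(6), of u] u by (simp add: compose_def)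
  then show "\<phi> u = \<phi>' u"
    using hom_inj[OF assms(1-3)] hom_mem[OF Q assms(1) _ u] assms(4,5) by (auto dest: inj_onD)
qed

text \<open>Being zero off \<open>F Q P\<close> makes equality of elements equality of functions.
  The equivariance says f(\<phi> b) = b^{-1} f(\<phi>); it is written with b on the left so that no
  inverse occurs.\<close>

definition fixc :: "'a set \<Rightarrow> (('a \<Rightarrow> 'a) \<Rightarrow> 'v) set"
  where "fixc P = {f. (\<forall>\<phi>. f \<phi> \<in> carrier V) \<and> (\<forall>\<phi>. \<phi> \<notin> F Q P \<longrightarrow> f \<phi> = \<zero>\<^bsub>V\<^esub>) \<and>
    (\<forall>\<phi>\<in>F Q P. \<forall>b\<in>F Q Q. \<sigma> b (f (compose Q \<phi> b)) = f \<phi>) \<and> (\<forall>\<phi>\<in>F Q P. \<forall>g\<in>P. f (cq g \<phi>) = f \<phi>)}"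

lemma fixcD:
  assumes "f \<in> fixc P"
  shows "f \<phi> \<in> carrier V" "\<phi> \<notin> F Q P \<Longrightarrow> f \<phi> = \<zero>\<^bsub>V\<^esub>"
    "\<lbrakk>\<phi> \<in> F Q P; b \<in> F Q Q\<rbrakk> \<Longrightarrow> \<sigma> b (f (compose Q \<phi> b)) = f \<phi>"
    "\<lbrakk>\<phi> \<in> F Q P; g \<in> P\<rbrakk> \<Longrightarrow> f (cq g \<phi>) = f \<phi>"
  using assms unfolding fixc_def by blast+

lemma fixcI:
  assumes "\<And>\<phi>. f \<phi> \<in> carrier V" "\<And>\<phi>. \<phi> \<notin> F Q P \<Longrightarrow> f \<phi> = \<zero>\<^bsub>V\<^esub>"
    "\<And>\<phi> b. \<lbrakk>\<phi> \<in> F Q P; b \<in> F Q Q\<rbrakk> \<Longrightarrow> \<sigma> b (f (compose Q \<phi> b)) = f \<phi>"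
    "\<And>\<phi> g. \<lbrakk>\<phi> \<in> F Q P; g \<in> P\<rbrakk> \<Longrightarrow> f (cq g \<phi>) = f \<phi>"
  shows "f \<in> fixc P"
  using assms unfolding fixc_def by blast

lemma fixc_eqI:
  assumes "f \<in> fixc P" "f' \<in> fixc P" "\<And>\<phi>. \<phi> \<in> F Q P \<Longrightarrow> f \<phi> = f' \<phi>"
  shows "f = f'"
  using assms fixcD(2) by (intro ext) metis

text \<open>Extension by zero along \<open>\<phi> \<mapsto> \<alpha> \<phi>\<close>.\<close>

definition lift :: "'a set \<Rightarrow> ('a \<Rightarrow> 'a) \<Rightarrow> (('a \<Rightarrow> 'a) \<Rightarrow> 'v) \<Rightarrow> ('a \<Rightarrow> 'a) \<Rightarrow> 'v"
  where "lift P \<alpha> f \<chi> = (if \<exists>\<phi>\<in>F Q P. compose Q \<alpha> \<phi> = \<chi>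
    then f (THE \<phi>. \<phi> \<in> F Q P \<and> compose Q \<alpha> \<phi> = \<chi>) else \<zero>\<^bsub>V\<^esub>)"

definition fcon :: "'a set \<Rightarrow> ('a \<Rightarrow> 'a) \<Rightarrow> (('a \<Rightarrow> 'a) \<Rightarrow> 'v) \<Rightarrow> ('a \<Rightarrow> 'a) \<Rightarrow> 'v"
  where "fcon P \<alpha> f \<phi> = (if \<phi> \<in> F Q P then f (compose Q \<alpha> \<phi>) else \<zero>\<^bsub>V\<^esub>)"

definition fcov :: "'a set \<Rightarrow> 'a set \<Rightarrow> ('a \<Rightarrow> 'a) \<Rightarrow> (('a \<Rightarrow> 'a) \<Rightarrow> 'v) \<Rightarrow> ('a \<Rightarrow> 'a) \<Rightarrow> 'v"
  where "fcov P R \<alpha> f \<psi> =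
    (if \<psi> \<in> F Q R then csum V R (\<alpha> ` P) (\<lambda>g. lift P \<alpha> f (cq (inv g) \<psi>)) else \<zero>\<^bsub>V\<^esub>)"

definition fixmod :: "'a set \<Rightarrow> ('k, ('a \<Rightarrow> 'a) \<Rightarrow> 'v) module"
  where "fixmod P = \<lparr>carrier = fixc P, monoid.mult = undefined, one = undefined,
    zero = (\<lambda>\<phi>. \<zero>\<^bsub>V\<^esub>), add = (\<lambda>f g \<phi>. f \<phi> \<oplus>\<^bsub>V\<^esub> g \<phi>), smult = (\<lambda>a f \<phi>. a \<odot>\<^bsub>V\<^esub> f \<phi>)\<rparr>"

definition fix_mackey :: "('a, 'k, ('a \<Rightarrow> 'a) \<Rightarrow> 'v) mackey"
  where "fix_mackey = \<lparr>obj = fixmod, con = (\<lambda>P R c. fcon P (SOME \<alpha>. \<alpha> \<in> c)),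
    cov = (\<lambda>P R c. fcov P R (SOME \<alpha>. \<alpha> \<in> c))\<rparr>"

lemma fixmod_simps [simp]:
  "carrier (fixmod P) = fixc P" "\<zero>\<^bsub>fixmod P\<^esub> = (\<lambda>\<phi>. \<zero>\<^bsub>V\<^esub>)"
  "f \<oplus>\<^bsub>fixmod P\<^esub> g = (\<lambda>\<phi>. f \<phi> \<oplus>\<^bsub>V\<^esub> g \<phi>)" "a \<odot>\<^bsub>fixmod P\<^esub> f = (\<lambda>\<phi>. a \<odot>\<^bsub>V\<^esub> f \<phi>)"
  by (simp_all add: fixmod_def)

lemma fixc_zero: "(\<lambda>\<phi>. \<zero>\<^bsub>V\<^esub>) \<in> fixc P"
  by (rule fixcI) (auto simp: act_zero)

lemma fixc_add: "\<lbrakk>f \<in> fixc P; g \<in> fixc P\<rbrakk> \<Longrightarrow> (\<lambda>\<phi>. f \<phi> \<oplus>\<^bsub>V\<^esub> g \<phi>) \<in> fixc P"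
  by (rule fixcI) (auto simp: fixcD lin_mapsD(2)[OF act_lin])

lemma fixc_smult: "\<lbrakk>a \<in> carrier k; f \<in> fixc P\<rbrakk> \<Longrightarrow> (\<lambda>\<phi>. a \<odot>\<^bsub>V\<^esub> f \<phi>) \<in> fixc P"
  by (rule fixcI) (auto simp: fixcD lin_mapsD(3)[OF act_lin])

lemma fixmod_module: "sbg P \<Longrightarrow> module k (fixmod P)"
proof (rule moduleI)
  assume P: "sbg P"
  show "cring k" by (rule V.R.is_cring)
  show "abelian_group (fixmod P)"
  proof (rule abelian_groupI)
    fix f assume f: "f \<in> carrier (fixmod P)"
    have "(\<lambda>\<phi>. (\<ominus>\<^bsub>k\<^esub> \<one>\<^bsub>k\<^esub>) \<odot>\<^bsub>V\<^esub> f \<phi>) \<in> fixc P" using f P by (intro fixc_smult) auto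
    moreover have "(\<ominus>\<^bsub>k\<^esub> \<one>\<^bsub>k\<^esub>) \<odot>\<^bsub>V\<^esub> f \<phi> \<oplus>\<^bsub>V\<^esub> f \<phi> = \<zero>\<^bsub>V\<^esub>" for \<phi>
      using f by (simp add: fixcD(1) V.smult_l_minus V.M.l_neg)
    ultimately show "\<exists>g\<in>carrier (fixmod P). g \<oplus>\<^bsub>fixmod P\<^esub> f = \<zero>\<^bsub>fixmod P\<^esub>" by (auto intro!: bexI)
  qed (use P in \<open>auto simp: fixc_zero fixc_add fixcD(1) V.M.a_assoc V.M.a_comm V.M.a_lcomm intro!: ext\<close>)
qed (auto simp: fixc_smult fixcD(1) V.smult_l_distr V.smult_r_distr V.smult_assoc1)

lemma fixmod_finsum:
  assumes "sbg P" "h \<in> I \<rightarrow> fixc P"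
  shows "(\<Oplus>\<^bsub>fixmod P\<^esub> i\<in>I. h i) \<phi> = (\<Oplus>\<^bsub>V\<^esub> i\<in>I. h i \<phi>)"
proof -
  have "(\<lambda>f. f \<phi>) \<in> lin_maps k (fixmod P) V"
    by (rule lin_mapsI) (auto simp: fixcD(1))
  then show ?thesis
    using lin_maps_finsum[OF fixmod_module[OF assms(1)] modV, of "\<lambda>f. f \<phi>" h I] assms(2) by simp
qed

section \<open>Extension by zero, restriction and transfer of equivariant functions\<close>

lemma lift_comp:
  assumes "sbg P" "sbg R" "\<alpha> \<in> F P R" "\<phi> \<in> F Q P"
  shows "lift P \<alpha> f (compose Q \<alpha> \<phi>) = f \<phi>"
proof -
  have "(THE \<phi>'. \<phi>' \<in> F Q P \<and> compose Q \<alpha> \<phi>' = compose Q \<alpha> \<phi>) = \<phi>"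
    using assms compose_hom_inj[OF assms(1-3)] by (intro the_equality) auto
  then show ?thesis using assms by (auto simp: lift_def)
qed

lemma lift_out: "(\<And>\<phi>. \<phi> \<in> F Q P \<Longrightarrow> compose Q \<alpha> \<phi> \<noteq> \<chi>) \<Longrightarrow> lift P \<alpha> f \<chi> = \<zero>\<^bsub>V\<^esub>"
  by (auto simp: lift_def)

lemma lift_closed:
  assumes "sbg P" "sbg R" "\<alpha> \<in> F P R" "f \<in> fixc P"
  shows "lift P \<alpha> f \<chi> \<in> carrier V"
  using assms lift_comp[OF assms(1-3)] fixcD(1)[OF assms(4)] by (cases "\<exists>\<phi>\<in>F Q P. compose Q \<alpha> \<phi> = \<chi>") (auto simp: lift_def)

text \<open>Compares two extensions by zero without touching the definite description: a
  factorisation on one side yields one on the other with matching value, or both sides vanish. The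
  map h is the identity or the action of an automorphism.\<close>

lemma lift_eqI:
  assumes "sbg P" "sbg R" "\<alpha> \<in> F P R" "sbg P'" "sbg R'" "\<alpha>' \<in> F P' R'"
    and "\<And>\<phi>. \<lbrakk>\<phi> \<in> F Q P; compose Q \<alpha> \<phi> = \<chi>\<rbrakk> \<Longrightarrow> \<exists>\<phi>'\<in>F Q P'. compose Q \<alpha>' \<phi>' = \<chi>' \<and> h (f \<phi>) = f' \<phi>'"
    and "\<And>\<phi>'. \<lbrakk>\<phi>' \<in> F Q P'; compose Q \<alpha>' \<phi>' = \<chi>'\<rbrakk> \<Longrightarrow> \<exists>\<phi>\<in>F Q P. compose Q \<alpha> \<phi> = \<chi>"
    and "h \<zero>\<^bsub>V\<^esub> = \<zero>\<^bsub>V\<^esub>"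
  shows "h (lift P \<alpha> f \<chi>) = lift P' \<alpha>' f' \<chi>'"
proof (cases "\<exists>\<phi>\<in>F Q P. compose Q \<alpha> \<phi> = \<chi>")
  case True
  then obtain \<phi> \<phi>' where "\<phi> \<in> F Q P" "compose Q \<alpha> \<phi> = \<chi>" "\<phi>' \<in> F Q P'" "compose Q \<alpha>' \<phi>' = \<chi>'" "h (f \<phi>) = f' \<phi>'"
    using assms(7) by blast
  then show ?thesis using lift_comp[OF assms(1-3)] lift_comp[OF assms(4-6)] by auto
next
  case False
  then show ?thesis using assms(8,9) by (auto simp: lift_def)
qed

lemma comp_assoc:
  fixes \<alpha> \<beta> :: "'a \<Rightarrow> 'a"
  assumes "sbg P" "\<phi> \<in> F Q P"
  shows "compose Q \<beta> (compose Q \<alpha> \<phi>) = compose Q (compose P \<beta> \<alpha>) \<phi>"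
  using compose_assoc'[of \<phi> Q P \<beta> \<alpha>] img(2)[OF assms] by simp

text \<open>\<beta> is injective, so \<beta> \<phi> factors through \<beta> \<alpha> exactly as
  \<phi> factors through \<alpha>.\<close>

lemma lift_compose:
  assumes "sbg P" "sbg R" "sbg T" "\<alpha> \<in> F P R" "\<beta> \<in> F R T" "\<phi> \<in> F Q R"
  shows "lift P (compose P \<beta> \<alpha>) f (compose Q \<beta> \<phi>) = lift P \<alpha> f \<phi>"
proof (rule lift_eqI[where h = "\<lambda>x. x", OF assms(1,3) _ assms(1,2,4)])
  show "compose P \<beta> \<alpha> \<in> F P T" using assms hom_comp by blast
  fix \<phi>0 assume \<phi>0: "\<phi>0 \<in> F Q P"
  have "compose Q (compose P \<beta> \<alpha>) \<phi>0 = compose Q \<beta> (compose Q \<alpha> \<phi>0)"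
    using comp_assoc[OF assms(1) \<phi>0] by simp
  moreover have "compose Q \<alpha> \<phi>0 \<in> F Q R" using \<phi>0 assms hom_comp Q by blast
  moreover assume "compose Q (compose P \<beta> \<alpha>) \<phi>0 = compose Q \<beta> \<phi>"
  ultimately show "\<exists>\<phi>'\<in>F Q P. compose Q \<alpha> \<phi>' = \<phi> \<and> f \<phi>0 = f \<phi>'"
    using compose_hom_inj[OF assms(2,3,5)] assms(6) \<phi>0 by (metis (no_types))
next
  fix \<phi>0 assume "\<phi>0 \<in> F Q P" "compose Q \<alpha> \<phi>0 = \<phi>"
  then show "\<exists>\<phi>'\<in>F Q P. compose Q (compose P \<beta> \<alpha>) \<phi>' = compose Q \<beta> \<phi>"
    using comp_assoc[OF assms(1)] by auto
qed simp

lemma lift_cq: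
  assumes "sbg P" "sbg R" "\<alpha> \<in> F P R" "f \<in> fixc P" "y \<in> P" "\<chi> \<in> F Q R"
  shows "lift P \<alpha> f (cq (\<alpha> y) \<chi>) = lift P \<alpha> f \<chi>"
proof (rule sym, rule lift_eqI[where h = "\<lambda>x. x", OF assms(1-3,1-3)])
  note y = sbgD(4)[OF assms(1,5)] sbgD(1)[OF assms(1,5)] hom_mem[OF assms(1-3,5)] sbgD(1)[OF assms(2)]
  have c: "compose Q \<alpha> (cq x \<phi>) = cq (\<alpha> x) (compose Q \<alpha> \<phi>)" if "x \<in> P" "\<phi> \<in> F Q P" for \<phi> x
    using hom_comp_cj_hom[OF Q assms(1,2) that(2) assms(3) that(1)] .
  show "\<exists>\<phi>'\<in>F Q P. compose Q \<alpha> \<phi>' = cq (\<alpha> y) \<chi> \<and> f \<phi> = f \<phi>'"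
    if "\<phi> \<in> F Q P" "compose Q \<alpha> \<phi> = \<chi>" for \<phi>
    using that c[OF assms(5)] cq_hom[OF assms(1) _ assms(5)] fixcD(4)[OF assms(4) _ assms(5)]
    by (intro bexI[of _ "cq y \<phi>"]) auto
  show "\<exists>\<phi>\<in>F Q P. compose Q \<alpha> \<phi> = \<chi>" if "\<phi>' \<in> F Q P" "compose Q \<alpha> \<phi>' = cq (\<alpha> y) \<chi>" for \<phi>'
    using that c[OF y(1)] cq_hom[OF assms(1) _ y(1)] hom_inv'[OF assms(1-3,5)] cq_inv(1)[OF assms(2,6)] y
    by (intro bexI[of _ "cq (inv y) \<phi>'"]) auto
qed simp

text \<open>Because g enters through its inverse, an element of \<alpha>(P) on its right ends up
  acting last, where invariance of f under P removes it. So the summand of a transfer is constant on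
  left cosets, as \<open>csum\<close> requires.\<close>

lemma lift_coset:
  assumes "sbg P" "sbg R" "\<alpha> \<in> F P R" "f \<in> fixc P" "\<psi> \<in> F Q R" "g \<in> R" "b \<in> \<alpha> ` P"
  shows "lift P \<alpha> f (cq (inv (g \<otimes> b)) \<psi>) = lift P \<alpha> f (cq (inv g) \<psi>)"
proof -
  obtain y where y: "y \<in> P" "b = \<alpha> y" using assms by auto
  note R = sbgD[OF assms(2)]
  have b: "b \<in> R" using y hom_mem[OF assms(1-3)] by auto
  have "cq (inv (g \<otimes> b)) \<psi> = cq (inv b) (cq (inv g) \<psi>)"
    using assms b R by (simp add: cq_cq inv_mult_group)
  also have "inv b = \<alpha> (inv y)" using y hom_inv'[OF assms(1-3)] by simp
  finally show ?thesis
    using lift_cq[OF assms(1-4), of "inv y"] y sbgD(4)[OF assms(1)] cq_hom[OF assms(2,5)] R assms(6) by simp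
qed

lemma lift_equiv:
  assumes "sbg P" "sbg R" "\<alpha> \<in> F P R" "f \<in> fixc P" "b \<in> F Q Q" "\<chi> \<in> F Q R"
  shows "\<sigma> b (lift P \<alpha> f (compose Q \<chi> b)) = lift P \<alpha> f \<chi>"
proof (rule lift_eqI[where h = "\<sigma> b", OF assms(1-3,1-3)])
  show "\<sigma> b \<zero>\<^bsub>V\<^esub> = \<zero>\<^bsub>V\<^esub>" by (rule act_zero[OF assms(5)])
  note b = aut_inv[OF assms(5)]
  have c: "compose Q (compose Q \<alpha> \<phi>) c = compose Q \<alpha> (compose Q \<phi> c)" if "c \<in> F Q Q" for c \<phi>
    using compose_assoc'[of c Q Q \<alpha> \<phi>] aut_image[OF that] by simp
  fix \<phi> assume \<phi>: "\<phi> \<in> F Q P"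
  {
    assume e: "compose Q \<alpha> \<phi> = compose Q \<chi> b"
    have "compose Q \<alpha> (compose Q \<phi> (inv_map Q b)) = \<chi>"
      using c[OF b(1), of \<phi>] e aut_cancel(1)[OF assms(2,6,5)] by simp
    moreover have "\<sigma> b (f \<phi>) = f (compose Q \<phi> (inv_map Q b))"
      using fixcD(3)[OF assms(4) aut_hom[OF assms(1) \<phi> b(1)] assms(5)] aut_cancel(2)[OF assms(1) \<phi> assms(5)] by simp
    ultimately show "\<exists>\<phi>'\<in>F Q P. compose Q \<alpha> \<phi>' = \<chi> \<and> \<sigma> b (f \<phi>) = f \<phi>'"
      using aut_hom[OF assms(1) \<phi> b(1)] by blast
  }
  assume "compose Q \<alpha> \<phi> = \<chi>"
  then show "\<exists>\<phi>\<in>F Q P. compose Q \<alpha> \<phi> = compose Q \<chi> b"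
    using c[OF assms(5), of \<phi>] aut_hom[OF assms(1) \<phi> assms(5)] by auto
qed

text \<open>Equivariance holds term by term, the action of b being linear. Invariance under R holds
  only for the whole sum, whose terms get permuted.\<close>

lemma fcov_in:
  assumes "sbg P" "sbg R" "\<alpha> \<in> F P R" "f \<in> fixc P"
  shows "fcov P R \<alpha> f \<in> fixc R"
proof (rule fixcI)
  have sb: "sbg (\<alpha> ` P)" "\<alpha> ` P \<subseteq> R" using assms hom_image_sbg hom_image by auto
  note R = sbgD[OF assms(2)]
  note cl = lift_closed[OF assms]
  show "fcov P R \<alpha> f \<psi> \<in> carrier V" for \<psi>
    using csum_closed[OF abV sb(1) assms(2) sb(2)] cl by (simp add: fcov_def)
  fix \<psi> assume \<psi>: "\<psi> \<in> F Q R"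
  {
    fix b assume b: "b \<in> F Q Q"
    have "\<sigma> b (fcov P R \<alpha> f (compose Q \<psi> b))
        = csum V R (\<alpha> ` P) (\<lambda>g. \<sigma> b (lift P \<alpha> f (cq (inv g) (compose Q \<psi> b))))"
      using aut_hom[OF assms(2) \<psi> b] csum_lin[OF modV modV act_lin[OF b] sb(1) assms(2) sb(2)] cl
      by (simp add: fcov_def)
    also have "\<dots> = csum V R (\<alpha> ` P) (\<lambda>g. lift P \<alpha> f (cq (inv g) \<psi>))"
    proof (rule csum_cong[OF abV sb(1) assms(2) sb(2)])
      fix g assume g: "g \<in> R"
      have "cq (inv g) (compose Q \<psi> b) = compose Q (cq (inv g) \<psi>) b"
        using compose_assoc'[of b Q Q "cj S (inv g)" \<psi>] aut_image[OF b] by simp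
      then show "\<sigma> b (lift P \<alpha> f (cq (inv g) (compose Q \<psi> b))) = lift P \<alpha> f (cq (inv g) \<psi>)"
        using lift_equiv[OF assms b cq_hom[OF assms(2) \<psi>]] R(4)[OF g] by simp
    qed (rule cl)
    finally show "\<sigma> b (fcov P R \<alpha> f (compose Q \<psi> b)) = fcov P R \<alpha> f \<psi>" using \<psi> by (simp add: fcov_def)
  }
  fix x assume x: "x \<in> R"
  \<comment> \<open>Conjugating \<psi> by x replaces the index g by x^{-1} g, a left translation of
    the cosets.\<close>
  have "fcov P R \<alpha> f (cq x \<psi>) = csum V R (\<alpha> ` P) (\<lambda>g. lift P \<alpha> f (cq (inv (inv x \<otimes> g)) \<psi>))"
    unfolding fcov_def using x \<psi> R cl cq_hom[OF assms(2) \<psi> x]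
    by (auto simp: cq_cq[OF assms(2)] inv_mult_group intro!: csum_cong[OF abV sb(1) assms(2) sb(2)])
  also have "\<dots> = csum V R (\<alpha> ` P) (\<lambda>g. lift P \<alpha> f (cq (inv g) \<psi>))"
    using x R cl lift_coset[OF assms \<psi>] by (intro csum_translate[OF abV sb(1) assms(2) sb(2)]) auto
  finally show "fcov P R \<alpha> f (cq x \<psi>) = fcov P R \<alpha> f \<psi>" using \<psi> by (simp add: fcov_def)
qed (simp add: fcov_def)

lemma fcon_in:
  assumes "sbg P" "sbg R" "\<alpha> \<in> F P R" "f \<in> fixc R"
  shows "fcon P \<alpha> f \<in> fixc P"
proof (rule fixcI)
  fix \<phi> assume \<phi>: "\<phi> \<in> F Q P"
  have a: "compose Q \<alpha> \<phi> \<in> F Q R" using hom_comp[OF Q assms(1,2) \<phi> assms(3)] .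
  show "\<sigma> b (fcon P \<alpha> f (compose Q \<phi> b)) = fcon P \<alpha> f \<phi>" if b: "b \<in> F Q Q" for b
    using fixcD(3)[OF assms(4) a b] compose_assoc'[of b Q Q \<alpha> \<phi>] aut_image[OF b] aut_hom[OF assms(1) \<phi> b] \<phi>
    by (simp add: fcon_def)
  show "fcon P \<alpha> f (cq g \<phi>) = fcon P \<alpha> f \<phi>" if g: "g \<in> P" for g
    using fixcD(4)[OF assms(4) a, of "\<alpha> g"] hom_comp_cj_hom[OF Q assms(1,2) \<phi> assms(3) g]
      cq_hom[OF assms(1) \<phi> g] \<phi> hom_mem[OF assms(1-3) g]
    by (simp add: fcon_def)
qed (auto simp: fcon_def fixcD(1)[OF assms(4)])

lemma lift_add:
  "lift P \<alpha> (\<lambda>\<phi>. f \<phi> \<oplus>\<^bsub>V\<^esub> f' \<phi>) \<chi> = lift P \<alpha> f \<chi> \<oplus>\<^bsub>V\<^esub> lift P \<alpha> f' \<chi>"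
  by (simp add: lift_def)

lemma fcov_lin:
  assumes "sbg P" "sbg R" "\<alpha> \<in> F P R"
  shows "fcov P R \<alpha> \<in> lin_maps k (fixmod P) (fixmod R)"
proof (rule lin_mapsI)
  have sb: "sbg (\<alpha> ` P)" "\<alpha> ` P \<subseteq> R" using assms hom_image_sbg hom_image by auto
  note cl = lift_closed[OF assms]
  fix f assume f: "f \<in> carrier (fixmod P)"
  then show "fcov P R \<alpha> f \<in> carrier (fixmod R)" using assms by (simp add: fcov_in)
  fix g assume g: "g \<in> carrier (fixmod P)"
  show "fcov P R \<alpha> (f \<oplus>\<^bsub>fixmod P\<^esub> g) = fcov P R \<alpha> f \<oplus>\<^bsub>fixmod R\<^esub> fcov P R \<alpha> g"
    using f g cl by (auto simp: fcov_def lift_add intro!: ext csum_add[OF abV sb(1) assms(2) sb(2)])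
next
  have sb: "sbg (\<alpha> ` P)" "\<alpha> ` P \<subseteq> R" using assms hom_image_sbg hom_image by auto
  note cl = lift_closed[OF assms]
  fix f a assume f: "f \<in> carrier (fixmod P)" and a: "a \<in> carrier k"
  have *: "(\<lambda>v. a \<odot>\<^bsub>V\<^esub> v) \<in> lin_maps k V V"
    using a by (intro lin_mapsI) (auto simp: V.smult_r_distr V.smult_assoc1[symmetric] V.R.m_comm)
  have **: "lift P \<alpha> (\<lambda>\<phi>. a \<odot>\<^bsub>V\<^esub> f \<phi>) \<chi> = a \<odot>\<^bsub>V\<^esub> lift P \<alpha> f \<chi>" for \<chi>
    using a by (simp add: lift_def)
  show "fcov P R \<alpha> (a \<odot>\<^bsub>fixmod P\<^esub> f) = a \<odot>\<^bsub>fixmod R\<^esub> fcov P R \<alpha> f"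
    using f a cl by (auto simp: fcov_def ** intro!: ext csum_lin[OF modV modV * sb(1) assms(2) sb(2), symmetric])
qed

lemma fcon_lin:
  assumes "sbg P" "sbg R" "\<alpha> \<in> F P R"
  shows "fcon P \<alpha> \<in> lin_maps k (fixmod R) (fixmod P)"
  using assms by (intro lin_mapsI) (auto simp: fcon_in fcon_def fixcD(1))

lemma fcon_id: "\<lbrakk>sbg P; f \<in> fixc P\<rbrakk> \<Longrightarrow> fcon P (incl P) f = f"
  using compose_incl[OF extQ img(2)] fixcD(2) by (intro ext) (auto simp: fcon_def)

lemma fcon_comp:
  assumes "sbg P" "sbg R" "sbg T" "\<alpha> \<in> F P R" "\<beta> \<in> F R T"
  shows "fcon P (compose P \<beta> \<alpha>) f = fcon P \<alpha> (fcon R \<beta> f)"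
  using comp_assoc[OF assms(1)] hom_comp[OF Q assms(1,2) _ assms(4)]
  by (intro ext) (simp add: fcon_def)

text \<open>Restriction depends only on the orbit class of \<alpha>, since f does not see
  conjugation by elements of R.\<close>

lemma fcon_cj:
  assumes "sbg P" "sbg R" "\<alpha> \<in> F P R" "x \<in> R" "f \<in> fixc R"
  shows "fcon P (compose P (cj S x) \<alpha>) f = fcon P \<alpha> f"
proof (rule ext)
  fix \<phi>
  have "compose Q (compose P (cj S x) \<alpha>) \<phi> = cq x (compose Q \<alpha> \<phi>)" if "\<phi> \<in> F Q P"
    using comp_assoc[OF assms(1) that] by simp
  then show "fcon P (compose P (cj S x) \<alpha>) f \<phi> = fcon P \<alpha> f \<phi>"
    using fixcD(4)[OF assms(5) _ assms(4)] hom_comp[OF Q assms(1,2) _ assms(3)] by (auto simp: fcon_def)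
qed

text \<open>Here R/\<alpha>(P) is a single coset, and every morphism into R factors through
  \<alpha>.\<close>

lemma fcov_iso:
  assumes "sbg P" "sbg R" "\<alpha> \<in> F P R" "\<alpha> ` P = R" "f \<in> fixc P"
  shows "fcov P R \<alpha> f = fcon R (inv_map P \<alpha>) f"
proof (rule ext)
  fix \<psi>
  note i = hom_inv_map[OF assms(1-3)]
  note R = sbgD[OF assms(2)]
  have "fcov P R \<alpha> f \<psi> = f (compose Q (inv_map P \<alpha>) \<psi>)" if \<psi>: "\<psi> \<in> F Q R"
  proof -
    let ?\<phi> = "compose Q (inv_map P \<alpha>) \<psi>"
    have "?\<phi> \<in> F Q P" using hom_comp[OF Q assms(2,1) \<psi>] i(1) assms(4) by simp
    moreover have "compose Q \<alpha> ?\<phi> = \<psi>"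
      using comp_assoc[OF assms(2) \<psi>, of \<alpha>] i(3) assms(4) compose_incl[OF extQ img(2), of R \<psi>] assms(2) \<psi> by simp
    ultimately have "lift P \<alpha> f \<psi> = f ?\<phi>" using lift_comp[OF assms(1-3), of ?\<phi> f] by simp
    moreover have "fcov P R \<alpha> f \<psi> = lift P \<alpha> f (cq (inv \<one>) \<psi>)"
      using csum_self[OF abV assms(2), of "\<lambda>g. lift P \<alpha> f (cq (inv g) \<psi>)"]
        \<psi> assms(4) lift_closed[OF assms(1-3,5)] lift_coset[OF assms(1-3,5) \<psi>] by (simp add: fcov_def)
    ultimately show ?thesis using cq_one[OF assms(2) \<psi>] by simp
  qed
  then show "fcov P R \<alpha> f \<psi> = fcon R (inv_map P \<alpha>) f \<psi>" by (simp add: fcon_def fcov_def)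
qed

text \<open>An instance of \<open>csum_tower\<close> for the chain \<beta>\<alpha>(P), \<beta>(R),
  T, once the inner transfer has been moved into T.\<close>

lemma fcov_comp:
  assumes "sbg P" "sbg R" "sbg T" "\<alpha> \<in> F P R" "\<beta> \<in> F R T" "f \<in> fixc P"
  shows "fcov P T (compose P \<beta> \<alpha>) f = fcov R T \<beta> (fcov P R \<alpha> f)"
proof (rule ext)
  fix \<psi>
  let ?\<gamma> = "compose P \<beta> \<alpha>"
  have \<gamma>: "?\<gamma> \<in> F P T" using assms hom_comp by blast
  have im: "?\<gamma> ` P = \<beta> ` \<alpha> ` P" by (rule compose_image)
  have sb: "sbg (\<alpha> ` P)" "sbg (\<beta> ` R)" "sbg (\<beta> ` \<alpha> ` P)" "\<alpha> ` P \<subseteq> R" "\<beta> ` R \<subseteq> T" "\<beta> ` \<alpha> ` P \<subseteq> \<beta> ` R"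
    using assms hom_image_sbg[of P R \<alpha> P] hom_image_sbg[of R T \<beta> R] hom_image_sbg[of R T \<beta> "\<alpha> ` P"]
      hom_image[of P R \<alpha>] hom_image[of R T \<beta>] by auto
  note T = sbgD[OF assms(3)] and R = sbgD[OF assms(2)]
  note cl = lift_closed[OF assms(1,3) \<gamma> assms(6)]
  have bT: "b \<in> T" if "b \<in> \<beta> ` R" for b using that sb by auto
  \<comment> \<open>If \<chi> = \<beta> \<phi>, then \<beta> carries the sum over R/\<alpha>(P) for
    \<phi> to one over its image. If \<chi> does not factor through \<beta>, neither does a
    conjugate of \<chi> by an element of \<beta>(R), so every term on the right vanishes.\<close>
  have key: "lift R \<beta> (fcov P R \<alpha> f) \<chi> = csum V (\<beta> ` R) (\<beta> ` \<alpha> ` P) (\<lambda>g. lift P ?\<gamma> f (cq (inv g) \<chi>))"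
    if \<chi>: "\<chi> \<in> F Q T" for \<chi>
  proof (cases "\<exists>\<phi>\<in>F Q R. compose Q \<beta> \<phi> = \<chi>")
    case True
    then obtain \<phi> where \<phi>: "\<phi> \<in> F Q R" "compose Q \<beta> \<phi> = \<chi>" by blast
    have "csum V (\<beta> ` R) (\<beta> ` \<alpha> ` P) (\<lambda>g. lift P ?\<gamma> f (cq (inv g) \<chi>))
        = csum V R (\<alpha> ` P) (\<lambda>g. lift P ?\<gamma> f (cq (inv (\<beta> g)) \<chi>))"
      using cl lift_coset[OF assms(1,3) \<gamma> assms(6) \<chi> bT] im
      by (intro csum_image[OF abV assms(2,3,5) sb(1,4)]) auto
    also have "\<dots> = csum V R (\<alpha> ` P) (\<lambda>g. lift P \<alpha> f (cq (inv g) \<phi>))"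
    proof (rule csum_cong[OF abV sb(1) assms(2) sb(4)])
      fix g assume g: "g \<in> R"
      have "cq (inv (\<beta> g)) \<chi> = compose Q \<beta> (cq (inv g) \<phi>)"
        using hom_comp_cj_hom[OF Q assms(2,3) \<phi>(1) assms(5) R(4)[OF g]] hom_inv'[OF assms(2,3,5) g] \<phi>(2) by simp
      then show "lift P ?\<gamma> f (cq (inv (\<beta> g)) \<chi>) = lift P \<alpha> f (cq (inv g) \<phi>)"
        using lift_compose[OF assms(1-5) cq_hom[OF assms(2) \<phi>(1) R(4)[OF g]]] by simp
    qed (rule lift_closed[OF assms(1,2,4,6)])
    also have "\<dots> = lift R \<beta> (fcov P R \<alpha> f) \<chi>"
      using lift_comp[OF assms(2,3,5) \<phi>(1), of "fcov P R \<alpha> f"] \<phi> by (simp add: fcov_def)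
    finally show ?thesis by simp
  next
    case False
    have "lift P ?\<gamma> f (cq (inv b) \<chi>) = \<zero>\<^bsub>V\<^esub>" if b: "b \<in> \<beta> ` R" for b
    proof (rule lift_out, rule notI)
      obtain r where r: "r \<in> R" "b = \<beta> r" using b by auto
      fix \<phi> assume \<phi>: "\<phi> \<in> F Q P" "compose Q ?\<gamma> \<phi> = cq (inv b) \<chi>"
      have a: "compose Q \<alpha> \<phi> \<in> F Q R" using hom_comp[OF Q assms(1,2) \<phi>(1) assms(4)] .
      have "\<chi> = cq (\<beta> r) (cq (inv b) \<chi>)" using cq_inv(2)[OF assms(3) \<chi>] T(1)[OF bT[OF b]] r by simp
      also have "\<dots> = cq (\<beta> r) (compose Q \<beta> (compose Q \<alpha> \<phi>))" using \<phi> comp_assoc[OF assms(1) \<phi>(1)] by simp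
      also have "\<dots> = compose Q \<beta> (cq r (compose Q \<alpha> \<phi>))"
        using hom_comp_cj_hom[OF Q assms(2,3) a assms(5) r(1)] by simp
      finally show False using False cq_hom[OF assms(2) a r(1)] by metis
    qed
    then show ?thesis using csum_zero[OF abV sb(3,2,6)] lift_out[of R \<beta> \<chi>] False by auto
  qed
  show "fcov P T ?\<gamma> f \<psi> = fcov R T \<beta> (fcov P R \<alpha> f) \<psi>"
  proof (cases "\<psi> \<in> F Q T")
    case True
    have "fcov R T \<beta> (fcov P R \<alpha> f) \<psi> = csum V T (\<beta> ` R) (\<lambda>g. lift R \<beta> (fcov P R \<alpha> f) (cq (inv g) \<psi>))"
      using True by (simp add: fcov_def)
    also have "\<dots> = csum V T (\<beta> ` R)
        (\<lambda>g. csum V (\<beta> ` R) (\<beta> ` \<alpha> ` P) (\<lambda>g'. lift P ?\<gamma> f (cq (inv (g \<otimes> g')) \<psi>)))"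
    proof (rule csum_cong[OF abV sb(2) assms(3) sb(5)])
      fix g assume g: "g \<in> T"
      show "csum V (\<beta> ` R) (\<beta> ` \<alpha> ` P) (\<lambda>g'. lift P ?\<gamma> f (cq (inv (g \<otimes> g')) \<psi>)) \<in> carrier V"
        using cl by (intro csum_closed[OF abV sb(3,2,6)])
      have "lift R \<beta> (fcov P R \<alpha> f) (cq (inv g) \<psi>) =
          csum V (\<beta> ` R) (\<beta> ` \<alpha> ` P) (\<lambda>g'. lift P ?\<gamma> f (cq (inv g') (cq (inv g) \<psi>)))"
        using key[OF cq_hom[OF assms(3) True T(4)[OF g]]] .
      also have "\<dots> = csum V (\<beta> ` R) (\<beta> ` \<alpha> ` P) (\<lambda>g'. lift P ?\<gamma> f (cq (inv (g \<otimes> g')) \<psi>))"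
        using cl True g T bT
        by (intro csum_cong[OF abV sb(3,2,6)]) (auto simp: cq_cq[OF assms(3)] inv_mult_group)
      finally show "lift R \<beta> (fcov P R \<alpha> f) (cq (inv g) \<psi>) =
          csum V (\<beta> ` R) (\<beta> ` \<alpha> ` P) (\<lambda>g'. lift P ?\<gamma> f (cq (inv (g \<otimes> g')) \<psi>))" .
    qed
    also have "\<dots> = csum V T (\<beta> ` \<alpha> ` P) (\<lambda>g. lift P ?\<gamma> f (cq (inv g) \<psi>))"
      using cl lift_coset[OF assms(1,3) \<gamma> assms(6) True] im
      by (intro csum_tower[OF abV sb(3,2) assms(3) sb(6,5)]) auto
    finally show ?thesis using True im by (simp add: fcov_def)
  qed (simp add: fcov_def)
qed

text \<open>Reduced to the contravariant statement: transfer along the automorphism c_x of R is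
  restriction along its inverse, which is again inner and hence does nothing.\<close>

lemma fcov_cj:
  assumes "sbg P" "sbg R" "\<alpha> \<in> F P R" "x \<in> R" "f \<in> fixc P"
  shows "fcov P R (compose P (cj S x) \<alpha>) f = fcov P R \<alpha> f"
proof -
  let ?c = "restrict (cj S x) R"
  have xS: "x \<in> carrier S" using sbgD(1)[OF assms(2,4)] .
  have im: "?c ` R = R" using cj_image_self[OF assms(2,4)] by simp
  have c: "?c \<in> F R R" using hom_conj[OF assms(2,2) xS] im by simp
  note i = hom_inv_map[OF assms(2,2) c]
  have f': "fcov P R \<alpha> f \<in> fixc R" using fcov_in assms by blast
  have "compose P (cj S x) \<alpha> = compose P ?c \<alpha>"
    by (simp add: compose_restrict[OF hom_image[OF assms(1-3)]])
  then have "fcov P R (compose P (cj S x) \<alpha>) f = fcov R R ?c (fcov P R \<alpha> f)"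
    using fcov_comp[OF assms(1,2,2,3) c assms(5)] by simp
  also have "\<dots> = fcon R (inv_map R ?c) (fcov P R \<alpha> f)" using fcov_iso[OF assms(2,2) c im f'] .
  also have "inv_map R ?c = compose R (cj S (inv x)) (incl R)"
  proof (rule extensionalityI[of _ R])
    show "inv_map R ?c \<in> extensional R" using i(1) im hom_ext[OF assms(2,2)] by simp
    fix u assume u: "u \<in> R"
    have "inv_map R ?c (?c (cj S (inv x) u)) = cj S (inv x) u"
      using i(4) u cj_mem[OF assms(2) _ u] sbgD(4)[OF assms(2,4)] by blast
    moreover have "?c (cj S (inv x) u) = u"
      using u xS cj_mem[OF assms(2) _ u] sbgD[OF assms(2)] assms(4) by simp
    ultimately show "inv_map R ?c u = compose R (cj S (inv x)) (incl R) u" using u by (simp add: compose_def)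
  qed simp
  also have "fcon R (compose R (cj S (inv x)) (incl R)) (fcov P R \<alpha> f) = fcov P R \<alpha> f"
    using fcon_cj[OF assms(2,2) hom_incl[OF assms(2,2)] sbgD(4)[OF assms(2,4)] f'] fcon_id[OF assms(2) f'] by simp
  finally show ?thesis .
qed

lemma fcov_id: "\<lbrakk>sbg P; f \<in> fixc P\<rbrakk> \<Longrightarrow> fcov P P (incl P) f = f"
proof -
  assume P: "sbg P" "f \<in> fixc P"
  have i: "incl P \<in> F P P" using hom_incl P by blast
  have "inv_map P (incl P) = incl P"
    using hom_inv_map[OF P(1,1) i] hom_ext[OF P(1,1)] by (intro extensionalityI[of _ P]) auto
  then show ?thesis using fcov_iso[OF P(1,1) i _ P(2)] fcon_id P by simp
qed

lemma lift_incl: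
  assumes "sbg P" "f \<in> fixc P"
  shows "lift P (incl P) f \<chi> = f \<chi>"
proof (cases "\<chi> \<in> F Q P")
  case True
  have "compose Q (incl P) \<chi> = \<chi>" using compose_incl[OF extQ img(2)] assms True by blast
  then show ?thesis using lift_comp[OF assms(1,1) hom_incl[OF assms(1,1)] True, of f] by simp
next
  case False
  then have "\<And>\<phi>. \<phi> \<in> F Q P \<Longrightarrow> compose Q (incl P) \<phi> \<noteq> \<chi>"
    using compose_incl[OF extQ img(2)] assms by metis
  then show ?thesis using lift_out False fixcD(2)[OF assms(2)] by metis
qed

text \<open>The representative picked inside \<open>fix_mackey\<close> is immaterial, so all later
  work is with \<open>fcon\<close> and \<open>fcov\<close> along actual morphisms.\<close>

lemma fcon_mcon:
  assumes "sbg P" "sbg R" "\<alpha> \<in> F P R"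
  shows "f \<in> fixc R \<Longrightarrow> mcon fix_mackey P R \<alpha> f = fcon P \<alpha> f"
    "f \<in> fixc P \<Longrightarrow> mcov fix_mackey P R \<alpha> f = fcov P R \<alpha> f"
proof -
  obtain x where x: "x \<in> R" "(SOME \<psi>. \<psi> \<in> orbit_class S P R \<alpha>) = compose P (cj S x) \<alpha>"
    using orbit_class_some[OF assms] .
  show "f \<in> fixc R \<Longrightarrow> mcon fix_mackey P R \<alpha> f = fcon P \<alpha> f"
    using x fcon_cj[OF assms x(1)] by (simp add: fix_mackey_def)
  show "f \<in> fixc P \<Longrightarrow> mcov fix_mackey P R \<alpha> f = fcov P R \<alpha> f"
    using x fcov_cj[OF assms x(1)] by (simp add: fix_mackey_def)
qed

lemma obj_fix [simp]: "obj fix_mackey P = fixmod P"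
  by (simp add: fix_mackey_def)

lemma fcon_incl_app:
  assumes "sbg A" "\<phi> \<in> F Q A"
  shows "fcon A (incl A) f \<phi> = f \<phi>"
  using compose_incl[OF extQ img(2)] assms by (simp add: fcon_def)

lemma hom_iff_image: "\<lbrakk>sbg P; sbg R; \<phi> \<in> F Q P\<rbrakk> \<Longrightarrow> \<phi> \<in> F Q R \<longleftrightarrow> \<phi> ` Q \<subseteq> R"
  using hom_change[OF Q] img(2) by blast

text \<open>No collection \<open>X\<close> enters here: a summand with no copy of \<open>Q\<close> in \<open>A \<inter> cj S x ` B\<close> is zero.\<close>

lemma fix_mackey_formula:
  assumes sb: "sbg P" "sbg A" "sbg B" "A \<subseteq> P" "B \<subseteq> P" and T: "double_coset_reps S A P B T"
    and f: "f \<in> fixc B" and \<phi>: "\<phi> \<in> F Q A"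
  shows "fcon A (incl A) (fcov B P (incl B) f) \<phi> =
    (\<Oplus>\<^bsub>V\<^esub> x\<in>T. fcov (A \<inter> cj S x ` B) A (incl (A \<inter> cj S x ` B))
      (fcon (A \<inter> cj S x ` B) (incl (A \<inter> cj S x ` B)) (fcov B (cj S x ` B) (restrict (cj S x) B) f)) \<phi>)"
proof -
  note P = sbgD[OF sb(1)] and A = sbgD[OF sb(2)]
  have iB: "incl B \<in> F B P" using hom_incl sb by blast
  have \<phi>P: "\<phi> \<in> F Q P" using hom_iff_image[OF sb(2,1) \<phi>] img(2)[OF sb(2) \<phi>] sb by blast
  have "fcon A (incl A) (fcov B P (incl B) f) \<phi> = csum V P B (\<lambda>g. lift B (incl B) f (cq (inv g) \<phi>))"
    using fcon_incl_app[OF sb(2) \<phi>] \<phi>P by (simp add: fcov_def)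
  also have "\<dots> = csum V P B (\<lambda>g. f (cq (inv g) \<phi>))" by (simp add: lift_incl[OF sb(3) f])
  also have "\<dots> = (\<Oplus>\<^bsub>V\<^esub> x\<in>T. csum V A (A \<inter> cj S x ` B) (\<lambda>a. f (cq (inv (a \<otimes> x)) \<phi>)))"
    using lift_coset[OF sb(3,1) iB f \<phi>P] fixcD(1)[OF f]
    by (intro csum_double_coset[OF abV sb(2,3,1,4,5) T]) (auto simp: lift_incl[OF sb(3) f])
  also have "\<dots> = (\<Oplus>\<^bsub>V\<^esub> x\<in>T. fcov (A \<inter> cj S x ` B) A (incl (A \<inter> cj S x ` B))
      (fcon (A \<inter> cj S x ` B) (incl (A \<inter> cj S x ` B)) (fcov B (cj S x ` B) (restrict (cj S x) B) f)) \<phi>)" (is "_ = (\<Oplus>\<^bsub>V\<^esub> x\<in>T. ?t x)")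
  proof -
    have "?t x \<in> carrier V \<and> csum V A (A \<inter> cj S x ` B) (\<lambda>a. f (cq (inv (a \<otimes> x)) \<phi>)) = ?t x" if x: "x \<in> T" for x
    proof -
    have xS: "x \<in> carrier S" using T x P by (auto simp: double_coset_reps_def)
    let ?C = "cj S x ` B" and ?c = "restrict (cj S x) B"
    have C: "sbg ?C" "sbg (A \<inter> ?C)" using sb xS by (auto intro!: subgroups_Inter_pair cj_image_sbg)
    have cB: "?c \<in> F B ?C" "?c ` B = ?C" using hom_conj[OF sb(3) C(1) xS] by auto
    have iD: "incl (A \<inter> ?C) \<in> F (A \<inter> ?C) ?C" "incl (A \<inter> ?C) \<in> F (A \<inter> ?C) A"
      using C sb by (auto intro!: hom_incl)
    let ?f = "fcov B ?C ?c f"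
    have f': "?f \<in> fixc ?C" using fcov_in[OF sb(3) C(1) cB(1) f] .
    let ?f2 = "fcon (A \<inter> ?C) (incl (A \<inter> ?C)) ?f"
    have f2: "?f2 \<in> fixc (A \<inter> ?C)" using fcon_in[OF C(2,1) iD(1) f'] .
    have "fcov (A \<inter> ?C) A (incl (A \<inter> ?C)) ?f2 \<phi> \<in> carrier V"
      using fixcD(1) fcov_in[OF C(2) sb(2) iD(2) f2] by blast
    moreover have "fcov (A \<inter> ?C) A (incl (A \<inter> ?C)) ?f2 \<phi> = csum V A (A \<inter> ?C) (\<lambda>a. ?f2 (cq (inv a) \<phi>))"
      using \<phi> by (simp add: fcov_def lift_incl[OF C(2) f2])
    moreover have "csum V A (A \<inter> ?C) (\<lambda>a. ?f2 (cq (inv a) \<phi>)) = csum V A (A \<inter> ?C) (\<lambda>a. f (cq (inv (a \<otimes> x)) \<phi>))"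
    proof (rule csum_cong[OF abV C(2) sb(2)])
      fix a assume a: "a \<in> A"
      let ?\<chi> = "cq (inv a) \<phi>"
      have aS: "a \<in> carrier S" using A a by auto
      have \<chi>: "?\<chi> \<in> F Q A" using cq_hom[OF sb(2) \<phi> A(4)[OF a]] .
      have e: "cq (inv (a \<otimes> x)) \<phi> = cq (inv x) ?\<chi>"
        using cq_cq[OF sb(2) \<phi>] aS xS by (simp add: inv_mult_group)
      show "?f2 ?\<chi> = f (cq (inv (a \<otimes> x)) \<phi>)"
      \<comment> \<open>\<chi> lands in the conjugate of B by x exactly when its conjugate by x^{-1}
        lands in B; if not, both values are zero.\<close>
      proof (cases "?\<chi> \<in> F Q ?C")
        case True
        have "?\<chi> \<in> F Q (A \<inter> ?C)" using hom_iff_image[OF C(1,2) True] img(2)[OF C(1) True] img(2)[OF sb(2) \<chi>] by blast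
        then have 1: "?f2 ?\<chi> = ?f ?\<chi>" using fcon_incl_app[OF C(2)] by blast
        have "compose Q (inv_map B ?c) ?\<chi> = cq (inv x) ?\<chi>"
        proof (rule extensionalityI[of _ Q])
          fix u assume u: "u \<in> Q"
          obtain b where b: "b \<in> B" "?\<chi> u = cj S x b" using hom_mem[OF Q C(1) True u] by auto
          have "inv_map B ?c (?c b) = b" using hom_inv_map(4)[OF sb(3) C(1) cB(1) b(1)] .
          then show "compose Q (inv_map B ?c) ?\<chi> u = cq (inv x) ?\<chi> u"
            using u b xS sbgD(1)[OF sb(3)] by (simp add: compose_eq del: compose_def)
        qed auto
        then show ?thesis using 1 e True fcov_iso[OF sb(3) C(1) cB f] by (simp add: fcon_def)
      next
        case False
        have "?\<chi> \<notin> F Q (A \<inter> ?C)" using False hom_iff_image[OF C(2,1)] img(2)[OF C(2)] by blast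
        then have 1: "?f2 ?\<chi> = \<zero>\<^bsub>V\<^esub>" by (simp add: fcon_def)
        have "cq (inv x) ?\<chi> \<notin> F Q B"
        proof
          assume "cq (inv x) ?\<chi> \<in> F Q B"
          then have "cj S (inv x) ` ?\<chi> ` Q \<subseteq> B" using img(2)[OF sb(3)] compose_image[of Q "cj S (inv x)"] by metis
          then have "cj S x ` cj S (inv x) ` ?\<chi> ` Q \<subseteq> ?C" by blast
          then have "?\<chi> ` Q \<subseteq> ?C" using cj_image_inv(2)[OF xS img(1)[OF sb(2) \<chi>]] by simp
          then show False using False hom_iff_image[OF sb(2) C(1) \<chi>] by blast
        qed
        then show ?thesis using 1 e fixcD(2)[OF f] by simp
      qed
    qed (use fixcD(1)[OF f] in auto)
    ultimately show ?thesis by simp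
    qed
    then show ?thesis by (intro V.finsum_cong') auto
  qed
  finally show ?thesis .
qed

end

section \<open>The subfunctor generated by the value at Q\<close>

context aut_module
begin

lemma fcov_zero: "\<lbrakk>sbg P; sbg R; \<alpha> \<in> F P R\<rbrakk> \<Longrightarrow> fcov P R \<alpha> (\<lambda>\<phi>. \<zero>\<^bsub>V\<^esub>) = (\<lambda>\<phi>. \<zero>\<^bsub>V\<^esub>)"
  using lin_maps_zero[OF fixmod_module fixmod_module fcov_lin] by fastforce

lemma fcon_zero: "fcon P \<alpha> (\<lambda>\<phi>. \<zero>\<^bsub>V\<^esub>) = (\<lambda>\<phi>. \<zero>\<^bsub>V\<^esub>)"
  by (auto simp: fcon_def)

lemma fcov_add:
  "\<lbrakk>sbg P; sbg R; \<alpha> \<in> F P R; f \<in> fixc P; g \<in> fixc P\<rbrakk>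
    \<Longrightarrow> fcov P R \<alpha> (\<lambda>\<phi>. f \<phi> \<oplus>\<^bsub>V\<^esub> g \<phi>) = (\<lambda>\<phi>. fcov P R \<alpha> f \<phi> \<oplus>\<^bsub>V\<^esub> fcov P R \<alpha> g \<phi>)"
  using lin_mapsD(2)[OF fcov_lin, of P R \<alpha> f g] by simp

lemma fcov_smult:
  "\<lbrakk>sbg P; sbg R; \<alpha> \<in> F P R; f \<in> fixc P; a \<in> carrier k\<rbrakk>
    \<Longrightarrow> fcov P R \<alpha> (\<lambda>\<phi>. a \<odot>\<^bsub>V\<^esub> f \<phi>) = (\<lambda>\<phi>. a \<odot>\<^bsub>V\<^esub> fcov P R \<alpha> f \<phi>)"
  using lin_mapsD(3)[OF fcov_lin, of P R \<alpha> a f] by simp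

lemma inv_map_inv_map:
  assumes "sbg P" "sbg R" "\<alpha> \<in> F P R"
  shows "inv_map (\<alpha> ` P) (inv_map P \<alpha>) = \<alpha>"
proof (rule extensionalityI[of _ P])
  note i = hom_inv_map[OF assms]
  have sb: "sbg (\<alpha> ` P)" using hom_image_sbg assms by blast
  note j = hom_inv_map[OF sb assms(1) i(1)]
  show "\<alpha> \<in> extensional P" using hom_ext[OF assms] .
  show "inv_map (\<alpha> ` P) (inv_map P \<alpha>) \<in> extensional P" using hom_ext[OF assms(1) sb] j(1) i(5) by simp
  fix u assume u: "u \<in> P"
  show "inv_map (\<alpha> ` P) (inv_map P \<alpha>) u = \<alpha> u" using j(4)[of "\<alpha> u"] i(4)[OF u] u by simp
qed

lemma fcon_iso:
  assumes "sbg P" "sbg R" "\<alpha> \<in> F P R" "\<alpha> ` P = R" "f \<in> fixc R"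
  shows "fcon P \<alpha> f = fcov R P (inv_map P \<alpha>) f"
  using fcov_iso[OF assms(2,1), of "inv_map P \<alpha>" f] hom_inv_map[OF assms(1-3)] inv_map_inv_map[OF assms(1-3)] assms
  by simp

text \<open>Restriction along any morphism is restriction to its image followed by an isomorphism,
  and isomorphisms act as transfers. Closure questions thus reduce to inclusions, where the Mackey
  formula applies.\<close>

lemma fcon_factor:
  assumes "sbg P" "sbg R" "\<alpha> \<in> F P R" "f \<in> fixc R"
  shows "fcon P \<alpha> f = fcov (\<alpha> ` P) P (inv_map P \<alpha>) (fcon (\<alpha> ` P) (incl (\<alpha> ` P)) f)"
proof -
  have sb: "sbg (\<alpha> ` P)" "\<alpha> ` P \<subseteq> R" using assms hom_image_sbg hom_image by blast+
  have i: "incl (\<alpha> ` P) \<in> F (\<alpha> ` P) R" using hom_incl sb assms by blast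
  have a: "\<alpha> \<in> F P (\<alpha> ` P)" using hom_iso_image assms by blast
  have "compose P (incl (\<alpha> ` P)) \<alpha> = \<alpha>" using compose_incl[OF hom_ext[OF assms(1-3)]] by simp
  then have "fcon P \<alpha> f = fcon P \<alpha> (fcon (\<alpha> ` P) (incl (\<alpha> ` P)) f)"
    using fcon_comp[OF assms(1) sb(1) assms(2) a i, of f] by simp
  then show ?thesis
    using fcon_iso[OF assms(1) sb(1) a refl fcon_in[OF sb(1) assms(2) i assms(4)]] by simp
qed

text \<open>Equivariance forces this formula: it is the only element of \<open>fixc Q\<close> with
  value v at the identity.\<close>

definition fv :: "'v \<Rightarrow> ('a \<Rightarrow> 'a) \<Rightarrow> 'v"
  where "fv v \<phi> = (if \<phi> \<in> F Q Q then \<sigma> (inv_map Q \<phi>) v else \<zero>\<^bsub>V\<^esub>)"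

lemma incl_Q: "incl Q \<in> F Q Q"
  using hom_incl[OF Q Q] by blast

lemma act_cancel: "\<lbrakk>b \<in> F Q Q; u \<in> carrier V; \<sigma> b u = v\<rbrakk> \<Longrightarrow> u = \<sigma> (inv_map Q b) v"
  using act_inv(1) by auto

lemma fv_in: "v \<in> carrier V \<Longrightarrow> fv v \<in> fixc Q"
proof (rule fixcI)
  assume v: "v \<in> carrier V"
  have cl: "\<sigma> (inv_map Q \<phi>) v \<in> carrier V" if "\<phi> \<in> F Q Q" for \<phi>
    using act_closed[OF aut_inv(1)[OF that] v] .
  then show "fv v \<phi> \<in> carrier V" for \<phi> by (simp add: fv_def)
  fix \<phi> assume \<phi>: "\<phi> \<in> F Q Q"
  show "\<sigma> b (fv v (compose Q \<phi> b)) = fv v \<phi>" if b: "b \<in> F Q Q" for b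
  proof -
    have c: "compose Q \<phi> b \<in> F Q Q" using aut_hom[OF Q \<phi> b] .
    have "\<sigma> \<phi> (\<sigma> b (\<sigma> (inv_map Q (compose Q \<phi> b)) v)) = v"
      using act_inv(2)[OF c v] act_comp[OF \<phi> b cl[OF c]] by simp
    then show ?thesis using act_cancel[OF \<phi> act_closed[OF b cl[OF c]]] \<phi> c by (simp add: fv_def)
  qed
  show "fv v (cq g \<phi>) = fv v \<phi>" if g: "g \<in> Q" for g
  proof -
    have c: "cq g \<phi> \<in> F Q Q" using cq_hom[OF Q \<phi> g] .
    have r: "restrict (cj S g) Q \<in> F Q Q"
      using hom_conj[OF Q Q, of g] cj_image_self[OF Q g] sbgD(1)[OF Q g] by blast
    have "cq g \<phi> = compose Q (restrict (cj S g) Q) \<phi>" by (simp add: compose_restrict[OF img(2)[OF Q \<phi>]])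
    then have "\<sigma> (restrict (cj S g) Q) (\<sigma> \<phi> (\<sigma> (inv_map Q (cq g \<phi>)) v)) = v"
      using act_inv(2)[OF c v] act_comp[OF r \<phi> cl[OF c]] by simp
    then have "\<sigma> \<phi> (\<sigma> (inv_map Q (cq g \<phi>)) v) = v" using act_inn[OF g act_closed[OF \<phi> cl[OF c]]] by simp
    then show ?thesis using act_cancel[OF \<phi> cl[OF c]] \<phi> c by (simp add: fv_def)
  qed
qed (simp add: fv_def)

lemma fixc_Q:
  assumes f: "f \<in> fixc Q"
  shows "f = fv (f (incl Q))"
proof (rule fixc_eqI[OF f fv_in[OF fixcD(1)[OF f]]])
  fix \<phi> assume \<phi>: "\<phi> \<in> F Q Q"
  have "\<sigma> \<phi> (f \<phi>) = f (incl Q)"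
    using fixcD(3)[OF f incl_Q \<phi>] compose_incl[OF extQ[OF Q \<phi>] img(2)[OF Q \<phi>]] by simp
  then show "f \<phi> = fv (f (incl Q)) \<phi>" using act_cancel[OF \<phi> fixcD(1)[OF f, of \<phi>]] \<phi> by (simp add: fv_def)
qed

lemma fv_incl: "v \<in> carrier V \<Longrightarrow> fv v (incl Q) = v"
proof -
  assume v: "v \<in> carrier V"
  have "\<sigma> (incl Q) (fv v (incl Q)) = v" using act_inv(2)[OF incl_Q v] incl_Q by (simp add: fv_def)
  then show ?thesis using act_id fixcD(1)[OF fv_in[OF v]] by simp
qed

lemma fcon_incl_val: "\<lbrakk>sbg P; \<phi> \<in> F Q P\<rbrakk> \<Longrightarrow> fcon Q \<phi> f (incl Q) = f \<phi>"
  using incl_Q compose_id[OF extQ] by (simp add: fcon_def)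

text \<open>Finite sums of transfers from Q, built one summand at a time to give an induction
  principle; scalars are absorbed into v.\<close>

inductive_set gen :: "'a set \<Rightarrow> (('a \<Rightarrow> 'a) \<Rightarrow> 'v) set" for P where
  gen_zero: "(\<lambda>\<phi>. \<zero>\<^bsub>V\<^esub>) \<in> gen P"
| gen_step: "\<lbrakk>\<chi> \<in> F Q P; v \<in> fixc Q; f \<in> gen P\<rbrakk> \<Longrightarrow> (\<lambda>\<phi>. fcov Q P \<chi> v \<phi> \<oplus>\<^bsub>V\<^esub> f \<phi>) \<in> gen P"

lemma gen_fixc: "\<lbrakk>sbg P; f \<in> gen P\<rbrakk> \<Longrightarrow> f \<in> fixc P"
  by (rotate_tac 1, induction rule: gen.induct) (auto intro: fixc_zero fixc_add fcov_in[OF Q])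

lemma gen_fcov: "\<lbrakk>sbg P; \<chi> \<in> F Q P; v \<in> fixc Q\<rbrakk> \<Longrightarrow> fcov Q P \<chi> v \<in> gen P"
  using gen_step[of \<chi> P v, OF _ _ gen_zero] fixcD(1)[OF fcov_in[OF Q]] by simp

lemma gen_add:
  assumes "sbg P" "f \<in> gen P" "g \<in> gen P"
  shows "(\<lambda>\<phi>. f \<phi> \<oplus>\<^bsub>V\<^esub> g \<phi>) \<in> gen P"
  using assms(2)
proof induction
  case gen_zero
  then show ?case using assms fixcD(1)[OF gen_fixc[OF assms(1,3)]] by simp
next
  case (gen_step \<chi> v f)
  have "(\<lambda>\<phi>. fcov Q P \<chi> v \<phi> \<oplus>\<^bsub>V\<^esub> (f \<phi> \<oplus>\<^bsub>V\<^esub> g \<phi>)) \<in> gen P"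
    using gen_step gen.gen_step by blast
  then show ?case
    using fixcD(1)[OF gen_fixc[OF assms(1) gen_step(3)]] fixcD(1)[OF gen_fixc[OF assms(1,3)]]
      fixcD(1)[OF fcov_in[OF Q assms(1) gen_step(1,2)]]
    by (simp add: V.M.a_assoc)
qed

lemma gen_smult:
  assumes "sbg P" "f \<in> gen P" "a \<in> carrier k"
  shows "(\<lambda>\<phi>. a \<odot>\<^bsub>V\<^esub> f \<phi>) \<in> gen P"
  using assms(2)
proof induction
  case gen_zero
  then show ?case using assms gen.gen_zero by simp
next
  case (gen_step \<chi> v f)
  have "(\<lambda>\<phi>. fcov Q P \<chi> (\<lambda>\<phi>. a \<odot>\<^bsub>V\<^esub> v \<phi>) \<phi> \<oplus>\<^bsub>V\<^esub> a \<odot>\<^bsub>V\<^esub> f \<phi>) \<in> gen P"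
    using gen_step fixc_smult[OF assms(3)] by (intro gen.gen_step) auto
  then show ?case
    using gen_step(1,2) assms fixcD(1)[OF gen_fixc[OF assms(1) gen_step(3)]]
      fixcD(1)[OF fcov_in[OF Q assms(1) gen_step(1,2)]]
    by (simp add: fcov_smult Q V.smult_r_distr)
qed

lemma gen_submodule: "sbg P \<Longrightarrow> submodule (gen P) k (fixmod P)"
  using gen_fixc gen_zero gen_add gen_smult by (intro submodule_of_closed fixmod_module) auto

lemma gen_fcov_closed:
  assumes "sbg P" "sbg R" "\<alpha> \<in> F P R" "f \<in> gen P"
  shows "fcov P R \<alpha> f \<in> gen R"
  using assms(4)
proof induction
  case gen_zero
  then show ?case using fcov_zero[OF assms(1-3)] gen.gen_zero by simp
next
  case (gen_step \<chi> v f)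
  have "fcov P R \<alpha> (fcov Q P \<chi> v) = fcov Q R (compose Q \<alpha> \<chi>) v"
    using fcov_comp[OF Q assms(1,2) _ assms(3)] gen_step by simp
  moreover have "compose Q \<alpha> \<chi> \<in> F Q R" using hom_comp[OF Q assms(1,2) _ assms(3)] gen_step by simp
  moreover have "fcov P R \<alpha> (\<lambda>\<phi>. fcov Q P \<chi> v \<phi> \<oplus>\<^bsub>V\<^esub> f \<phi>)
      = (\<lambda>\<phi>. fcov P R \<alpha> (fcov Q P \<chi> v) \<phi> \<oplus>\<^bsub>V\<^esub> fcov P R \<alpha> f \<phi>)"
    using gen_step by (intro fcov_add[OF assms(1-3)] fcov_in[OF Q assms(1)] gen_fixc[OF assms(1)])
  ultimately show ?case using gen.gen_step[of "compose Q \<alpha> \<chi>" R v] gen_step by simp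
qed

text \<open>The Mackey formula is stated for given representatives; using it requires that some
  exist.\<close>

lemma double_coset_reps_exist:
  assumes sb: "sbg A" "sbg B" "sbg P" "A \<subseteq> P" "B \<subseteq> P"
  obtains T where "double_coset_reps S A P B T"
proof -
  define D where "D y = (A #> y) <#> B" for y
  have mem: "y \<in> D x \<longleftrightarrow> (\<exists>a\<in>A. \<exists>b\<in>B. y = a \<otimes> x \<otimes> b)" for x y
    by (auto simp: D_def set_mult_def r_coset_def)
  have P: "x \<in> carrier S" if "x \<in> P" for x using that sbgD(1)[OF sb(3)] by blast
  have AB: "x \<in> A \<Longrightarrow> x \<in> carrier S" "x \<in> B \<Longrightarrow> x \<in> carrier S" for x using P sb by auto
  have self: "y \<in> D y" if "y \<in> P" for y
    unfolding mem using that P sbgD(2)[OF sb(1)] sbgD(2)[OF sb(2)] by (intro bexI[of _ \<one>]) auto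
  have sub: "D y \<subseteq> P" if "y \<in> P" for y
    using that subsetD[OF sb(4)] subsetD[OF sb(5)] sbgD(3)[OF sb(3)] unfolding subset_iff mem by blast
  have le: "D x \<subseteq> D y" if xy: "x \<in> D y" "y \<in> P" for x y
  proof
    fix z assume "z \<in> D x"
    then obtain a b where ab: "a \<in> A" "b \<in> B" "z = a \<otimes> x \<otimes> b" by (auto simp: mem)
    obtain a' b' where ab': "a' \<in> A" "b' \<in> B" "x = a' \<otimes> y \<otimes> b'" using xy(1) by (auto simp: mem)
    have "z = (a \<otimes> a') \<otimes> y \<otimes> (b' \<otimes> b)" using ab ab' AB P[OF xy(2)] by (simp add: m_assoc)
    then show "z \<in> D y" unfolding mem using ab ab' sbgD(3)[OF sb(1)] sbgD(3)[OF sb(2)] by blast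
  qed
  have sym: "y \<in> D x" if xy: "x \<in> D y" "y \<in> P" for x y
  proof -
    obtain a b where ab: "a \<in> A" "b \<in> B" "x = a \<otimes> y \<otimes> b" using xy(1) by (auto simp: mem)
    have "y = inv a \<otimes> x \<otimes> inv b" using ab AB P[OF xy(2)] by (simp add: m_assoc)
    then show ?thesis unfolding mem using ab sbgD(4)[OF sb(1)] sbgD(4)[OF sb(2)] by blast
  qed
  define r where "r C = (SOME x. x \<in> C)" for C :: "'a set"
  have r: "r (D y) \<in> D y" if "y \<in> P" for y unfolding r_def using self[OF that] by (rule someI[of "\<lambda>x. x \<in> D y"])
  define T where "T = (\<lambda>y. r (D y)) ` P"
  have "\<exists>!x. x \<in> T \<and> y \<in> D x" if y: "y \<in> P" for y
  proof (rule ex1I)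
    show "r (D y) \<in> T \<and> y \<in> D (r (D y))" using y sym[OF r[OF y] y] by (auto simp: T_def)
    fix x assume x: "x \<in> T \<and> y \<in> D x"
    then obtain z where z: "z \<in> P" "x = r (D z)" by (auto simp: T_def)
    have xz: "x \<in> D z" using r z by simp
    have xP: "x \<in> P" using sub[OF z(1)] xz by blast
    have "D y = D x" using le[of y x] le[of x y] sym[of y x] x xP y by blast
    moreover have "D x = D z" using le[OF xz z(1)] le[OF sym[OF xz z(1)] xP] by blast
    ultimately show "x = r (D y)" using z by simp
  qed
  moreover have "T \<subseteq> P" using r sub by (auto simp: T_def)
  ultimately have "double_coset_reps S A P B T" by (simp add: double_coset_reps_def D_def)
  then show ?thesis using that by blast
qed

text \<open>The Mackey formula for A and the copy \<chi>(Q) of Q. A conjugate of \<chi>(Q) either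
  lies in A, giving a transfer from Q again, or meets A in a group of order below that of Q, on
  which every function of the model is zero.\<close>

lemma gen_fcon_incl:
  assumes sb: "sbg A" "sbg R" "A \<subseteq> R" and \<chi>: "\<chi> \<in> F Q R" and v: "v \<in> fixc Q"
  shows "fcon A (incl A) (fcov Q R \<chi> v) \<in> gen A"
proof -
  let ?B = "\<chi> ` Q"
  have B: "sbg ?B" "?B \<subseteq> R" using img_sbg[OF sb(2) \<chi>] img(2)[OF sb(2) \<chi>] by auto
  have \<chi>B: "\<chi> \<in> F Q ?B" using hom_iso_image[OF Q sb(2) \<chi>] .
  have iB: "incl ?B \<in> F ?B R" using hom_incl B sb by blast
  let ?w = "fcov Q ?B \<chi> v"
  have w: "?w \<in> fixc ?B" using fcov_in[OF Q B(1) \<chi>B v] .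
  have "compose Q (incl ?B) \<chi> = \<chi>" using compose_incl[OF extQ[OF sb(2) \<chi>]] by simp
  then have eq: "fcov Q R \<chi> v = fcov ?B R (incl ?B) ?w"
    using fcov_comp[OF Q B(1) sb(2) \<chi>B iB v] by simp
  obtain T where T: "double_coset_reps S A R ?B T"
    using double_coset_reps_exist[OF sb(1) B(1) sb(2,3) B(2)] .
  let ?t = "\<lambda>x. fcov (A \<inter> cj S x ` ?B) A (incl (A \<inter> cj S x ` ?B))
      (fcon (A \<inter> cj S x ` ?B) (incl (A \<inter> cj S x ` ?B)) (fcov ?B (cj S x ` ?B) (restrict (cj S x) ?B) ?w))"
  have t: "?t x \<in> gen A" if x: "x \<in> T" for x
  proof -
    have xS: "x \<in> carrier S" using T x sbgD(1)[OF sb(2)] by (auto simp: double_coset_reps_def)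
    let ?C = "cj S x ` ?B" and ?c = "restrict (cj S x) ?B"
    have C: "sbg ?C" "sbg (A \<inter> ?C)" using sb B xS by (auto intro!: subgroups_Inter_pair cj_image_sbg)
    have cB: "?c \<in> F ?B ?C" using hom_conj[OF B(1) C(1) xS] by auto
    have iD: "incl (A \<inter> ?C) \<in> F (A \<inter> ?C) ?C" "incl (A \<inter> ?C) \<in> F (A \<inter> ?C) A"
      using C sb by (auto intro!: hom_incl)
    have w': "fcov ?B ?C ?c ?w \<in> gen ?C"
      using gen_fcov_closed[OF B(1) C(1) cB gen_fcov[OF B(1) \<chi>B v]] .
    show ?thesis
    \<comment> \<open>When the conjugate lies inside A, the inner restriction is the identity and
      only transfers remain.\<close>
    proof (cases "A \<inter> ?C = ?C")
      case True
      then have "?t x = fcov ?C A (incl ?C) (fcov ?B ?C ?c ?w)"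
        using fcon_id[OF C(1) gen_fixc[OF C(1) w']] by simp
      then show ?thesis using gen_fcov_closed[OF C(1) sb(1) _ w'] iD(2) True by simp
    next
      case False
      have fC: "finite ?C" using finite_sbg[OF C(1)] .
      have "card (A \<inter> ?C) < card ?C" using False by (intro psubset_card_mono[OF fC]) auto
      also have "card ?C \<le> card Q"
        using card_image_le[OF finite_sbg[OF B(1)], of "cj S x"] card_image_le[OF finite_sbg[OF Q], of \<chi>] by linarith
      finally have lt: "card (A \<inter> ?C) < card Q" .
      \<comment> \<open>Morphisms are injective, so none leads from Q to a smaller group.\<close>
      have none: "\<phi> \<notin> F Q (A \<inter> ?C)" for \<phi>
      proof
        assume \<phi>: "\<phi> \<in> F Q (A \<inter> ?C)"
        have "card Q = card (\<phi> ` Q)" using hom_inj[OF Q C(2) \<phi>] by (simp add: card_image)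
        also have "\<dots> \<le> card (A \<inter> ?C)" using img(2)[OF C(2) \<phi>] fC by (intro card_mono) auto
        finally show False using lt by simp
      qed
      have "fcon (A \<inter> ?C) (incl (A \<inter> ?C)) (fcov ?B ?C ?c ?w) = (\<lambda>\<phi>. \<zero>\<^bsub>V\<^esub>)"
        using none by (auto simp: fcon_def)
      then show ?thesis using fcov_zero[OF C(2) sb(1) iD(2)] gen_zero by simp
    qed
  qed
  have s: "(\<Oplus>\<^bsub>fixmod A\<^esub> x\<in>T. ?t x) \<in> gen A"
    using t by (intro submodule_finsum_closed[OF fixmod_module[OF sb(1)] gen_submodule[OF sb(1)]]) auto
  have "fcon A (incl A) (fcov Q R \<chi> v) = (\<Oplus>\<^bsub>fixmod A\<^esub> x\<in>T. ?t x)"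
  proof (rule fixc_eqI[of _ A])
    show "fcon A (incl A) (fcov Q R \<chi> v) \<in> fixc A"
      using fcon_in[OF sb(1,2) hom_incl[OF sb] fcov_in[OF Q sb(2) \<chi> v]] .
    show "(\<Oplus>\<^bsub>fixmod A\<^esub> x\<in>T. ?t x) \<in> fixc A" using s gen_fixc sb by blast
    fix \<phi> assume \<phi>: "\<phi> \<in> F Q A"
    have "(\<Oplus>\<^bsub>fixmod A\<^esub> x\<in>T. ?t x) \<phi> = (\<Oplus>\<^bsub>V\<^esub> x\<in>T. ?t x \<phi>)"
      using t gen_fixc[OF sb(1)] by (intro fixmod_finsum[OF sb(1)]) auto
    then show "fcon A (incl A) (fcov Q R \<chi> v) \<phi> = (\<Oplus>\<^bsub>fixmod A\<^esub> x\<in>T. ?t x) \<phi>"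
      using fix_mackey_formula[OF sb(2,1) B(1) sb(3) B(2) T w \<phi>] eq by simp
  qed
  then show ?thesis using s by simp
qed

lemma fcon_add: "fcon P \<alpha> (\<lambda>\<phi>. f \<phi> \<oplus>\<^bsub>V\<^esub> g \<phi>) = (\<lambda>\<phi>. fcon P \<alpha> f \<phi> \<oplus>\<^bsub>V\<^esub> fcon P \<alpha> g \<phi>)"
  by (auto simp: fcon_def)

lemma gen_fcon_closed:
  assumes "sbg P" "sbg R" "\<alpha> \<in> F P R" "f \<in> gen R"
  shows "fcon P \<alpha> f \<in> gen P"
  using assms(4)
proof induction
  case gen_zero
  then show ?case using gen.gen_zero by (simp add: fcon_zero)
next
  case (gen_step \<chi> v f)
  have sb: "sbg (\<alpha> ` P)" "\<alpha> ` P \<subseteq> R" using assms hom_image_sbg hom_image by blast+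
  have "fcon P \<alpha> (fcov Q R \<chi> v) \<in> gen P"
    using fcon_factor[OF assms(1-3) fcov_in[OF Q assms(2)], of \<chi> v] gen_step
      gen_fcov_closed[OF sb(1) assms(1) hom_inv_map(1)[OF assms(1-3)] gen_fcon_incl[OF sb(1) assms(2) sb(2)]]
    by simp
  then show ?case using gen_add[OF assms(1)] gen_step by (simp add: fcon_add)
qed

text \<open>A nonzero value requires a nonzero term, and the term at g is an extension by zero that
  vanishes unless c_g^{-1} \<psi> has the form \<chi> b.\<close>

lemma fcov_support:
  assumes P: "sbg P" and \<chi>: "\<chi> \<in> F Q P" and \<psi>: "\<psi> \<in> F Q P" and nz: "fcov Q P \<chi> v \<psi> \<noteq> \<zero>\<^bsub>V\<^esub>"
  shows "\<exists>g\<in>P. \<exists>b\<in>F Q Q. \<psi> = cq g (compose Q \<chi> b)"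
proof (rule ccontr)
  assume *: "\<not> ?thesis"
  have sb: "sbg (\<chi> ` Q)" "\<chi> ` Q \<subseteq> P" using img_sbg[OF P \<chi>] img(2)[OF P \<chi>] by auto
  have "lift Q \<chi> v (cq (inv g) \<psi>) = \<zero>\<^bsub>V\<^esub>" if g: "g \<in> P" for g
  proof (rule lift_out, rule notI)
    fix b assume b: "b \<in> F Q Q" "compose Q \<chi> b = cq (inv g) \<psi>"
    then have "\<psi> = cq g (compose Q \<chi> b)" using cq_inv(2)[OF P \<psi> sbgD(1)[OF P g]] by simp
    then show False using * g b(1) by blast
  qed
  then show False using nz csum_zero[OF abV sb(1) P sb(2)] \<psi> by (simp add: fcov_def)
qed

text \<open>Replacing \<chi> by c_g \<chi> b is compensated by applying b^{-1} to v; the conjugation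
  c_g is invisible to transfer.\<close>

lemma fcov_change:
  assumes P: "sbg P" and \<chi>: "\<chi> \<in> F Q P" and v: "v \<in> fixc Q" and g: "g \<in> P" and b: "b \<in> F Q Q"
  obtains w where "w \<in> fixc Q" "fcov Q P \<chi> v = fcov Q P (cq g (compose Q \<chi> b)) w"
proof
  note bi = aut_inv[OF b]
  let ?w = "fcov Q Q (inv_map Q b) v"
  show w: "?w \<in> fixc Q" using fcov_in[OF Q Q bi(1) v] .
  have c: "compose Q \<chi> b \<in> F Q P" using aut_hom[OF P \<chi> b] .
  have "fcov Q P (cq g (compose Q \<chi> b)) ?w = fcov Q P (compose Q \<chi> b) ?w"
    using fcov_cj[OF Q P c g w] .
  also have "\<dots> = fcov Q P (compose Q (compose Q \<chi> b) (inv_map Q b)) v"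
    using fcov_comp[OF Q Q P bi(1) c v] by simp
  also have "\<dots> = fcov Q P \<chi> v" using aut_cancel(1)[OF P \<chi> b] by simp
  finally show "fcov Q P \<chi> v = fcov Q P (cq g (compose Q \<chi> b)) ?w" by simp
qed

text \<open>Every generator that contributes at \<psi> can be rewritten as a transfer along \<psi>
  itself, and transfers along the same morphism add. At \<open>\<alpha> L\<close> this will say that
  the value is a single relative trace, that is, an element of Webb's summand.\<close>

lemma gen_value:
  assumes P: "sbg P" and \<psi>: "\<psi> \<in> F Q P" and f: "f \<in> gen P"
  shows "\<exists>w\<in>fixc Q. f \<psi> = fcov Q P \<psi> w \<psi>"
  using f
proof induction
  case gen_zero
  then show ?case using fcov_zero[OF Q P \<psi>] fixc_zero[of Q] by (auto intro!: bexI)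
next
  case (gen_step \<chi> v f)
  then obtain w where w: "w \<in> fixc Q" "f \<psi> = fcov Q P \<psi> w \<psi>" by auto
  have "\<exists>u\<in>fixc Q. fcov Q P \<chi> v \<psi> = fcov Q P \<psi> u \<psi>"
  proof (cases "fcov Q P \<chi> v \<psi> = \<zero>\<^bsub>V\<^esub>")
    case True
    then show ?thesis using fcov_zero[OF Q P \<psi>] fixc_zero[of Q] by (auto intro!: bexI)
  next
    case False
    then obtain g b where "g \<in> P" "b \<in> F Q Q" "\<psi> = cq g (compose Q \<chi> b)"
      using fcov_support[OF P gen_step(1) \<psi>] by blast
    then show ?thesis using fcov_change[OF P gen_step(1,2)] by metis
  qed
  then obtain u where u: "u \<in> fixc Q" "fcov Q P \<chi> v \<psi> = fcov Q P \<psi> u \<psi>" by auto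
  then show ?case
    using w fcov_add[OF Q P \<psi> u(1) w(1)] fixc_add[OF u(1) w(1)]
    by (intro bexI[of _ "\<lambda>\<phi>. u \<phi> \<oplus>\<^bsub>V\<^esub> w \<phi>"]) simp_all
qed

end

section \<open>The Mackey functor over X, and simplicity of the generated subfunctor\<close>

locale fix_setting = aut_module S p F k V Q \<sigma> + fusion_collection S p F X
  for S :: "'a monoid" (structure) and p F X and k :: "'k ring" and V :: "('k, 'v) module" and Q \<sigma> +
  assumes QX: "Q \<in> X"
begin

lemma fix_functor: "mackey_functor k S F X fix_mackey"
proof (rule mackey_functorI)
  fix P R \<phi> assume *: "P \<in> X" "R \<in> X" "\<phi> \<in> F P R"
  note sb = X_sbg[OF *(1)] X_sbg[OF *(2)]
  show "mcon fix_mackey P R \<phi> \<in> lin_maps k (obj fix_mackey R) (obj fix_mackey P)"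
    using lin_mapsD[OF fcon_lin[OF sb *(3)]] fixc_add fixc_smult sb *
    by (intro lin_mapsI) (simp_all add: fcon_mcon)
  show "mcov fix_mackey P R \<phi> \<in> lin_maps k (obj fix_mackey P) (obj fix_mackey R)"
    using lin_mapsD[OF fcov_lin[OF sb *(3)]] fixc_add fixc_smult sb *
    by (intro lin_mapsI) (simp_all add: fcon_mcon)
  show "mcon fix_mackey P R \<phi> m = mcov fix_mackey R P (inv_map P \<phi>) m"
    if "\<phi> ` P = R" "m \<in> carrier (obj fix_mackey R)" for m
    using that * sb hom_inv_map(1)[OF sb *(3)] fcon_iso[OF sb *(3)] by (simp add: fcon_mcon)
next
  fix P R T \<phi> \<psi> m assume *: "P \<in> X" "R \<in> X" "T \<in> X" "\<phi> \<in> F P R" "\<psi> \<in> F R T"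
  note sb = X_sbg[OF *(1)] X_sbg[OF *(2)] X_sbg[OF *(3)]
  have c: "compose P \<psi> \<phi> \<in> F P T" using hom_comp[OF sb *(4,5)] .
  show "mcon fix_mackey P T (compose P \<psi> \<phi>) m = mcon fix_mackey P R \<phi> (mcon fix_mackey R T \<psi> m)"
    if "m \<in> carrier (obj fix_mackey T)"
    using that * sb c fcon_in[OF sb(2,3) *(5)] by (simp add: fcon_mcon fcon_comp[OF sb *(4,5)])
  show "mcov fix_mackey P T (compose P \<psi> \<phi>) m = mcov fix_mackey R T \<psi> (mcov fix_mackey P R \<phi> m)"
    if "m \<in> carrier (obj fix_mackey P)"
    using that * sb c fcov_in[OF sb(1,2) *(4)] by (simp add: fcon_mcon fcov_comp[OF sb *(4,5)])
next
  fix P m assume *: "P \<in> X" "m \<in> carrier (obj fix_mackey P)"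
  note sb = X_sbg[OF *(1)]
  show "mcon fix_mackey P P (incl P) m = m" "mcov fix_mackey P P (incl P) m = m"
    using * sb hom_incl[OF sb sb] by (simp_all add: fcon_mcon fcon_id fcov_id)
next
  fix P A B T f
  assume *: "P \<in> X" "A \<in> X" "B \<in> X" "A \<subseteq> P" "B \<subseteq> P" "double_coset_reps S A P B T"
    and f: "f \<in> carrier (obj fix_mackey B)"
  note sb = X_sbg[OF *(1)] X_sbg[OF *(2)] X_sbg[OF *(3)] *(4,5)
  note f = f[simplified]
  let ?I = "{x \<in> T. A \<inter> cj S x ` B \<in> X}"
  let ?t = "\<lambda>x. fcov (A \<inter> cj S x ` B) A (incl (A \<inter> cj S x ` B))
      (fcon (A \<inter> cj S x ` B) (incl (A \<inter> cj S x ` B)) (fcov B (cj S x ` B) (restrict (cj S x) B) f))"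
  let ?m = "\<lambda>x. mackey_term fix_mackey A B x f"
  have t: "?t x \<in> fixc A \<and> ?m x = ?t x \<and> (A \<inter> cj S x ` B \<notin> X \<longrightarrow> ?t x = (\<lambda>\<phi>. \<zero>\<^bsub>V\<^esub>))" if x: "x \<in> T" for x
  proof -
    have xS: "x \<in> carrier S" using x dcr_subset[OF *(6)] sbgD(1)[OF sb(1)] by blast
    let ?C = "cj S x ` B" and ?c = "restrict (cj S x) B"
    have C: "sbg ?C" "sbg (A \<inter> ?C)" using sb xS by (auto intro!: subgroups_Inter_pair cj_image_sbg)
    have cB: "?c \<in> F B ?C" using hom_conj[OF sb(3) C(1) xS] by auto
    have iD: "incl (A \<inter> ?C) \<in> F (A \<inter> ?C) ?C" "incl (A \<inter> ?C) \<in> F (A \<inter> ?C) A"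
      using C sb by (auto intro!: hom_incl)
    have f1: "fcov B ?C ?c f \<in> fixc ?C" using fcov_in[OF sb(3) C(1) cB f] .
    have f2: "fcon (A \<inter> ?C) (incl (A \<inter> ?C)) (fcov B ?C ?c f) \<in> fixc (A \<inter> ?C)"
      using fcon_in[OF C(2,1) iD(1) f1] .
    \<comment> \<open>Overconjugacy closure: as Q lies in X, a morphism from Q to the intersection
      would put the intersection into X. So functions on that hom set vanish, and the unrestricted
      Mackey sum agrees with the one over X.\<close>
    have "?t x = (\<lambda>\<phi>. \<zero>\<^bsub>V\<^esub>)" if "A \<inter> ?C \<notin> X"
    proof -
      have "\<phi> \<notin> F Q (A \<inter> ?C)" for \<phi> using that X_up[OF QX _ C(2)] by blast
      then have "fcon (A \<inter> ?C) (incl (A \<inter> ?C)) (fcov B ?C ?c f) = (\<lambda>\<phi>. \<zero>\<^bsub>V\<^esub>)"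
        by (auto simp: fcon_def)
      then show ?thesis using fcov_zero[OF C(2) sb(2) iD(2)] by simp
    qed
    moreover have "?t x \<in> fixc A" using fcov_in[OF C(2) sb(2) iD(2) f2] .
    moreover have "?m x = ?t x"
      by (simp add: fcon_mcon(2)[OF sb(3) C(1) cB f] fcon_mcon(1)[OF C(2,1) iD(1) f1] fcon_mcon(2)[OF C(2) sb(2) iD(2) f2])
    ultimately show ?thesis by blast
  qed
  have iA: "incl A \<in> F A P" "incl B \<in> F B P" using hom_incl sb by auto
  have f1: "fcov B P (incl B) f \<in> fixc P" using fcov_in[OF sb(3,1) iA(2) f] .
  interpret A: module k "fixmod A" by (rule fixmod_module[OF sb(2)])
  have "fcon A (incl A) (fcov B P (incl B) f) = (\<Oplus>\<^bsub>fixmod A\<^esub> x\<in>T. ?t x)"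
  proof (rule fixc_eqI[of _ A])
    show "fcon A (incl A) (fcov B P (incl B) f) \<in> fixc A" using fcon_in[OF sb(2,1) iA(1) f1] .
    show "(\<Oplus>\<^bsub>fixmod A\<^esub> x\<in>T. ?t x) \<in> fixc A" using t A.finsum_closed[of ?t T] by auto
    fix \<phi> assume \<phi>: "\<phi> \<in> F Q A"
    have "(\<Oplus>\<^bsub>fixmod A\<^esub> x\<in>T. ?t x) \<phi> = (\<Oplus>\<^bsub>V\<^esub> x\<in>T. ?t x \<phi>)"
      using t by (intro fixmod_finsum[OF sb(2)]) auto
    then show "fcon A (incl A) (fcov B P (incl B) f) \<phi> = (\<Oplus>\<^bsub>fixmod A\<^esub> x\<in>T. ?t x) \<phi>"
      using fix_mackey_formula[OF sb *(6) f \<phi>] by simp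
  qed
  also have "\<dots> = (\<Oplus>\<^bsub>fixmod A\<^esub> x\<in>?I. ?t x)"
  proof -
    have "finite T" using *(6) finite_sbg[OF sb(1)] finite_subset by (auto simp: double_coset_reps_def)
    then show ?thesis using t by (intro A.M.add.finprod_mono_neutral_cong_right) auto
  qed
  also have "\<dots> = (\<Oplus>\<^bsub>fixmod A\<^esub> x\<in>?I. ?m x)"
    using t by (intro A.M.finsum_cong') auto
  finally show "mcon fix_mackey A P (incl A) (mcov fix_mackey B P (incl B) f) = (\<Oplus>\<^bsub>obj fix_mackey A\<^esub> x\<in>?I. ?m x)"
    by (simp add: fcon_mcon(2)[OF sb(3,1) iA(2) f] fcon_mcon(1)[OF sb(2,1) iA(1) f1])
qed (simp add: fixmod_module X_sbg)

sublocale Fx: mackey_on S p F X k fix_mackey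
  using fix_functor by (simp add: mackey_on_def fusion_collection_axioms)

lemma gen_subfunctor: "subfunctor k S F X fix_mackey gen"
  unfolding subfunctor_def
proof (intro conjI ballI)
  fix P assume "P \<in> X"
  then show "submodule (gen P) k (obj fix_mackey P)" using gen_submodule X_sbg by simp
next
  fix P R \<phi> f assume *: "P \<in> X" "R \<in> X" "\<phi> \<in> F P R"
  note sb = X_sbg[OF *(1)] X_sbg[OF *(2)]
  show "f \<in> gen R \<Longrightarrow> mcon fix_mackey P R \<phi> f \<in> gen P"
    using gen_fcon_closed[OF sb *(3)] gen_fixc[OF sb(2)] by (simp add: fcon_mcon sb *)
  show "f \<in> gen P \<Longrightarrow> mcov fix_mackey P R \<phi> f \<in> gen R"
    using gen_fcov_closed[OF sb *(3)] gen_fixc[OF sb(1)] by (simp add: fcon_mcon sb *)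
qed

abbreviation "G \<equiv> sub_mackey fix_mackey gen"

lemma gen_functor: "mackey_functor k S F X G"
  by (rule Fx.subfunctor_mackey[OF gen_subfunctor])

sublocale G: mackey_on S p F X k G
  using gen_functor by (simp add: mackey_on_def fusion_collection_axioms)

lemma gen_Q: "gen Q = fixc Q"
proof
  show "gen Q \<subseteq> fixc Q" using gen_fixc[OF Q] by blast
  show "fixc Q \<subseteq> gen Q" using gen_fcov[OF Q incl_Q] fcov_id[OF Q] by force
qed

text \<open>Transfers from Q span \<open>gen\<close>, so a subfunctor that has everything at Q
  contains all of it.\<close>

lemma gen_least:
  assumes N: "subfunctor k S F X fix_mackey N" and NQ: "fixc Q \<subseteq> N Q" and P: "P \<in> X"
  shows "gen P \<subseteq> N P"
proof
  fix f assume "f \<in> gen P"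
  then show "f \<in> N P"
  proof induction
    case gen_zero
    then show ?case using submoduleD(2)[OF fixmod_module Fx.subfunctorD(1)[OF N P, simplified]] X_sbg[OF P] by simp
  next
    case (gen_step \<chi> v f)
    have "fcov Q P \<chi> v \<in> N P"
      using Fx.subfunctorD(4)[OF N QX P gen_step(1), of v] NQ gen_step fcon_mcon(2)[OF Q X_sbg[OF P]] by auto
    then show ?case
      using gen_step submoduleD(3)[OF fixmod_module Fx.subfunctorD(1)[OF N P, simplified]] X_sbg[OF P] by simp
  qed
qed

text \<open>A subfunctor is controlled by the set W of values at the identity of its elements over
  Q. Every value f(\<phi>) is the value at the identity of the restriction of f along \<phi>, so W =
  0 forces f = 0. If W is all of V, the subfunctor is everything at Q and \<open>gen_least\<close>
  applies.\<close>

lemma gen_simple: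
  assumes nz: "carrier V \<noteq> {\<zero>\<^bsub>V\<^esub>}"
    and simple: "\<And>W. \<lbrakk>submodule W k V; \<And>b w. \<lbrakk>b \<in> F Q Q; w \<in> W\<rbrakk> \<Longrightarrow> \<sigma> b w \<in> W\<rbrakk>
      \<Longrightarrow> W = {\<zero>\<^bsub>V\<^esub>} \<or> W = carrier V"
  shows "mackey_simple k S F X G"
  unfolding G.simple_iff
proof (intro conjI allI impI)
  obtain v where v: "v \<in> carrier V" "v \<noteq> \<zero>\<^bsub>V\<^esub>" using nz V.M.zero_closed by blast
  show "\<not> mackey_zero X G"
  proof
    assume "mackey_zero X G"
    then have "fv v = (\<lambda>\<phi>. \<zero>\<^bsub>V\<^esub>)" using QX gen_Q fv_in[OF v(1)] by (auto simp: mackey_zero_def)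
    then show False using fv_incl[OF v(1)] v(2) by simp
  qed
  fix N assume N: "subfunctor k S F X G N"
  note ND = G.subfunctorD[OF N]
  have Nsub: "N P \<subseteq> gen P" if "P \<in> X" for P using ND(2)[OF that] by simp
  have Nfix: "f \<in> fixc P" if "P \<in> X" "f \<in> N P" for P f using Nsub that gen_fixc X_sbg by blast
  \<comment> \<open>A subfunctor of \<open>G\<close> is viewed inside the full functor of
    equivariant functions, where \<open>gen_least\<close> is stated.\<close>
  have NM: "submodule (N P) k (fixmod P)" if P: "P \<in> X" for P
    using submoduleD[OF G.M.obj_module[OF P] ND(1)[OF P]] Nfix[OF P]
    by (intro submodule_of_closed[OF fixmod_module[OF X_sbg[OF P]]]) auto
  have Nf: "subfunctor k S F X fix_mackey N" unfolding subfunctor_def using NM ND(3,4) by simp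
  define W where "W = (\<lambda>f. f (incl Q)) ` N Q"
  have ev: "(\<lambda>f. f (incl Q)) \<in> lin_maps k (fixmod Q) V" by (rule lin_mapsI) (auto simp: fixcD(1))
  have "W = {\<zero>\<^bsub>V\<^esub>} \<or> W = carrier V"
  proof (rule simple)
    show "submodule W k V"
      unfolding W_def by (rule image_submodule[OF fixmod_module[OF Q] modV ev NM[OF QX]])
    fix b w assume b: "b \<in> F Q Q" and "w \<in> W"
    then obtain f where f: "f \<in> N Q" "w = f (incl Q)" by (auto simp: W_def)
    note bi = aut_inv[OF b]
    have fQ: "f \<in> fixc Q" using Nfix[OF QX f(1)] .
    \<comment> \<open>On values at the identity, b acts as restriction along b^{-1}, under which N
      is closed.\<close>
    have "\<sigma> b w = f (inv_map Q b)" using fixcD(3)[OF fQ bi(1) b] bi f by simp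
    also have "\<dots> = fcon Q (inv_map Q b) f (incl Q)" using fcon_incl_val[OF Q bi(1)] by simp
    also have "\<dots> \<in> W"
      using Fx.subfunctorD(3)[OF Nf QX QX bi(1) f(1)] fcon_mcon(1)[OF Q Q bi(1) fQ] by (simp add: W_def)
    finally show "\<sigma> b w \<in> W" .
  qed
  then show "(\<forall>P\<in>X. N P = {\<zero>\<^bsub>obj G P\<^esub>}) \<or> (\<forall>P\<in>X. N P = carrier (obj G P))"
  proof
    assume W: "W = {\<zero>\<^bsub>V\<^esub>}"
    have "f = (\<lambda>\<phi>. \<zero>\<^bsub>V\<^esub>)" if P: "P \<in> X" and f: "f \<in> N P" for P f
    proof (rule fixc_eqI[OF Nfix[OF P f] fixc_zero])
      fix \<phi> assume \<phi>: "\<phi> \<in> F Q P"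
      have "fcon Q \<phi> f \<in> N Q"
        using Fx.subfunctorD(3)[OF Nf QX P \<phi> f] fcon_mcon(1)[OF Q X_sbg[OF P] \<phi> Nfix[OF P f]] by simp
      then have "f \<phi> \<in> W" using fcon_incl_val[OF X_sbg[OF P] \<phi>] unfolding W_def by (metis imageI)
      then show "f \<phi> = \<zero>\<^bsub>V\<^esub>" using W by simp
    qed
    moreover have "(\<lambda>\<phi>. \<zero>\<^bsub>V\<^esub>) \<in> N P" if "P \<in> X" for P
      using submoduleD(2)[OF fixmod_module[OF X_sbg[OF that]] NM[OF that]] by simp
    ultimately show ?thesis by fastforce
  next
    assume W: "W = carrier V"
    have "fixc Q \<subseteq> N Q"
    proof
      fix f assume f: "f \<in> fixc Q"
      then have "f (incl Q) \<in> W" using W fixcD(1) by simp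
      then obtain f' where f': "f' \<in> N Q" "f (incl Q) = f' (incl Q)" by (auto simp: W_def)
      then have "f = f'" using fixc_Q[OF f] fixc_Q[OF Nfix[OF QX f'(1)]] by simp
      then show "f \<in> N Q" using f' by simp
    qed
    then have "N P = gen P" if "P \<in> X" for P using gen_least[OF Nf _ that] Nsub[OF that] by blast
    then show ?thesis by simp
  qed
qed

end

section \<open>The functors of Webb\<close>

lemma (in fusion_system) normalizer_mem:
  assumes "L \<subseteq> carrier S"
  shows "g \<in> normalizer S L \<longleftrightarrow> g \<in> carrier S \<and> cj S g ` L = L"
proof -
  have "l_coset S g L #> inv g = cj S g ` L"
    by (auto simp: l_coset_def r_coset_def cj_def image_iff)
  then show ?thesis using assms by (auto simp: normalizer_def stabilizer_def)
qed

text \<open>The factorisation axiom supplies inverses, so being an F-isomorphism onto L is a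
  condition on the image alone.\<close>

lemma (in fusion_system) fus_conj_iff:
  assumes "sbg Q"
  shows "fus_conj S F Q L \<longleftrightarrow> sbg L \<and> (\<exists>\<phi>\<in>F Q L. \<phi> ` Q = L)"
proof (cases "sbg L")
  case True
  have "\<phi> \<in> fus_iso F Q L \<longleftrightarrow> \<phi> \<in> F Q L \<and> \<phi> ` Q = L" for \<phi>
  proof
    assume "\<phi> \<in> fus_iso F Q L"
    then obtain \<psi> where *: "\<phi> \<in> F Q L" "\<psi> \<in> F L Q" "compose L \<phi> \<psi> = (\<lambda>u\<in>L. u)"
      by (auto simp: fus_iso_def)
    have "u \<in> \<phi> ` Q" if u: "u \<in> L" for u
      using fun_cong[OF *(3), of u] u hom_mem[OF True assms *(2) u]
      by (intro image_eqI[of _ _ "\<psi> u"]) (simp_all add: compose_def)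
    then show "\<phi> \<in> F Q L \<and> \<phi> ` Q = L" using *(1) hom_image[OF assms True *(1)] by blast
  next
    assume "\<phi> \<in> F Q L \<and> \<phi> ` Q = L"
    then show "\<phi> \<in> fus_iso F Q L" using hom_factor[OF assms True, of \<phi>] by simp
  qed
  then show ?thesis using True assms by (auto simp: fus_conj_def)
qed (simp add: fus_conj_def)

locale webb_setting = aut_module S p F k V Q \<sigma> + W: webb_construction S F Q V \<rho> \<alpha> reps
  for S :: "'a monoid" (structure) and p F and k :: "'k ring" and V :: "('k, 'v) module" and Q \<sigma> \<rho> \<alpha> reps +
  assumes rho: "\<lbrakk>b \<in> F Q Q; v \<in> carrier V\<rbrakk> \<Longrightarrow> \<rho> (Inn S Q #>\<^bsub>fus_Aut F Q\<^esub> b) v = \<sigma> b v"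
    and choice: "webb_choice S F Q \<alpha> reps"
begin

abbreviation "cjQ L \<equiv> fus_conj S F Q L"

lemma cjQ_sbg: "cjQ L \<Longrightarrow> sbg L"
  by (simp add: fus_conj_def)

lemma cjQ_image: "\<lbrakk>sbg P; \<phi> \<in> F Q P\<rbrakk> \<Longrightarrow> cjQ (\<phi> ` Q)"
  using hom_iso_image[OF Q] img_sbg fus_conj_iff[OF Q] by blast

lemma alpha:
  assumes "cjQ L"
  shows "\<alpha> L \<in> F Q L" "\<alpha> L ` Q = L"
proof -
  have sb: "sbg L" using assms cjQ_sbg by blast
  have "\<alpha> L \<in> fus_iso F Q L" using choice assms by (auto simp: webb_choice_def)
  then obtain \<psi> where *: "\<alpha> L \<in> F Q L" "\<psi> \<in> F L Q" "compose L (\<alpha> L) \<psi> = (\<lambda>u\<in>L. u)"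
    by (auto simp: fus_iso_def)
  show "\<alpha> L \<in> F Q L" by fact
  have "u \<in> \<alpha> L ` Q" if u: "u \<in> L" for u
    using fun_cong[OF *(3), of u] u hom_mem[OF sb Q *(2) u]
    by (intro image_eqI[of _ _ "\<psi> u"]) (simp_all add: compose_def)
  then show "\<alpha> L ` Q = L" using hom_image[OF Q sb *(1)] by blast
qed

lemma alpha_hom: "\<lbrakk>cjQ L; sbg P; L \<subseteq> P\<rbrakk> \<Longrightarrow> \<alpha> L \<in> F Q P"
  using alpha hom_iff_image[OF cjQ_sbg] by metis

text \<open>Every morphism with image L is \<open>\<alpha> L\<close> precomposed with an
  automorphism of Q. An equivariant function is therefore known on all of them from its value at
  \<open>\<alpha> L\<close>.\<close>

lemma alpha_divide:
  assumes "cjQ L" "sbg P" "\<phi> \<in> F Q P" "\<phi> ` Q = L"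
  shows "compose Q (inv_map Q (\<alpha> L)) \<phi> \<in> F Q Q" "compose Q (\<alpha> L) (compose Q (inv_map Q (\<alpha> L)) \<phi>) = \<phi>"
proof -
  note a = alpha[OF assms(1)] and L = cjQ_sbg[OF assms(1)]
  note i = hom_inv_map[OF Q L a(1)]
  have \<phi>: "\<phi> \<in> F Q L" using hom_iff_image[OF assms(2) L assms(3)] assms(4) by simp
  show "compose Q (inv_map Q (\<alpha> L)) \<phi> \<in> F Q Q" using hom_comp[OF Q L Q \<phi>] i(1) a(2) by simp
  show "compose Q (\<alpha> L) (compose Q (inv_map Q (\<alpha> L)) \<phi>) = \<phi>"
    using comp_assoc[OF L \<phi>, of "\<alpha> L" "inv_map Q (\<alpha> L)"] i(3) a(2) compose_incl[OF extQ[OF L \<phi>]] assms(4) by simp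
qed

lemma reps:
  assumes "sbg P"
  shows "L \<in> reps P \<Longrightarrow> L \<subseteq> P" "L \<in> reps P \<Longrightarrow> cjQ L"
    and "\<lbrakk>L \<subseteq> P; cjQ L\<rbrakk> \<Longrightarrow> \<exists>!L'. L' \<in> reps P \<and> (\<exists>g\<in>P. cj S g ` L = L')"
proof -
  note c = conjunct2[OF choice[unfolded webb_choice_def], THEN spec, THEN mp, OF assms]
  show "L \<in> reps P \<Longrightarrow> L \<subseteq> P" "L \<in> reps P \<Longrightarrow> cjQ L" using conjunct1[OF c] by simp_all
  assume "L \<subseteq> P" "cjQ L"
  then show "\<exists>!L'. L' \<in> reps P \<and> (\<exists>g\<in>P. cj S g ` L = L')"
    using conjunct2[OF c, THEN spec, THEN mp] by simp
qed

lemma reps_finite: "sbg P \<Longrightarrow> finite (reps P)"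
  using reps(1) finite_sbg by (meson PowI finite_Pow_iff finite_subset subsetI)

lemma reps_unique:
  assumes "sbg P" "L \<in> reps P" "L' \<in> reps P" "g \<in> P" "cj S g ` L = L'"
  shows "L = L'"
proof -
  have "\<exists>h\<in>P. cj S h ` L = L"
    using sbgD(2)[OF assms(1)] cj_image_one[of L] reps(1)[OF assms(1,2)] sbgD(5)[OF assms(1)] by blast
  then show ?thesis using reps(3)[OF assms(1) reps(1,2)[OF assms(1,2)]] assms by blast
qed

lemma to_rep:
  assumes "sbg P" "L \<subseteq> P" "cjQ L"
  shows "W.to_rep P L \<in> P" "cj S (W.to_rep P L) ` L \<in> reps P"
proof -
  have "\<exists>g. g \<in> P \<and> cj S g ` L \<in> reps P" using reps(3)[OF assms] by blast
  then have "W.to_rep P L \<in> P \<and> cj S (W.to_rep P L) ` L \<in> reps P"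
    unfolding W.to_rep_def by (rule someI_ex)
  then show "W.to_rep P L \<in> P" "cj S (W.to_rep P L) ` L \<in> reps P" by auto
qed

lemma cj_cjQ:
  assumes "cjQ L" "x \<in> carrier S"
  shows "cjQ (cj S x ` L)"
proof -
  have sb: "sbg L" "sbg (cj S x ` L)" using cjQ_sbg assms cj_image_sbg by auto
  have "cq x (\<alpha> L) \<in> F Q (cj S x ` L)" using alpha[OF assms(1)] assms by (intro hom_comp_cj[OF Q sb(1)] sb) auto
  then show ?thesis using cjQ_image[OF sb(2)] alpha(2)[OF assms(1)] compose_image[of Q "cj S x" "\<alpha> L"] by metis
qed

text \<open>The automorphism b defining the action of \<gamma> satisfies \<gamma>
  \<open>\<alpha> L\<close> = \<open>\<alpha> L2\<close> b, and equivariance reads b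
  f(\<open>\<alpha> L2\<close> b) = f(\<open>\<alpha> L2\<close>). Webb's twisted actions thus
  become changes of the evaluation point. The function f is asked to be equivariant only on
  morphisms into L2, so that it may be a translate of an element of \<open>fixc\<close>.\<close>

lemma push_val:
  assumes L: "cjQ L" "cjQ L2" and \<gamma>: "compose Q \<gamma> (\<alpha> L) \<in> F Q L2" "\<gamma> ` L = L2"
    and f: "\<And>\<chi> b. \<lbrakk>\<chi> \<in> F Q L2; b \<in> F Q Q\<rbrakk> \<Longrightarrow> \<sigma> b (f (compose Q \<chi> b)) = f \<chi>"
    and cl: "\<And>\<chi>. f \<chi> \<in> carrier V"
  shows "W.push L L2 \<gamma> (f (compose Q \<gamma> (\<alpha> L))) = f (\<alpha> L2)"
proof -
  have "compose Q \<gamma> (\<alpha> L) ` Q = L2" using alpha(2)[OF L(1)] \<gamma>(2) by (simp add: compose_image)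
  note d = alpha_divide[OF L(2) cjQ_sbg[OF L(2)] \<gamma>(1) this]
  show ?thesis using f[OF alpha(1)[OF L(2)] d(1)] d(2) rho[OF d(1) cl] by (simp add: W.push_def)
qed

lemma cpush_val:
  assumes L: "cjQ L" and x: "x \<in> carrier S"
    and f: "\<And>\<chi> b. \<lbrakk>\<chi> \<in> F Q (cj S x ` L); b \<in> F Q Q\<rbrakk> \<Longrightarrow> \<sigma> b (f (compose Q \<chi> b)) = f \<chi>"
    and cl: "\<And>\<chi>. f \<chi> \<in> carrier V"
  shows "W.cpush L x (f (cq x (\<alpha> L))) = f (\<alpha> (cj S x ` L))"
proof -
  have "compose Q (restrict (cj S x) L) (\<alpha> L) = cq x (\<alpha> L)" using alpha(2)[OF L] by (simp add: compose_restrict)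
  moreover have "cq x (\<alpha> L) \<in> F Q (cj S x ` L)"
    using alpha[OF L] cj_image_sbg[OF cjQ_sbg[OF L] x] x by (intro hom_comp_cj[OF Q cjQ_sbg[OF L]]) auto
  ultimately show ?thesis
    using push_val[OF L cj_cjQ[OF L x], of "restrict (cj S x) L" f] f cl by (simp add: W.cpush_def)
qed

text \<open>For P-invariant f the two evaluation points in \<open>cpush_val\<close> have equal
  values up to the twist. So Webb's identification of the summands of conjugate subgroups is
  compatible with evaluating one and the same f.\<close>

lemma cpush_fixc:
  assumes "sbg P" "f \<in> fixc P" "cjQ L" "L \<subseteq> P" "g \<in> P"
  shows "W.cpush L g (f (\<alpha> L)) = f (\<alpha> (cj S g ` L))"
proof -
  have gS: "g \<in> carrier S" using sbgD(1)[OF assms(1,5)] .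
  have sb: "sbg (cj S g ` L)" "cj S g ` L \<subseteq> P"
    using cj_image_sbg[OF cjQ_sbg[OF assms(3)] gS] cj_image_mono[OF assms(1,5,4)] by auto
  have "\<chi> \<in> F Q P" if "\<chi> \<in> F Q (cj S g ` L)" for \<chi>
    using hom_iff_image[OF sb(1) assms(1) that] img(2)[OF sb(1) that] sb(2) by blast
  then show ?thesis
    using cpush_val[OF assms(3) gS, of f] fixcD(1,3,4)[OF assms(2)] alpha_hom[OF assms(3,1,4)] assms(5) by simp
qed

section \<open>Evaluation at the chosen isomorphisms\<close>

definition \<Psi> :: "'a set \<Rightarrow> (('a \<Rightarrow> 'a) \<Rightarrow> 'v) \<Rightarrow> 'a set \<Rightarrow> 'v"
  where "\<Psi> P f = (\<lambda>L\<in>reps P. f (\<alpha> L))"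

text \<open>Says that f belongs to the one summand indexed by the P-class of L.\<close>

definition supp :: "'a set \<Rightarrow> 'a set \<Rightarrow> (('a \<Rightarrow> 'a) \<Rightarrow> 'v) \<Rightarrow> bool"
  where "supp P L f \<longleftrightarrow> (\<forall>\<phi>\<in>F Q P. f \<phi> \<noteq> \<zero>\<^bsub>V\<^esub> \<longrightarrow> (\<exists>g\<in>P. cj S g ` L = \<phi> ` Q))"

lemma suppD: "\<lbrakk>supp P L f; \<phi> \<in> F Q P; f \<phi> \<noteq> \<zero>\<^bsub>V\<^esub>\<rbrakk> \<Longrightarrow> \<exists>g\<in>P. cj S g ` L = \<phi> ` Q"
  by (simp add: supp_def)

text \<open>An f supported on the class of L has at most one nonzero component, the one at the
  representative of L, and \<open>cpush_fixc\<close> computes it from the value at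
  \<open>\<alpha> L\<close>.\<close>

lemma emb_val:
  assumes "sbg P" "f \<in> fixc P" "cjQ L" "L \<subseteq> P" "supp P L f"
  shows "W.emb P L (f (\<alpha> L)) = \<Psi> P f"
proof (rule extensionalityI[of _ "reps P"])
  show "W.emb P L (f (\<alpha> L)) \<in> extensional (reps P)" "\<Psi> P f \<in> extensional (reps P)"
    by (auto simp: W.emb_def \<Psi>_def)
  fix L' assume L': "L' \<in> reps P"
  note t = to_rep[OF assms(1,4,3)]
  show "W.emb P L (f (\<alpha> L)) L' = \<Psi> P f L'"
  proof (cases "L' = cj S (W.to_rep P L) ` L")
    case True
    then show ?thesis using L' cpush_fixc[OF assms(1-4) t(1)] by (simp add: W.emb_def \<Psi>_def)
  next
    case False
    have "f (\<alpha> L') = \<zero>\<^bsub>V\<^esub>"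
    proof (rule ccontr)
      assume "f (\<alpha> L') \<noteq> \<zero>\<^bsub>V\<^esub>"
      then obtain g where "g \<in> P" "cj S g ` L = L'"
        using assms(5) alpha_hom[OF reps(2)[OF assms(1) L'] assms(1) reps(1)[OF assms(1) L']]
          alpha(2)[OF reps(2)[OF assms(1) L']] by (auto simp: supp_def)
      then show False using False L' t reps(3)[OF assms(1,4,3)] by blast
    qed
    then show ?thesis using False L' by (simp add: W.emb_def \<Psi>_def)
  qed
qed

text \<open>The projection of f to the summand indexed by the P-class of L.\<close>

definition ind :: "'a set \<Rightarrow> 'a set \<Rightarrow> (('a \<Rightarrow> 'a) \<Rightarrow> 'v) \<Rightarrow> ('a \<Rightarrow> 'a) \<Rightarrow> 'v"
  where "ind P L f \<phi> = (if \<phi> \<in> F Q P \<and> (\<exists>g\<in>P. cj S g ` L = \<phi> ` Q) then f \<phi> else \<zero>\<^bsub>V\<^esub>)"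

lemma ind_supp: "supp P L (ind P L f)"
  by (auto simp: supp_def ind_def)

lemma fcov_supp:
  assumes P: "sbg P" and \<chi>: "\<chi> \<in> F Q P"
  shows "supp P (\<chi> ` Q) (fcov Q P \<chi> v)"
  unfolding supp_def
proof (intro ballI impI)
  fix \<psi> assume \<psi>: "\<psi> \<in> F Q P" "fcov Q P \<chi> v \<psi> \<noteq> \<zero>\<^bsub>V\<^esub>"
  then obtain g b where "g \<in> P" "b \<in> F Q Q" "\<psi> = cq g (compose Q \<chi> b)" using fcov_support[OF P \<chi>] by blast
  then show "\<exists>g\<in>P. cj S g ` \<chi> ` Q = \<psi> ` Q" using aut_image by (auto simp: compose_image)
qed

lemma conj_sym:
  assumes "sbg P" "L \<subseteq> P" "g \<in> P" "cj S g ` L = L'"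
  shows "\<exists>h\<in>P. cj S h ` L' = L"
  using assms cj_image_inv(1)[of g L] sbgD[OF assms(1)] by (intro bexI[of _ "inv g"]) auto

lemma conj_trans:
  assumes "sbg P" "L \<subseteq> P" "g \<in> P" "cj S g ` L = L'" "h \<in> P" "cj S h ` L' = L''"
  shows "\<exists>x\<in>P. cj S x ` L = L''"
  using assms cj_image_cj[of h g L] sbgD[OF assms(1)] by (intro bexI[of _ "h \<otimes> g"]) auto

text \<open>A transfer from Q along \<chi> is supported on the class of \<chi>(Q). Projection to the
  class of L therefore keeps it whole or kills it, and the span of the transfers is
  preserved.\<close>

lemma gen_ind:
  assumes P: "sbg P" and L: "L \<subseteq> P" and f: "f \<in> gen P"
  shows "ind P L f \<in> gen P"
  using f
proof induction
  case gen_zero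
  then show ?case using gen.gen_zero by (simp add: ind_def)
next
  case (gen_step \<chi> v f)
  have s: "supp P (\<chi> ` Q) (fcov Q P \<chi> v)" using fcov_supp[OF P gen_step(1)] .
  have \<chi>P: "\<chi> ` Q \<subseteq> P" using img(2)[OF P gen_step(1)] .
  have cl: "fcov Q P \<chi> v \<phi> \<in> carrier V" "ind P L f \<phi> \<in> carrier V" "f \<phi> \<in> carrier V" for \<phi>
    using fixcD(1)[OF fcov_in[OF Q P gen_step(1,2)]] fixcD(1)[OF gen_fixc[OF P gen_step(4)]]
      fixcD(1)[OF gen_fixc[OF P gen_step(3)]] by auto
  have sum: "ind P L (\<lambda>\<phi>. fcov Q P \<chi> v \<phi> \<oplus>\<^bsub>V\<^esub> f \<phi>) = (\<lambda>\<phi>. ind P L (fcov Q P \<chi> v) \<phi> \<oplus>\<^bsub>V\<^esub> ind P L f \<phi>)"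
    by (intro ext) (auto simp: ind_def)
  show ?case
  proof (cases "\<exists>g\<in>P. cj S g ` L = \<chi> ` Q")
    case True
    then obtain g where g: "g \<in> P" "cj S g ` L = \<chi> ` Q" by blast
    have "ind P L (fcov Q P \<chi> v) = fcov Q P \<chi> v"
    proof
      fix \<phi>
      show "ind P L (fcov Q P \<chi> v) \<phi> = fcov Q P \<chi> v \<phi>"
      proof (cases "fcov Q P \<chi> v \<phi> = \<zero>\<^bsub>V\<^esub>")
        case False
        then have \<phi>: "\<phi> \<in> F Q P" by (auto simp: fcov_def split: if_splits)
        obtain h where h: "h \<in> P" "cj S h ` \<chi> ` Q = \<phi> ` Q" using suppD[OF s, OF \<phi> False] by blast
        show ?thesis using conj_trans[OF P L g h] \<phi> by (simp add: ind_def)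
      qed (simp add: ind_def)
    qed
    then show ?thesis using gen.gen_step[OF gen_step(1,2,4)] sum by simp
  next
    case False
    have "ind P L (fcov Q P \<chi> v) = (\<lambda>\<phi>. \<zero>\<^bsub>V\<^esub>)"
    proof
      fix \<phi>
      show "ind P L (fcov Q P \<chi> v) \<phi> = \<zero>\<^bsub>V\<^esub>"
      proof (rule ccontr)
        assume "ind P L (fcov Q P \<chi> v) \<phi> \<noteq> \<zero>\<^bsub>V\<^esub>"
        then have \<phi>: "\<phi> \<in> F Q P" "\<exists>g\<in>P. cj S g ` L = \<phi> ` Q" "fcov Q P \<chi> v \<phi> \<noteq> \<zero>\<^bsub>V\<^esub>"
          by (auto simp: ind_def split: if_splits)
        obtain x where x: "x \<in> P" "cj S x ` \<chi> ` Q = \<phi> ` Q" using suppD[OF s, OF \<phi>(1,3)] by blast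
        obtain h where h: "h \<in> P" "cj S h ` \<phi> ` Q = \<chi> ` Q" using conj_sym[OF P \<chi>P x] by blast
        obtain g where g: "g \<in> P" "cj S g ` L = \<phi> ` Q" using \<phi>(2) by blast
        show False using False conj_trans[OF P L g h] by blast
      qed
    qed
    then show ?thesis using sum gen_step(4) cl by simp
  qed
qed

text \<open>Each image \<phi>(Q) is P-conjugate to exactly one representative, so at \<phi> just one
  projection is f(\<phi>) and the others are zero.\<close>

lemma ind_sum:
  assumes P: "sbg P" and f: "f \<in> fixc P" and i: "\<And>L. L \<in> reps P \<Longrightarrow> ind P L f \<in> fixc P"
  shows "(\<Oplus>\<^bsub>fixmod P\<^esub> L\<in>reps P. ind P L f) = f"
proof -
  interpret fP: module k "fixmod P" by (rule fixmod_module[OF P])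
  have s: "(\<Oplus>\<^bsub>fixmod P\<^esub> L\<in>reps P. ind P L f) \<in> fixc P"
    using i fP.finsum_closed[of "\<lambda>L. ind P L f" "reps P"] by auto
  show ?thesis
  proof (rule fixc_eqI[OF s f])
    fix \<phi> assume \<phi>: "\<phi> \<in> F Q P"
    have L: "\<phi> ` Q \<subseteq> P" "cjQ (\<phi> ` Q)" using img(2)[OF P \<phi>] cjQ_image[OF P \<phi>] by auto
    obtain L' g where L': "L' \<in> reps P" "g \<in> P" "cj S g ` \<phi> ` Q = L'" using reps(3)[OF P L] by blast
    have "(\<Oplus>\<^bsub>fixmod P\<^esub> L\<in>reps P. ind P L f) \<phi> = (\<Oplus>\<^bsub>V\<^esub> L\<in>reps P. ind P L f \<phi>)"
      using i by (intro fixmod_finsum[OF P]) auto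
    also have "\<dots> = (\<Oplus>\<^bsub>V\<^esub> L\<in>reps P. if L' = L then f \<phi> else \<zero>\<^bsub>V\<^esub>)"
    proof (rule V.finsum_cong')
      fix K assume K: "K \<in> reps P"
      have "(\<exists>g\<in>P. cj S g ` K = \<phi> ` Q) \<longleftrightarrow> L' = K"
      proof
        assume "\<exists>g\<in>P. cj S g ` K = \<phi> ` Q"
        then obtain h where h: "h \<in> P" "cj S h ` K = \<phi> ` Q" by blast
        obtain x where "x \<in> P" "cj S x ` K = L'"
          using conj_trans[OF P reps(1)[OF P K] h L'(2,3)] by blast
        then show "L' = K" using reps_unique[OF P K L'(1)] by blast
      next
        assume "L' = K"
        then show "\<exists>g\<in>P. cj S g ` K = \<phi> ` Q" using conj_sym[OF P L(1) L'(2,3)] by simp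
      qed
      then show "ind P K f \<phi> = (if L' = K then f \<phi> else \<zero>\<^bsub>V\<^esub>)" using \<phi> by (simp add: ind_def)
    qed (use fixcD(1)[OF f] in auto)
    also have "\<dots> = f \<phi>"
      using V.finsum_singleton[OF L'(1) reps_finite[OF P], of "\<lambda>_. f \<phi>"] fixcD(1)[OF f] by simp
    finally show "(\<Oplus>\<^bsub>fixmod P\<^esub> L\<in>reps P. ind P L f) \<phi> = f \<phi>" .
  qed
qed

lemma nrm_mem: "\<lbrakk>sbg P; L \<subseteq> P\<rbrakk> \<Longrightarrow> g \<in> W.nrm P L \<longleftrightarrow> g \<in> P \<and> cj S g ` L = L"
  using normalizer_mem[of L g] sbgD(1,5)[of P] by (auto simp: W.nrm_def)

lemma nrm_sbg: "\<lbrakk>sbg P; L \<subseteq> P\<rbrakk> \<Longrightarrow> sbg (W.nrm P L)"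
proof -
  assume P: "sbg P" "L \<subseteq> P"
  have "sbg (normalizer S L)" using normalizer_imp_subgroup[of L] sbgD(5)[OF P(1)] P(2) by blast
  then show ?thesis unfolding W.nrm_def by (rule subgroups_Inter_pair[OF P(1)])
qed

lemma nrm_self: "\<lbrakk>sbg P; sbg L; L \<subseteq> P\<rbrakk> \<Longrightarrow> L \<subseteq> W.nrm P L"
  by (rule subsetI) (simp add: nrm_mem cj_image_self subset_iff)

lemma tr_csum: "W.tr L H K v = csum V K H (\<lambda>g. W.cpush L g v)"
  by (simp add: W.tr_def csum_def)

text \<open>Expresses the action of the normaliser on the twisted module by the terms that occur in
  transfers from Q along \<open>\<alpha> L\<close>. This is the bridge from relative traces to
  \<open>fcov\<close>.\<close>

lemma cpush_normalizer:
  assumes L: "cjQ L" and g: "g \<in> carrier S" "cj S g ` L = L" and v: "v \<in> carrier V"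
  shows "W.cpush L g v = lift Q (\<alpha> L) (fv v) (cq (inv g) (\<alpha> L))"
proof -
  have sb: "sbg L" using cjQ_sbg[OF L] .
  note a = alpha[OF L]
  have aS: "\<alpha> L \<in> F Q (carrier S)" using alpha_hom[OF L subgroup_self sbgD(5)[OF sb]] .
  let ?f = "\<lambda>\<chi>. lift Q (\<alpha> L) (fv v) (cq (inv g) \<chi>)"
  have g': "cj S (inv g) ` L = L" using cj_image_inv(1)[OF g(1) sbgD(5)[OF sb]] g(2) by simp
  \<comment> \<open>\<open>cpush_val\<close> is applied to the translate of the extension of
    \<open>fv v\<close> by g, because its value at c_g \<open>\<alpha> L\<close> is v
    itself.\<close>
  have "W.cpush L g (?f (cq g (\<alpha> L))) = ?f (\<alpha> (cj S g ` L))"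
  proof (rule cpush_val[OF L g(1)])
    fix \<chi> b assume "\<chi> \<in> F Q (cj S g ` L)" and b: "b \<in> F Q Q"
    then have \<chi>: "\<chi> \<in> F Q L" using g by simp
    have c: "cq (inv g) \<chi> \<in> F Q L"
      using hom_comp_cj[OF Q sb \<chi> sb, of "inv g"] g g' img(2)[OF sb \<chi>] by blast
    have "cq (inv g) (compose Q \<chi> b) = compose Q (cq (inv g) \<chi>) b"
      using compose_assoc'[of b Q Q "cj S (inv g)" \<chi>] aut_image[OF b] by simp
    then show "\<sigma> b (?f (compose Q \<chi> b)) = ?f \<chi>"
      using lift_equiv[OF Q sb a(1) fv_in[OF v] b c] by simp
  qed (rule lift_closed[OF Q sb a(1) fv_in[OF v]])
  moreover have "?f (cq g (\<alpha> L)) = v"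
    using cq_inv(1)[OF subgroup_self aS g(1)] lift_comp[OF Q sb a(1) incl_Q, of "fv v"] fv_incl[OF v]
      compose_id[OF extQ[OF sb a(1)]] by simp
  ultimately show ?thesis using g by simp
qed

text \<open>L acts on its twisted module through inner automorphisms, hence trivially, so the trace
  from L is taken on all of V.\<close>

lemma fixed_eq: "cjQ L \<Longrightarrow> W.fixed L L = carrier V"
proof -
  assume L: "cjQ L"
  note sb = cjQ_sbg[OF L] and a = alpha[OF L]
  have "W.cpush L h v = v" if h: "h \<in> L" and v: "v \<in> carrier V" for h v
  proof -
    have hS: "h \<in> carrier S" using sbgD(1)[OF sb h] .
    have "W.cpush L h v = lift Q (\<alpha> L) (fv v) (cq (inv (\<one> \<otimes> h)) (\<alpha> L))"
      using cpush_normalizer[OF L hS cj_image_self[OF sb h] v] hS by simp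
    also have "\<dots> = lift Q (\<alpha> L) (fv v) (cq (inv \<one>) (\<alpha> L))"
      using lift_coset[OF Q sb a(1) fv_in[OF v] a(1) sbgD(2)[OF sb]] h a(2) by simp
    also have "\<dots> = lift Q (\<alpha> L) (fv v) (compose Q (\<alpha> L) (incl Q))"
      using cq_one[OF sb a(1)] compose_id[OF extQ[OF sb a(1)]] by simp
    also have "\<dots> = v" using lift_comp[OF Q sb a(1) incl_Q] fv_incl[OF v] by simp
    finally show ?thesis .
  qed
  then show ?thesis by (auto simp: W.fixed_def)
qed

text \<open>The transfer sums over P/L. At \<open>\<alpha> L\<close> the coset of g contributes only
  if g normalises L, and on those cosets the terms are the action of g by
  \<open>cpush_normalizer\<close>.\<close>

lemma tr_val:
  assumes P: "sbg P" and L: "cjQ L" "L \<subseteq> P" and v: "v \<in> carrier V"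
  shows "W.tr L L (W.nrm P L) v = fcov Q P (\<alpha> L) (fv v) (\<alpha> L)"
proof -
  note sb = cjQ_sbg[OF L(1)] and a = alpha[OF L(1)]
  have aP: "\<alpha> L \<in> F Q P" using alpha_hom[OF L(1) P L(2)] .
  let ?N = "W.nrm P L"
  have N: "sbg ?N" "L \<subseteq> ?N" "?N \<subseteq> P" using nrm_sbg[OF P L(2)] nrm_self[OF P sb L(2)] by (auto simp: W.nrm_def)
  let ?h = "\<lambda>g. lift Q (\<alpha> L) (fv v) (cq (inv g) (\<alpha> L))"
  have cl: "?h g \<in> carrier V" for g using lift_closed[OF Q P aP fv_in[OF v]] .
  have "fcov Q P (\<alpha> L) (fv v) (\<alpha> L) = csum V P L ?h" using aP a(2) by (simp add: fcov_def)
  also have "\<dots> = (\<Oplus>\<^bsub>V\<^esub> i\<in>{()}. csum V ?N L ?h)"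
  proof (rule csum_Sigma[OF abV sb P L(2)])
    show "?h (g \<otimes> b) = ?h g" if "g \<in> P" "b \<in> L" for g b
      using lift_coset[OF Q P aP fv_in[OF v] aP] that a(2) by simp
    \<comment> \<open>A nonzero term means that c_g^{-1} \<open>\<alpha> L\<close> factors through
      \<open>\<alpha> L\<close>; comparing images gives g in the normaliser.\<close>
    fix g assume g: "g \<in> P" "?h g \<noteq> \<zero>\<^bsub>V\<^esub>"
    have gS: "g \<in> carrier S" using sbgD(1)[OF P g(1)] .
    obtain b where b: "b \<in> F Q Q" "compose Q (\<alpha> L) b = cq (inv g) (\<alpha> L)"
      using g(2) lift_out by metis
    have "L = cj S (inv g) ` L" using arg_cong[OF b(2), of "\<lambda>f. f ` Q"] aut_image[OF b(1)] a(2) by (simp add: compose_image)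
    then have "cj S g ` L = L" using cj_image_inv(2)[OF gS sbgD(5)[OF sb]] by simp
    then have "g \<in> ?N" using nrm_mem[OF P L(2)] g(1) by simp
    then show "\<exists>i\<in>{()}. \<exists>a\<in>?N. inv g \<otimes> a \<in> L" using sbgD(2)[OF sb] gS by (auto intro!: bexI[of _ g])
  qed (use sb N cl in auto)
  also have "\<dots> = csum V ?N L ?h" using csum_closed[OF abV sb N(1,2)] cl by simp
  also have "\<dots> = csum V ?N L (\<lambda>g. W.cpush L g v)"
    using cpush_normalizer[OF L(1) _ _ v] nrm_mem[OF P L(2)] sbgD(1)[OF P] cl
    by (intro csum_cong[OF abV sb N(1,2), symmetric]) auto
  finally show ?thesis by (simp add: tr_csum)
qed

lemma summand_eq:
  assumes "sbg P" "cjQ L" "L \<subseteq> P"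
  shows "W.summand P L = (\<lambda>v. fcov Q P (\<alpha> L) (fv v) (\<alpha> L)) ` carrier V"
  unfolding W.summand_def fixed_eq[OF assms(2)] using tr_val[OF assms] by (intro image_cong) auto

lemma smod_simps [simp]:
  "carrier (W.smod P) = (\<Pi>\<^sub>E L\<in>reps P. W.summand P L)" "\<zero>\<^bsub>W.smod P\<^esub> = (\<lambda>L\<in>reps P. \<zero>\<^bsub>V\<^esub>)"
  "f \<oplus>\<^bsub>W.smod P\<^esub> g = (\<lambda>L\<in>reps P. f L \<oplus>\<^bsub>V\<^esub> g L)" "a \<odot>\<^bsub>W.smod P\<^esub> f = (\<lambda>L\<in>reps P. a \<odot>\<^bsub>V\<^esub> f L)"
  by (simp_all add: W.smod_def)

abbreviation "genmod P \<equiv> (fixmod P)\<lparr>carrier := gen P\<rparr>"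

lemma genmod_module: "sbg P \<Longrightarrow> module k (genmod P)"
  using submodule_incl_lin(1)[OF fixmod_module gen_submodule] .

text \<open>That each component is a trace, and not just some vector, rests on
  \<open>gen_value\<close>, hence on f being a sum of transfers from Q.\<close>

lemma \<Psi>_lin:
  assumes P: "sbg P"
  shows "\<Psi> P \<in> lin_maps k (genmod P) (W.smod P)"
proof (rule lin_mapsI)
  fix f assume f: "f \<in> carrier (genmod P)"
  have "f (\<alpha> L) \<in> W.summand P L" if L: "L \<in> reps P" for L
  proof -
    note L' = reps(2,1)[OF P L]
    obtain w where w: "w \<in> fixc Q" "f (\<alpha> L) = fcov Q P (\<alpha> L) w (\<alpha> L)"
      using gen_value[OF P alpha_hom[OF L'(1) P L'(2)]] f by auto
    have "fv (w (incl Q)) = w" using fixc_Q[OF w(1)] by simp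
    then show ?thesis unfolding summand_eq[OF P L']
      using w(2) fixcD(1)[OF w(1)] by (intro image_eqI[of _ _ "w (incl Q)"]) simp_all
  qed
  then show "\<Psi> P f \<in> carrier (W.smod P)" by (auto simp: \<Psi>_def)
qed (auto simp: \<Psi>_def)

lemma \<Psi>_zero: "\<Psi> P \<zero>\<^bsub>genmod P\<^esub> = \<zero>\<^bsub>W.smod P\<^esub>"
  by (simp add: \<Psi>_def)

text \<open>Conjugate \<phi> by an element of P until its image is a chosen representative, then
  divide by the chosen isomorphism. Invariance and equivariance carry the zero back to
  \<phi>.\<close>

lemma \<Psi>_inj:
  assumes P: "sbg P" and f: "f \<in> fixc P" and z: "\<Psi> P f = (\<lambda>L\<in>reps P. \<zero>\<^bsub>V\<^esub>)"
  shows "f = (\<lambda>\<phi>. \<zero>\<^bsub>V\<^esub>)"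
proof (rule fixc_eqI[OF f fixc_zero])
  fix \<phi> assume \<phi>: "\<phi> \<in> F Q P"
  have L: "\<phi> ` Q \<subseteq> P" "cjQ (\<phi> ` Q)" using img(2)[OF P \<phi>] cjQ_image[OF P \<phi>] by auto
  obtain L' g where L': "L' \<in> reps P" "g \<in> P" "cj S g ` \<phi> ` Q = L'" using reps(3)[OF P L] by blast
  have c: "cq g \<phi> \<in> F Q P" "cq g \<phi> ` Q = L'" using cq_hom[OF P \<phi> L'(2)] L'(3) by (auto simp: compose_image)
  note L'' = reps(2,1)[OF P L'(1)]
  note d = alpha_divide[OF L''(1) P c]
  let ?b = "compose Q (inv_map Q (\<alpha> L')) (cq g \<phi>)"
  have "f (\<alpha> L') = \<zero>\<^bsub>V\<^esub>" using fun_cong[OF z, of L'] L'(1) by (simp add: \<Psi>_def)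
  then have "\<sigma> ?b (f (cq g \<phi>)) = \<zero>\<^bsub>V\<^esub>"
    using fixcD(3)[OF f alpha_hom[OF L''(1) P L''(2)] d(1)] d(2) by simp
  then have "f (cq g \<phi>) = \<zero>\<^bsub>V\<^esub>"
    using act_inv(1)[OF d(1) fixcD(1)[OF f, of "cq g \<phi>"]] act_zero[OF aut_inv(1)[OF d(1)]] by simp
  then show "f \<phi> = \<zero>\<^bsub>V\<^esub>" using fixcD(4)[OF f \<phi> L'(2)] by simp
qed

lemma \<Psi>_bij:
  assumes P: "sbg P"
  shows "bij_betw (\<Psi> P) (gen P) (carrier (W.smod P))"
  unfolding bij_betw_def
proof
  show "inj_on (\<Psi> P) (gen P)"
  proof (rule inj_onI)
    fix f g assume fg: "f \<in> gen P" "g \<in> gen P" "\<Psi> P f = \<Psi> P g"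
    have g': "(\<lambda>\<phi>. (\<ominus>\<^bsub>k\<^esub> \<one>\<^bsub>k\<^esub>) \<odot>\<^bsub>V\<^esub> g \<phi>) \<in> gen P" using gen_smult[OF P fg(2)] by simp
    note cl = fixcD(1)[OF gen_fixc[OF P fg(1)]] fixcD(1)[OF gen_fixc[OF P fg(2)]]
    have e: "(\<ominus>\<^bsub>k\<^esub> \<one>\<^bsub>k\<^esub>) \<odot>\<^bsub>V\<^esub> g \<phi> = \<ominus>\<^bsub>V\<^esub> g \<phi>" for \<phi> using cl by (simp add: V.smult_l_minus)
    have 1: "(\<lambda>\<phi>. f \<phi> \<oplus>\<^bsub>V\<^esub> \<ominus>\<^bsub>V\<^esub> g \<phi>) \<in> fixc P" using gen_fixc[OF P gen_add[OF P fg(1) g']] by (simp add: e)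
    have "\<Psi> P (\<lambda>\<phi>. f \<phi> \<oplus>\<^bsub>V\<^esub> \<ominus>\<^bsub>V\<^esub> g \<phi>) = (\<lambda>L\<in>reps P. \<zero>\<^bsub>V\<^esub>)"
      unfolding \<Psi>_def
    proof (rule restrict_ext)
      fix L assume "L \<in> reps P"
      then have "f (\<alpha> L) = g (\<alpha> L)" using fun_cong[OF fg(3), of L] by (simp add: \<Psi>_def)
      then show "f (\<alpha> L) \<oplus>\<^bsub>V\<^esub> \<ominus>\<^bsub>V\<^esub> g (\<alpha> L) = \<zero>\<^bsub>V\<^esub>" using cl by (simp add: V.M.r_neg)
    qed
    then have "f \<phi> \<oplus>\<^bsub>V\<^esub> \<ominus>\<^bsub>V\<^esub> g \<phi> = \<zero>\<^bsub>V\<^esub>" for \<phi> using \<Psi>_inj[OF P 1] by metis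
    then show "f = g" using cl V.M.minus_equality V.M.minus_minus by (metis V.M.a_inv_closed ext)
  qed
  show "\<Psi> P ` gen P = carrier (W.smod P)"
  proof
    show "\<Psi> P ` gen P \<subseteq> carrier (W.smod P)" using lin_mapsD(1)[OF \<Psi>_lin[OF P]] by auto
    show "carrier (W.smod P) \<subseteq> \<Psi> P ` gen P"
    proof
      fix w assume w: "w \<in> carrier (W.smod P)"
      have "\<forall>L\<in>reps P. \<exists>v\<in>carrier V. w L = fcov Q P (\<alpha> L) (fv v) (\<alpha> L)"
        using w summand_eq[OF P reps(2,1)[OF P]] by (auto simp: PiE_iff)
      then obtain v where v: "\<And>L. L \<in> reps P \<Longrightarrow> v L \<in> carrier V"
        "\<And>L. L \<in> reps P \<Longrightarrow> w L = fcov Q P (\<alpha> L) (fv (v L)) (\<alpha> L)" by metis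
      \<comment> \<open>A preimage is assembled from one transfer per representative, each realising
        the prescribed trace. Transfers for different representatives have disjoint supports, so the
        component at K sees only its own term.\<close>
      let ?t = "\<lambda>L. fcov Q P (\<alpha> L) (fv (v L))"
      have a: "\<alpha> L \<in> F Q P" "\<alpha> L ` Q = L" if "L \<in> reps P" for L
        using alpha_hom[OF reps(2)[OF P that] P reps(1)[OF P that]] alpha(2)[OF reps(2)[OF P that]] by auto
      have t: "?t L \<in> gen P" if "L \<in> reps P" for L
        using gen_fcov[OF P a(1)[OF that] fv_in[OF v(1)[OF that]]] .
      let ?f = "\<Oplus>\<^bsub>fixmod P\<^esub> L\<in>reps P. ?t L"
      have f: "?f \<in> gen P"
        using t by (intro submodule_finsum_closed[OF fixmod_module[OF P] gen_submodule[OF P]]) auto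
      have "?f (\<alpha> K) = w K" if K: "K \<in> reps P" for K
      proof -
        have "?f (\<alpha> K) = (\<Oplus>\<^bsub>V\<^esub> L\<in>reps P. ?t L (\<alpha> K))"
          using t gen_fixc[OF P] by (intro fixmod_finsum[OF P]) auto
        also have "\<dots> = (\<Oplus>\<^bsub>V\<^esub> L\<in>reps P. if K = L then w K else \<zero>\<^bsub>V\<^esub>)"
        proof (rule V.finsum_cong')
          fix L assume L: "L \<in> reps P"
          show "?t L (\<alpha> K) = (if K = L then w K else \<zero>\<^bsub>V\<^esub>)"
          proof (cases "K = L")
            case False
            have "?t L (\<alpha> K) = \<zero>\<^bsub>V\<^esub>"
            proof (rule ccontr)
              assume "?t L (\<alpha> K) \<noteq> \<zero>\<^bsub>V\<^esub>"
              then obtain g where "g \<in> P" "cj S g ` L = K"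
                using suppD[OF fcov_supp[OF P a(1)[OF L]], OF a(1)[OF K]] unfolding a(2)[OF L] a(2)[OF K] by blast
              then show False using False reps_unique[OF P L K] by simp
            qed
            then show ?thesis using False by simp
          qed (use v L in simp)
        qed (use v K fixcD(1)[OF gen_fixc[OF P t[OF K]]] in auto)
        also have "\<dots> = w K"
          using V.finsum_singleton[OF K reps_finite[OF P], of "\<lambda>_. w K"] v(2)[OF K] fixcD(1)[OF gen_fixc[OF P t[OF K]]] by simp
        finally show ?thesis .
      qed
      then have "\<Psi> P ?f = w" using w by (intro extensionalityI[of _ "reps P"]) (auto simp: \<Psi>_def PiE_iff)
      then show "w \<in> \<Psi> P ` gen P" using f by blast
    qed
  qed
qed

lemma smod_module: "sbg P \<Longrightarrow> module k (W.smod P)"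
proof -
  assume P: "sbg P"
  have "bij_betw (\<Psi> P) (carrier (genmod P)) (carrier (W.smod P))" using \<Psi>_bij[OF P] by simp
  from module_transport[OF genmod_module[OF P] \<Psi>_lin[OF P] this] show ?thesis using \<Psi>_zero by blast
qed

text \<open>Webb defines his maps summand by summand. Since f is the sum of its projections and all
  maps are linear, it suffices to compare each definition with the operation on functions supported
  on one class.\<close>

lemma assemble:
  assumes P: "sbg P" and R: "sbg R" and op: "op \<in> lin_maps k (fixmod P) (fixmod R)"
    and opg: "\<And>f. f \<in> gen P \<Longrightarrow> op f \<in> gen R" and f: "f \<in> gen P"
    and t: "\<And>L. L \<in> reps P \<Longrightarrow> t L = \<Psi> R (op (ind P L f))"
  shows "(\<Oplus>\<^bsub>W.smod R\<^esub> L\<in>reps P. t L) = \<Psi> R (op f)"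
proof -
  interpret sR: module k "W.smod R" by (rule smod_module[OF R])
  have i: "ind P L f \<in> gen P" if "L \<in> reps P" for L using gen_ind[OF P reps(1)[OF P that] f] .
  have "(\<Oplus>\<^bsub>W.smod R\<^esub> L\<in>reps P. t L) = (\<Oplus>\<^bsub>W.smod R\<^esub> L\<in>reps P. \<Psi> R (op (ind P L f)))"
  proof (rule sR.finsum_cong')
    show "(\<lambda>L. \<Psi> R (op (ind P L f))) \<in> reps P \<rightarrow> carrier (W.smod R)"
      using lin_mapsD(1)[OF \<Psi>_lin[OF R]] i opg by (intro Pi_I) (simp del: smod_simps)
  qed (use t in auto)
  also have "\<dots> = \<Psi> R (\<Oplus>\<^bsub>genmod R\<^esub> L\<in>reps P. op (ind P L f))"
    using i opg by (intro lin_maps_finsum[OF genmod_module[OF R] smod_module[OF R] \<Psi>_lin[OF R], symmetric]) auto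
  also have "(\<Oplus>\<^bsub>genmod R\<^esub> L\<in>reps P. op (ind P L f)) = (\<Oplus>\<^bsub>fixmod R\<^esub> L\<in>reps P. op (ind P L f))"
    using i opg by (intro submodule_finsum[OF fixmod_module[OF R] gen_submodule[OF R]]) auto
  also have "\<dots> = op (\<Oplus>\<^bsub>fixmod P\<^esub> L\<in>reps P. ind P L f)"
    using i gen_fixc[OF P] by (intro lin_maps_finsum[OF fixmod_module[OF P] fixmod_module[OF R] op, symmetric]) auto
  also have "(\<Oplus>\<^bsub>fixmod P\<^esub> L\<in>reps P. ind P L f) = f"
    using ind_sum[OF P gen_fixc[OF P f]] i gen_fixc[OF P] by blast
  finally show ?thesis .
qed

lemma ind_alpha:
  assumes "sbg P" "L \<in> reps P"
  shows "ind P L f (\<alpha> L) = f (\<alpha> L)"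
proof -
  note L = reps(2,1)[OF assms]
  have "\<exists>g\<in>P. cj S g ` L = L"
    using sbgD(2)[OF assms(1)] cj_image_one[of L] L sbgD(5)[OF assms(1)] by blast
  then show ?thesis using alpha_hom[OF L(1) assms(1) L(2)] alpha(2)[OF L(1)] by (simp add: ind_def)
qed

text \<open>Transfer along an isomorphism is restriction along its inverse, so the new function
  takes at \<phi> \<open>\<alpha> L\<close> the old value at \<open>\<alpha> L\<close>.
  \<open>push_val\<close> moves it to the chosen isomorphism for \<phi>(L), and the support moves
  along with \<phi>.\<close>

lemma siso_val:
  assumes P: "sbg P" and R: "sbg R" and \<phi>: "\<phi> \<in> F P R" "\<phi> ` P = R" and f: "f \<in> gen P"
  shows "W.siso P R \<phi> (\<Psi> P f) = \<Psi> R (fcov P R \<phi> f)"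
  unfolding W.siso_def
proof (rule assemble[OF P R fcov_lin[OF P R \<phi>(1)] gen_fcov_closed[OF P R \<phi>(1)] f])
  fix L assume L: "L \<in> reps P"
  note L' = reps(2,1)[OF P L]
  note sb = cjQ_sbg[OF L'(1)] and a = alpha[OF L'(1)]
  have aP: "\<alpha> L \<in> F Q P" using alpha_hom[OF L'(1) P L'(2)] .
  have c: "compose Q \<phi> (\<alpha> L) \<in> F Q R" using hom_comp[OF Q P R aP \<phi>(1)] .
  have im: "compose Q \<phi> (\<alpha> L) ` Q = \<phi> ` L" using a(2) by (simp add: compose_image)
  have L2: "cjQ (\<phi> ` L)" "\<phi> ` L \<subseteq> R" using cjQ_image[OF R c] im \<phi>(2) L'(2) by auto
  let ?h = "ind P L f" and ?h' = "fcov P R \<phi> (ind P L f)"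
  have h: "?h \<in> gen P" using gen_ind[OF P L'(2) f] .
  have h': "?h' \<in> fixc R" using fcov_in[OF P R \<phi>(1) gen_fixc[OF P h]] .
  note i = hom_inv_map[OF P R \<phi>(1)]
  have eq: "?h' = fcon R (inv_map P \<phi>) ?h" using fcov_iso[OF P R \<phi> gen_fixc[OF P h]] .
  have "?h' (compose Q \<phi> (\<alpha> L)) = f (\<alpha> L)"
  proof -
    have "compose Q (inv_map P \<phi>) (compose Q \<phi> (\<alpha> L)) = \<alpha> L"
      using comp_assoc[OF P aP, of "inv_map P \<phi>" \<phi>] i(2) compose_incl[OF extQ[OF P aP] img(2)[OF P aP]] by simp
    then show ?thesis using eq c ind_alpha[OF P L] by (simp add: fcon_def)
  qed
  moreover have "compose Q (restrict \<phi> L) (\<alpha> L) = compose Q \<phi> (\<alpha> L)" using a(2) by (simp add: compose_restrict)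
  moreover have "compose Q \<phi> (\<alpha> L) \<in> F Q (\<phi> ` L)"
    using hom_iff_image[OF R cjQ_sbg[OF L2(1)] c] im by simp
  moreover have "\<chi> \<in> F Q R" if "\<chi> \<in> F Q (\<phi> ` L)" for \<chi>
    using hom_iff_image[OF cjQ_sbg[OF L2(1)] R that] img(2)[OF cjQ_sbg[OF L2(1)] that] L2(2) by blast
  ultimately have push: "W.push L (\<phi> ` L) (restrict \<phi> L) (f (\<alpha> L)) = ?h' (\<alpha> (\<phi> ` L))"
    using push_val[OF L'(1) L2(1), of "restrict \<phi> L" ?h'] fixcD(1,3)[OF h'] by simp
  have "supp R (\<phi> ` L) ?h'"
    unfolding supp_def
  proof (intro ballI impI)
    fix \<psi> assume \<psi>: "\<psi> \<in> F Q R" "?h' \<psi> \<noteq> \<zero>\<^bsub>V\<^esub>"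
    let ?\<chi> = "compose Q (inv_map P \<phi>) \<psi>"
    have \<chi>: "?\<chi> \<in> F Q P" using hom_comp[OF Q R P \<psi>(1)] i(1) \<phi>(2) by simp
    have "?h ?\<chi> \<noteq> \<zero>\<^bsub>V\<^esub>" using \<psi> eq by (simp add: fcon_def)
    then obtain g where g: "g \<in> P" "cj S g ` L = ?\<chi> ` Q" using suppD[OF ind_supp, OF \<chi>] by blast
    have "\<phi> ` ?\<chi> ` Q = \<psi> ` Q"
      using comp_assoc[OF R \<psi>(1), of \<phi> "inv_map P \<phi>"] i(3) \<phi>(2) compose_incl[OF extQ[OF R \<psi>(1)] img(2)[OF R \<psi>(1)]]
        compose_image[of Q \<phi> ?\<chi>] by simp
    moreover have "\<phi> ` cj S g ` L = cj S (\<phi> g) ` \<phi> ` L"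
      unfolding image_image using hom_cj[OF P R \<phi>(1) g(1)] L'(2) by (intro image_cong) auto
    ultimately show "\<exists>g\<in>R. cj S g ` \<phi> ` L = \<psi> ` Q" using g hom_mem[OF P R \<phi>(1) g(1)] by metis
  qed
  then show "W.emb R (\<phi> ` L) (W.push L (\<phi> ` L) (restrict \<phi> L) (\<Psi> P f L)) = \<Psi> R ?h'"
    using emb_val[OF R h' L2] push L by (simp add: \<Psi>_def)
qed

text \<open>Restriction to R keeps the values of f but evaluates at more subgroups, because a
  P-class of subgroups may split into several R-classes. P-invariance links these values to the one
  at the representative in P.\<close>

lemma srestr_val:
  assumes P: "sbg P" and R: "sbg R" and RP: "R \<subseteq> P" and f: "f \<in> gen P"
  shows "W.srestr P R (\<Psi> P f) = \<Psi> R (fcon R (incl R) f)"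
  unfolding W.srestr_def
proof (rule assemble[OF P R fcon_lin gen_fcon_closed f])
  show iR: "incl R \<in> F R P" "incl R \<in> F R P" using hom_incl[OF R P RP] by auto
  fix L assume L: "L \<in> reps P"
  note L' = reps(2,1)[OF P L]
  show "(\<lambda>L'\<in>reps R. if \<exists>g\<in>P. cj S g ` L = L' then W.cpush L (SOME g. g \<in> P \<and> cj S g ` L = L') (\<Psi> P f L) else \<zero>\<^bsub>V\<^esub>)
    = \<Psi> R (fcon R (incl R) (ind P L f))"
    unfolding \<Psi>_def[of R]
  proof (rule restrict_ext)
    fix K assume K: "K \<in> reps R"
    note K' = reps(2,1)[OF R K]
    have aR: "\<alpha> K \<in> F Q R" using alpha_hom[OF K'(1) R K'(2)] .
    have aP: "\<alpha> K \<in> F Q P" using alpha_hom[OF K'(1) P] K'(2) RP by blast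
    have e: "fcon R (incl R) (ind P L f) (\<alpha> K) = (if \<exists>g\<in>P. cj S g ` L = K then f (\<alpha> K) else \<zero>\<^bsub>V\<^esub>)"
      using fcon_incl_app[OF R aR] aP alpha(2)[OF K'(1)] by (simp add: ind_def)
    show "(if \<exists>g\<in>P. cj S g ` L = K then W.cpush L (SOME g. g \<in> P \<and> cj S g ` L = K) (\<Psi> P f L) else \<zero>\<^bsub>V\<^esub>)
      = fcon R (incl R) (ind P L f) (\<alpha> K)"
    proof (cases "\<exists>g\<in>P. cj S g ` L = K")
      case True
      \<comment> \<open>Any conjugating element gives the same vector, namely the value of f at
        \<open>\<alpha> K\<close>.\<close>
      let ?g = "SOME g. g \<in> P \<and> cj S g ` L = K"
      have "?g \<in> P \<and> cj S ?g ` L = K" using True by (intro someI_ex[of "\<lambda>g. g \<in> P \<and> cj S g ` L = K"]) auto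
      then show ?thesis using True e cpush_fixc[OF P gen_fixc[OF P f] L', of ?g] L by (simp add: \<Psi>_def)
    next
      case False
      then show ?thesis using e by simp
    qed
  qed
qed (use P R in auto)

text \<open>The transfer sums over P/R, and the function is supported on the R-class of L. Evaluated
  at \<open>\<alpha> L\<close>, a coset of R contributes only if it meets the normaliser of L in P.
  Such cosets are the cosets in that normaliser of the normaliser of L in R, whence the relative
  trace.\<close>

lemma stransfer_val:
  assumes P: "sbg P" and R: "sbg R" and RP: "R \<subseteq> P" and f: "f \<in> gen R"
  shows "W.stransfer P R (\<Psi> R f) = \<Psi> P (fcov R P (incl R) f)"
  unfolding W.stransfer_def
proof (rule assemble[OF R P fcov_lin gen_fcov_closed f])
  have iR: "incl R \<in> F R P" using hom_incl[OF R P RP] .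
  then show "incl R \<in> F R P" "incl R \<in> F R P" by auto
  fix L assume L: "L \<in> reps R"
  note L' = reps(2,1)[OF R L]
  have LP: "L \<subseteq> P" using L' RP by auto
  note sb = cjQ_sbg[OF L'(1)] and a = alpha[OF L'(1)]
  have aR: "\<alpha> L \<in> F Q R" using alpha_hom[OF L'(1) R L'(2)] .
  have aP: "\<alpha> L \<in> F Q P" using alpha_hom[OF L'(1) P LP] .
  let ?h = "ind R L f" and ?h' = "fcov R P (incl R) (ind R L f)"
  have h: "?h \<in> fixc R" using gen_fixc[OF R gen_ind[OF R L'(2) f]] .
  have h': "?h' \<in> fixc P" using fcov_in[OF R P iR h] .
  have val: "?h' \<psi> = csum V P R (\<lambda>g. ?h (cq (inv g) \<psi>))" if "\<psi> \<in> F Q P" for \<psi>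
    using that by (simp add: fcov_def lift_incl[OF R h])
  \<comment> \<open>If the term at g is nonzero, the image of c_g^{-1} \<psi> is an R-conjugate of
    L, so g can be corrected by an element of R to carry L to the image of \<psi>.\<close>
  have cls: "\<exists>r\<in>R. cj S (g \<otimes> r) ` L = \<psi> ` Q" if \<psi>: "\<psi> \<in> F Q P" and g: "g \<in> P" and nz: "?h (cq (inv g) \<psi>) \<noteq> \<zero>\<^bsub>V\<^esub>" for g \<psi>
  proof -
    have gS: "g \<in> carrier S" using sbgD(1)[OF P g] .
    have "cq (inv g) \<psi> \<in> F Q R" using nz fixcD(2)[OF h] by blast
    then obtain r where r: "r \<in> R" "cj S r ` L = cq (inv g) \<psi> ` Q" using suppD[OF ind_supp, OF _ nz] by blast
    have rS: "r \<in> carrier S" using sbgD(1)[OF R r(1)] .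
    have "cj S (g \<otimes> r) ` L = cj S g ` cj S r ` L" using cj_image_cj[OF gS rS sbgD(5)[OF sb]] by simp
    also have "\<dots> = \<psi> ` Q"
      using r(2) cj_image_inv(2)[OF gS img(1)[OF P \<psi>]] by (simp add: compose_image)
    finally show ?thesis using r(1) by blast
  qed
  let ?N = "W.nrm P L" and ?M = "W.nrm R L"
  have N: "sbg ?N" "sbg ?M" "?M \<subseteq> ?N" "?N \<subseteq> P"
    using nrm_sbg[OF P LP] nrm_sbg[OF R L'(2)] RP by (auto simp: W.nrm_def)
  have NS: "g \<in> ?N \<Longrightarrow> g \<in> carrier S" for g using sbgD(1)[OF N(1)] .
  have "?h' (\<alpha> L) = (\<Oplus>\<^bsub>V\<^esub> i\<in>{()}. csum V ?N ?M (\<lambda>g. ?h (cq (inv g) (\<alpha> L))))"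
    unfolding val[OF aP]
  proof (rule csum_Sigma[OF abV R P RP])
    show "?h (cq (inv (g \<otimes> b)) (\<alpha> L)) = ?h (cq (inv g) (\<alpha> L))" if "g \<in> P" "b \<in> R" for g b
      using lift_coset[OF R P iR h aP that(1), of b] that(2) by (simp add: lift_incl[OF R h])
    \<comment> \<open>The normaliser of L in R is the intersection of R with the normaliser in
      P.\<close>
    show "inv x \<otimes> y \<in> R \<longleftrightarrow> i = j \<and> inv x \<otimes> y \<in> ?M" if "x \<in> ?N" "y \<in> ?N" for x y and i j :: unit
      using that sbgD(3,4)[OF N(1)] nrm_mem[OF P LP] nrm_mem[OF R L'(2)] by auto
    fix g assume g: "g \<in> P" "?h (cq (inv g) (\<alpha> L)) \<noteq> \<zero>\<^bsub>V\<^esub>"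
    then obtain r where r: "r \<in> R" "cj S (g \<otimes> r) ` L = L" using cls[OF aP] unfolding a(2) by blast
    have c: "g \<in> carrier S" "r \<in> carrier S" using sbgD(1)[OF P g(1)] sbgD(1)[OF R r(1)] by auto
    have "g \<otimes> r \<in> ?N" using nrm_mem[OF P LP] r(2) sbgD(3)[OF P g(1)] r(1) RP by auto
    moreover have "inv g \<otimes> (g \<otimes> r) \<in> R" using c r by simp
    ultimately show "\<exists>i\<in>{()}. \<exists>a\<in>?N. inv g \<otimes> a \<in> R" by blast
  qed (use N fixcD(1)[OF h] in auto)
  also have "\<dots> = csum V ?N ?M (\<lambda>g. ?h (cq (inv g) (\<alpha> L)))"
    using csum_closed[OF abV N(2,1,3)] fixcD(1)[OF h] by simp
  also have "\<dots> = csum V ?N ?M (\<lambda>g. W.cpush L g (f (\<alpha> L)))"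
  proof (rule csum_cong[OF abV N(2,1,3), symmetric])
    show "?h (cq (inv g) (\<alpha> L)) \<in> carrier V" for g using fixcD(1)[OF h] .
    fix g assume g: "g \<in> ?N"
    have gL: "cj S g ` L = L" "cj S (inv g) ` L = L"
      using g sbgD(4)[OF N(1) g] nrm_mem[OF P LP] by auto
    let ?f = "\<lambda>\<chi>. ?h (cq (inv g) \<chi>)"
    have "W.cpush L g (?f (cq g (\<alpha> L))) = ?f (\<alpha> (cj S g ` L))"
    proof (rule cpush_val[OF L'(1) NS[OF g]])
      fix \<chi> b assume "\<chi> \<in> F Q (cj S g ` L)" and b: "b \<in> F Q Q"
      then have \<chi>: "\<chi> \<in> F Q L" using gL by simp
      have c: "cq (inv g) \<chi> \<in> F Q R"
        using hom_comp_cj[OF Q sb \<chi> R, of "inv g"] gL(2) img(2)[OF sb \<chi>] NS[OF g] L'(2) by blast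
      have "cq (inv g) (compose Q \<chi> b) = compose Q (cq (inv g) \<chi>) b"
        using compose_assoc'[of b Q Q "cj S (inv g)" \<chi>] aut_image[OF b] by simp
      then show "\<sigma> b (?f (compose Q \<chi> b)) = ?f \<chi>" using fixcD(3)[OF h c b] by simp
    qed (rule fixcD(1)[OF h])
    then show "W.cpush L g (f (\<alpha> L)) = ?f (\<alpha> L)"
      using cq_inv(1)[OF sb a(1) NS[OF g]] gL ind_alpha[OF R L] by simp
  qed
  also have "\<dots> = W.tr L ?M ?N (f (\<alpha> L))" by (simp add: tr_csum)
  finally have tr: "W.tr L ?M ?N (f (\<alpha> L)) = ?h' (\<alpha> L)" by simp
  have "supp P L ?h'"
    unfolding supp_def
  proof (intro ballI impI, rule ccontr)
    fix \<psi> assume \<psi>: "\<psi> \<in> F Q P" "?h' \<psi> \<noteq> \<zero>\<^bsub>V\<^esub>" and no: "\<not> (\<exists>g\<in>P. cj S g ` L = \<psi> ` Q)"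
    have "?h (cq (inv g) \<psi>) = \<zero>\<^bsub>V\<^esub>" if "g \<in> P" for g
      using cls[OF \<psi>(1) that] no sbgD(3)[OF P that] RP by blast
    then show False using \<psi>(2) val[OF \<psi>(1)] csum_zero[OF abV R P RP] by simp
  qed
  then show "W.emb P L (W.tr L ?M ?N (\<Psi> R f L)) = \<Psi> P ?h'"
    using emb_val[OF P h' L'(1) LP] tr L by (simp add: \<Psi>_def)
qed (use P R in auto)

lemma simple_mackey_obj [simp]: "obj W.simple_mackey P = W.smod P"
  by (simp add: W.simple_mackey_def)

text \<open>The representative picked from the class is c_x \<phi>. Its factorisation through its
  image matches the shape of Webb's definition, and x disappears by \<open>fcon_cj\<close>.\<close>

lemma simple_mackey_con:
  assumes P: "sbg P" and R: "sbg R" and \<phi>: "\<phi> \<in> F P R" and f: "f \<in> gen R"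
  shows "mcon W.simple_mackey P R \<phi> (\<Psi> R f) = \<Psi> P (fcon P \<phi> f)"
proof -
  obtain x where x: "x \<in> R" "(SOME \<psi>. \<psi> \<in> orbit_class S P R \<phi>) = compose P (cj S x) \<phi>"
    using orbit_class_some[OF P R \<phi>] .
  let ?\<psi> = "compose P (cj S x) \<phi>"
  have \<psi>: "?\<psi> \<in> F P R" using hom_comp_cj'[OF P R \<phi> x(1)] .
  have sb: "sbg (?\<psi> ` P)" "?\<psi> ` P \<subseteq> R" using hom_image_sbg[OF P R \<psi> P] hom_image[OF P R \<psi>] by auto
  note i = hom_inv_map[OF P R \<psi>]
  have g: "fcon (?\<psi> ` P) (incl (?\<psi> ` P)) f \<in> gen (?\<psi> ` P)"
    using gen_fcon_closed[OF sb(1) R hom_incl[OF sb(1) R sb(2)] f] .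
  have "mcon W.simple_mackey P R \<phi> (\<Psi> R f) =
      W.siso (?\<psi> ` P) P (inv_map P ?\<psi>) (W.srestr R (?\<psi> ` P) (\<Psi> R f))"
    using x(2) by (simp add: W.simple_mackey_def Let_def)
  also have "\<dots> = \<Psi> P (fcov (?\<psi> ` P) P (inv_map P ?\<psi>) (fcon (?\<psi> ` P) (incl (?\<psi> ` P)) f))"
    using srestr_val[OF R sb f] siso_val[OF sb(1) P i(1,5) g] by simp
  also have "\<dots> = \<Psi> P (fcon P ?\<psi> f)" using fcon_factor[OF P R \<psi> gen_fixc[OF R f]] by simp
  also have "\<dots> = \<Psi> P (fcon P \<phi> f)" using fcon_cj[OF P R \<phi> x(1) gen_fixc[OF R f]] by simp
  finally show ?thesis .
qed

lemma simple_mackey_cov: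
  assumes P: "sbg P" and R: "sbg R" and \<phi>: "\<phi> \<in> F P R" and f: "f \<in> gen P"
  shows "mcov W.simple_mackey P R \<phi> (\<Psi> P f) = \<Psi> R (fcov P R \<phi> f)"
proof -
  obtain x where x: "x \<in> R" "(SOME \<psi>. \<psi> \<in> orbit_class S P R \<phi>) = compose P (cj S x) \<phi>"
    using orbit_class_some[OF P R \<phi>] .
  let ?\<psi> = "compose P (cj S x) \<phi>"
  have \<psi>: "?\<psi> \<in> F P R" using hom_comp_cj'[OF P R \<phi> x(1)] .
  have sb: "sbg (?\<psi> ` P)" "?\<psi> ` P \<subseteq> R" using hom_image_sbg[OF P R \<psi> P] hom_image[OF P R \<psi>] by auto
  have \<psi>': "?\<psi> \<in> F P (?\<psi> ` P)" using hom_iso_image[OF P R \<psi>] .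
  have i: "incl (?\<psi> ` P) \<in> F (?\<psi> ` P) R" using hom_incl[OF sb(1) R sb(2)] .
  have g: "fcov P (?\<psi> ` P) ?\<psi> f \<in> gen (?\<psi> ` P)" using gen_fcov_closed[OF P sb(1) \<psi>' f] .
  have "mcov W.simple_mackey P R \<phi> (\<Psi> P f) = W.stransfer R (?\<psi> ` P) (W.siso P (?\<psi> ` P) ?\<psi> (\<Psi> P f))"
    using x(2) by (simp add: W.simple_mackey_def Let_def)
  also have "\<dots> = \<Psi> R (fcov (?\<psi> ` P) R (incl (?\<psi> ` P)) (fcov P (?\<psi> ` P) ?\<psi> f))"
    using siso_val[OF P sb(1) \<psi>' refl f] stransfer_val[OF R sb g] by simp
  also have "\<dots> = \<Psi> R (fcov P R (compose P (incl (?\<psi> ` P)) ?\<psi>) f)"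
    using fcov_comp[OF P sb(1) R \<psi>' i gen_fixc[OF P f]] by simp
  also have "compose P (incl (?\<psi> ` P)) ?\<psi> = ?\<psi>" using compose_incl[OF hom_ext[OF P R \<psi>]] by simp
  also have "fcov P R ?\<psi> f = fcov P R \<phi> f" using fcov_cj[OF P R \<phi> x(1) gen_fixc[OF P f]] .
  finally show ?thesis .
qed

end

section \<open>Outer automorphisms\<close>

context fusion_system
begin

lemma fus_Aut_simps [simp]:
  "carrier (fus_Aut F Q) = F Q Q" "b \<otimes>\<^bsub>fus_Aut F Q\<^esub> c = compose Q b c" "\<one>\<^bsub>fus_Aut F Q\<^esub> = incl Q"
  by (simp_all add: fus_Aut_def)

text \<open>Thus Out_F(Q) consists of the endomorphism classes of Q in the orbit category, which is
  why it acts on the value of any Mackey functor at Q.\<close>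

lemma Inn_coset: "Inn S Q #>\<^bsub>fus_Aut F Q\<^esub> b = orbit_class S Q Q b"
  by (auto simp: r_coset_def orbit_class_def)

context
  fixes Q assumes Q: "sbg Q"
begin

lemma fus_Aut_group: "group (fus_Aut F Q)"
proof (rule groupI; simp)
  show "compose Q b c \<in> F Q Q" if "b \<in> F Q Q" "c \<in> F Q Q" for b c using hom_comp[OF Q Q Q] that by blast
  show "incl Q \<in> F Q Q" using hom_incl[OF Q Q] by blast
  show "compose Q (compose Q b c) d = compose Q b (compose Q c d)" if "d \<in> F Q Q" for b c d
    using compose_assoc'[of d Q Q b c] hom_image[OF Q Q that] by simp
  show "compose Q (incl Q) b = b" if b: "b \<in> F Q Q" for b
    using compose_incl[OF hom_ext[OF Q Q b] hom_image[OF Q Q b]] .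
  show "\<exists>c\<in>F Q Q. compose Q c b = incl Q" if b: "b \<in> F Q Q" for b
  proof -
    have "b ` Q = Q" using endo_image[OF Q b] .
    then show ?thesis using hom_inv_map[OF Q Q b] by auto
  qed
qed

lemma Inn_mem: "x \<in> Q \<Longrightarrow> restrict (cj S x) Q \<in> F Q Q"
  using hom_conj[OF Q Q] cj_image_self[OF Q] sbgD(1)[OF Q] by blast

lemma Inn_orbit: "Inn S Q = orbit_class S Q Q (incl Q)"
proof -
  have "compose Q (cj S x) (incl Q) = restrict (cj S x) Q" for x by (auto simp: compose_def)
  then show ?thesis using orbit_class_eq[OF Q Q hom_incl[OF Q Q]] by (simp add: Inn_def)
qed

lemma orbit_class_Inn: "x \<in> Q \<Longrightarrow> orbit_class S Q Q (restrict (cj S x) Q) = Inn S Q"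
proof -
  assume x: "x \<in> Q"
  have "compose Q (cj S x) (incl Q) = restrict (cj S x) Q" by (auto simp: compose_def)
  then show ?thesis using orbit_class_cj[OF Q Q hom_incl[OF Q Q] x] Inn_orbit by simp
qed

text \<open>An automorphism b conjugates c_x to conjugation by b(x), and b permutes Q.\<close>

lemma Inn_normal: "Inn S Q \<lhd> fus_Aut F Q"
proof (rule group.normalI[OF fus_Aut_group])
  interpret A: group "fus_Aut F Q" by (rule fus_Aut_group)
  have c: "compose Q (restrict (cj S x) Q) (restrict (cj S y) Q) = restrict (cj S (x \<otimes> y)) Q"
    if "x \<in> Q" "y \<in> Q" for x y
    using that cj_mem[OF Q] sbgD(1)[OF Q] by (auto simp: compose_def cj_cj)
  have one: "restrict (cj S \<one>) Q = incl Q" using sbgD(1)[OF Q] by (intro restrict_ext) simp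
  show "subgroup (Inn S Q) (fus_Aut F Q)"
  proof (rule A.subgroupI)
    show "Inn S Q \<subseteq> carrier (fus_Aut F Q)" using Inn_mem by (auto simp: Inn_def)
    show "Inn S Q \<noteq> {}" using sbgD(2)[OF Q] by (auto simp: Inn_def)
  next
    fix a assume "a \<in> Inn S Q"
    then obtain x where x: "x \<in> Q" "a = restrict (cj S x) Q" by (auto simp: Inn_def)
    have "restrict (cj S (inv x)) Q \<otimes>\<^bsub>fus_Aut F Q\<^esub> a = \<one>\<^bsub>fus_Aut F Q\<^esub>"
      using c[OF sbgD(4)[OF Q x(1)] x(1)] x one sbgD(1)[OF Q x(1)] by simp
    then have "inv\<^bsub>fus_Aut F Q\<^esub> a = restrict (cj S (inv x)) Q"
      using Inn_mem[OF x(1)] Inn_mem[OF sbgD(4)[OF Q x(1)]] x(2) by (intro A.inv_equality) auto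
    then show "inv\<^bsub>fus_Aut F Q\<^esub> a \<in> Inn S Q" using sbgD(4)[OF Q x(1)] by (simp add: Inn_def)
    fix b assume "b \<in> Inn S Q"
    then obtain y where y: "y \<in> Q" "b = restrict (cj S y) Q" by (auto simp: Inn_def)
    then show "a \<otimes>\<^bsub>fus_Aut F Q\<^esub> b \<in> Inn S Q" using c[OF x(1) y(1)] x y sbgD(3)[OF Q] by (auto simp: Inn_def)
  qed
  show "\<forall>b\<in>carrier (fus_Aut F Q). Inn S Q #>\<^bsub>fus_Aut F Q\<^esub> b = l_coset (fus_Aut F Q) b (Inn S Q)"
  proof
    fix b assume "b \<in> carrier (fus_Aut F Q)"
    then have b: "b \<in> F Q Q" by simp
    have im: "b ` Q = Q" using endo_image[OF Q b] .
    have swap: "compose Q b (restrict (cj S x) Q) = compose Q (restrict (cj S (b x)) Q) b" if "x \<in> Q" for x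
      using that hom_cj[OF Q Q b] hom_mem[OF Q Q b] by (auto simp: compose_def)
    have "l_coset (fus_Aut F Q) b (Inn S Q) = (\<lambda>x. compose Q b (restrict (cj S x) Q)) ` Q"
      by (auto simp: l_coset_def Inn_def)
    also have "\<dots> = (\<lambda>x. compose Q (restrict (cj S (b x)) Q) b) ` Q"
      using swap by (intro image_cong) auto
    also have "\<dots> = (\<lambda>y. compose Q (restrict (cj S y) Q) b) ` b ` Q" by (simp add: image_image)
    also have "\<dots> = Inn S Q #>\<^bsub>fus_Aut F Q\<^esub> b"
      unfolding im by (auto simp: r_coset_def Inn_def)
    finally show "Inn S Q #>\<^bsub>fus_Aut F Q\<^esub> b = l_coset (fus_Aut F Q) b (Inn S Q)" by simp
  qed
qed

lemma fus_Out_group: "group (fus_Out S F Q)"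
  unfolding fus_Out_def by (rule normal.factorgroup_is_group[OF Inn_normal])

lemma fus_Out_carrier: "carrier (fus_Out S F Q) = orbit_class S Q Q ` F Q Q"
  by (auto simp: fus_Out_def FactGroup_def RCOSETS_def Inn_coset)

lemma fus_Out_one: "\<one>\<^bsub>fus_Out S F Q\<^esub> = Inn S Q"
  by (simp add: fus_Out_def FactGroup_def)

lemma fus_Out_mult:
  "\<lbrakk>b \<in> F Q Q; c \<in> F Q Q\<rbrakk> \<Longrightarrow> orbit_class S Q Q b \<otimes>\<^bsub>fus_Out S F Q\<^esub> orbit_class S Q Q c = orbit_class S Q Q (compose Q b c)"
  using normal.rcos_sum[OF Inn_normal, of b c] by (simp add: fus_Out_def FactGroup_def Inn_coset)

end

end

lemma (in fusion_collection) kG_module_aut: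
  assumes Q: "sbg Q" and V: "kG_module k (fus_Out S F Q) V \<rho>"
  shows "aut_module S p F k V Q (\<lambda>b. \<rho> (orbit_class S Q Q b))"
proof -
  interpret V: module k V using V by (simp add: kG_module_def)
  interpret Q: subgroup Q S by (rule Q)
  interpret A: group_action "fus_Out S F Q" "carrier V" \<rho> using V by (simp add: kG_module_def)
  have one: "\<rho> (Inn S Q) v = v" if "v \<in> carrier V" for v
    using A.id_eq_one[symmetric] that by (simp add: fus_Out_one[OF Q])
  show ?thesis
  proof unfold_locales
    fix b assume b: "b \<in> F Q Q"
    then show "\<rho> (orbit_class S Q Q b) \<in> lin_maps k V V"
      using V by (auto simp: kG_module_def fus_Out_carrier[OF Q])
    fix c v assume "c \<in> F Q Q" "v \<in> carrier V"
    then show "\<rho> (orbit_class S Q Q (compose Q b c)) v = \<rho> (orbit_class S Q Q b) (\<rho> (orbit_class S Q Q c) v)"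
      using A.composition_rule[of v "orbit_class S Q Q b" "orbit_class S Q Q c"] b
      by (simp add: fus_Out_mult[OF Q] fus_Out_carrier[OF Q])
  next
    fix v assume v: "v \<in> carrier V"
    show "\<rho> (orbit_class S Q Q (incl Q)) v = v" using one[OF v] Inn_orbit[OF Q] by simp
    show "\<rho> (orbit_class S Q Q (restrict (cj S x) Q)) v = v" if "x \<in> Q" for x
      using one[OF v] orbit_class_Inn[OF Q that] by simp
  qed
qed

section \<open>The simple functors\<close>

locale webb_fix = webb_setting S p F k V Q \<sigma> \<rho> \<alpha> reps + fix_setting S p F X k V Q \<sigma>
  for S :: "'a monoid" (structure) and p F X and k :: "'k ring" and V :: "('k, 'v) module" and Q \<sigma> \<rho> \<alpha> reps
begin

lemma \<Psi>_mor: "mackey_mor k S F X G W.simple_mackey \<Psi>"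
proof (rule mackey_morI)
  fix P assume P: "P \<in> X"
  show "\<Psi> P \<in> lin_maps k (obj G P) (obj W.simple_mackey P)"
    using \<Psi>_lin[OF X_sbg[OF P]] by (simp del: smod_simps)
  fix R \<phi> f assume R: "R \<in> X" "\<phi> \<in> F P R"
  note sb = X_sbg[OF P] X_sbg[OF R(1)]
  show "\<Psi> P (mcon G P R \<phi> f) = mcon W.simple_mackey P R \<phi> (\<Psi> R f)" if "f \<in> carrier (obj G R)"
    using that simple_mackey_con[OF sb R(2)] fcon_mcon(1)[OF sb R(2)] gen_fixc[OF sb(2)] by simp
  show "\<Psi> R (mcov G P R \<phi> f) = mcov W.simple_mackey P R \<phi> (\<Psi> P f)" if "f \<in> carrier (obj G P)"
    using that simple_mackey_cov[OF sb R(2)] fcon_mcon(2)[OF sb R(2)] gen_fixc[OF sb(1)] by simp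
qed

lemma \<Psi>_bij': "P \<in> X \<Longrightarrow> bij_betw (\<Psi> P) (carrier (obj G P)) (carrier (obj W.simple_mackey P))"
  using \<Psi>_bij[OF X_sbg] by simp

lemma webb_functor: "mackey_functor k S F X W.simple_mackey"
proof (rule G.mackey_transport[OF \<Psi>_mor \<Psi>_bij'])
  show "\<Psi> P \<zero>\<^bsub>obj G P\<^esub> = \<zero>\<^bsub>obj W.simple_mackey P\<^esub>" for P
    using \<Psi>_zero by simp
qed

lemma webb_iso: "mackey_iso k S F X G W.simple_mackey \<Psi>"
  by (rule mackey_iso_of_bij[OF \<Psi>_mor \<Psi>_bij' gen_functor])

text \<open>If P has a summand, it contains an F-conjugate of Q, and overconjugacy closure carries
  membership in X from Q to that conjugate and on to P.\<close>

lemma webb_vanishes: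
  assumes "sbg P" "P \<notin> X"
  shows "carrier (obj W.simple_mackey P) = {\<zero>\<^bsub>obj W.simple_mackey P\<^esub>}"
proof -
  have "reps P = {}"
  proof (rule ccontr)
    assume "reps P \<noteq> {}"
    then obtain L where L: "L \<in> reps P" by blast
    have "L \<in> X"
      using X_up[OF QX alpha(1)[OF reps(2)[OF assms(1) L]] cjQ_sbg[OF reps(2)[OF assms(1) L]]] .
    then show False using X_mono[OF _ reps(1)[OF assms(1) L] assms(1)] assms(2) by blast
  qed
  then show ?thesis by (simp add: restrict_def)
qed

end

text \<open>\<open>fv v\<close> is its own transfer along the identity, so it lies in the generated
  subfunctor, and it has value v at the identity.\<close>

lemma (in webb_setting) webb_Q_nonzero:
  assumes "carrier V \<noteq> {\<zero>\<^bsub>V\<^esub>}"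
  shows "carrier (obj W.simple_mackey Q) \<noteq> {\<zero>\<^bsub>obj W.simple_mackey Q\<^esub>}"
proof
  assume z: "carrier (obj W.simple_mackey Q) = {\<zero>\<^bsub>obj W.simple_mackey Q\<^esub>}"
  obtain v where v: "v \<in> carrier V" "v \<noteq> \<zero>\<^bsub>V\<^esub>" using assms V.M.zero_closed by blast
  have "fv v \<in> gen Q"
    using gen_fcov[OF Q incl_Q fv_in[OF v(1)]] fcov_id[OF Q fv_in[OF v(1)]] by simp
  then have "\<Psi> Q (fv v) \<in> carrier (obj W.simple_mackey Q)"
    using \<Psi>_bij[OF Q] by (auto simp: bij_betw_def simp del: smod_simps)
  then have "\<Psi> Q (fv v) = (\<lambda>L\<in>reps Q. \<zero>\<^bsub>V\<^esub>)" unfolding z by simp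
  then have "fv v = (\<lambda>\<phi>. \<zero>\<^bsub>V\<^esub>)" using \<Psi>_inj[OF Q fv_in[OF v(1)]] by blast
  then show False using fv_incl[OF v(1)] v(2) by simp
qed

text \<open>Restriction only re-uses values of f and transfer only adds them. Through its preimage
  in M the lemma turns submodules of M(Q) into subfunctors, which shows that M(Q) is simple.\<close>

lemma (in fix_setting) values_subfunctor:
  assumes W: "submodule W k V"
  shows "subfunctor k S F X fix_mackey (\<lambda>P. {f \<in> fixc P. \<forall>\<phi>. f \<phi> \<in> W})"
  unfolding subfunctor_def
proof (intro conjI ballI)
  note D = submoduleD[OF modV W]
  fix P assume P: "P \<in> X"
  note sb = X_sbg[OF P]
  show "submodule {f \<in> fixc P. \<forall>\<phi>. f \<phi> \<in> W} k (obj fix_mackey P)"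
    using D fixc_zero fixc_add fixc_smult fixmod_module[OF sb]
    by (intro submodule_of_closed) auto
  fix R \<phi> f assume R: "R \<in> X" "\<phi> \<in> F P R"
  note sR = X_sbg[OF R(1)]
  show "mcon fix_mackey P R \<phi> f \<in> {f \<in> fixc P. \<forall>\<phi>. f \<phi> \<in> W}" if "f \<in> {f \<in> fixc R. \<forall>\<phi>. f \<phi> \<in> W}"
    using that fcon_in[OF sb sR R(2)] D(2) by (simp add: fcon_mcon(1)[OF sb sR R(2)]) (simp add: fcon_def)
  show "mcov fix_mackey P R \<phi> f \<in> {f \<in> fixc R. \<forall>\<phi>. f \<phi> \<in> W}" if f: "f \<in> {f \<in> fixc P. \<forall>\<phi>. f \<phi> \<in> W}"
  proof -
    have "lift P \<phi> f \<chi> \<in> W" for \<chi>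
      using f D(2) lift_comp[OF sb sR R(2)] by (cases "\<exists>\<theta>\<in>F Q P. compose Q \<phi> \<theta> = \<chi>") (auto simp: lift_def)
    then have "fcov P R \<phi> f \<psi> \<in> W" for \<psi>
      unfolding fcov_def csum_def using D(2) by (auto intro!: submodule_finsum_closed[OF modV W])
    then show ?thesis using f fcov_in[OF sb sR R(2)] by (simp add: fcon_mcon(2)[OF sb sR R(2)])
  qed
qed

section \<open>Classification\<close>

locale minimal_value = mackey_on S p F X k M
  for S :: "'a monoid" (structure) and p F X and k :: "'k ring" and M :: "('a, 'k, 'm) mackey" +
  fixes Q
  assumes QX': "Q \<in> X"
    and minimal: "\<lbrakk>P \<in> X; card P < card Q\<rbrakk> \<Longrightarrow> carrier (obj M P) = {\<zero>\<^bsub>obj M P\<^esub>}"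
begin

sublocale V: module k "obj M Q" by (rule M.obj_module[OF QX'])

text \<open>Automorphisms of Q act covariantly on M(Q). Inner ones act trivially because they
  represent the identity in the orbit category.\<close>

sublocale fix_setting S p F X k "obj M Q" Q "mcov M Q Q"
proof -
  have Q: "sbg Q" using X_sbg[OF QX'] .
  have i: "incl Q \<in> F Q Q" using hom_incl[OF Q Q] by blast
  interpret Q: subgroup Q S by (rule Q)
  show "fix_setting S p F X k (obj M Q) Q (mcov M Q Q)"
  proof unfold_locales
    fix v assume v: "v \<in> carrier (obj M Q)"
    show "mcov M Q Q (incl Q) v = v" using mcov_id[OF QX' v] .
    fix x assume x: "x \<in> Q"
    have "restrict (cj S x) Q = compose Q (cj S x) (incl Q)" by (auto simp: compose_def)
    then show "mcov M Q Q (restrict (cj S x) Q) v = v"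
      using orbit_class_cj[OF Q Q i x] mcov_id[OF QX' v] by simp
  qed (simp_all add: mcov_lin QX' mcov_comp)
qed

definition \<eta> :: "'a set \<Rightarrow> 'm \<Rightarrow> ('a \<Rightarrow> 'a) \<Rightarrow> 'm"
  where "\<eta> P m \<phi> = (if \<phi> \<in> F Q P then mcon M Q P \<phi> m else \<zero>\<^bsub>obj M Q\<^esub>)"

text \<open>Contravariance turns precomposition with b into M^* along b, and the axiom on
  isomorphisms makes this the action of b^{-1}, which is the required equivariance.\<close>

lemma \<eta>_in:
  assumes P: "P \<in> X" and m: "m \<in> carrier (obj M P)"
  shows "\<eta> P m \<in> fixc P"
proof (rule fixcI)
  note sb = X_sbg[OF P]
  show "\<eta> P m \<phi> \<in> carrier (obj M Q)" for \<phi> using mcon_closed[OF QX P] m by (simp add: \<eta>_def)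
  fix \<phi> assume \<phi>: "\<phi> \<in> F Q P"
  show "mcov M Q Q b (\<eta> P m (compose Q \<phi> b)) = \<eta> P m \<phi>" if b: "b \<in> F Q Q" for b
  proof -
    have c: "mcon M Q P \<phi> m \<in> carrier (obj M Q)" using mcon_closed[OF QX P \<phi> m] .
    have "mcon M Q P (compose Q \<phi> b) m = mcov M Q Q (inv_map Q b) (mcon M Q P \<phi> m)"
      using mcon_comp[OF QX QX P b \<phi> m] mcon_iso[OF QX QX b aut_image[OF b] c] by simp
    then show ?thesis using act_inv(2)[OF b c] \<phi> aut_hom[OF sb \<phi> b] by (simp add: \<eta>_def)
  qed
  show "\<eta> P m (cq g \<phi>) = \<eta> P m \<phi>" if g: "g \<in> P" for g
    using orbit_class_cj[OF Q sb \<phi> g] cq_hom[OF sb \<phi> g] \<phi> by (simp add: \<eta>_def)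
qed (simp add: \<eta>_def)

lemma \<eta>_con:
  assumes "P \<in> X" "R \<in> X" "\<alpha> \<in> F P R" "m \<in> carrier (obj M R)"
  shows "\<eta> P (mcon M P R \<alpha> m) = fcon P \<alpha> (\<eta> R m)"
  using mcon_comp[OF QX assms(1,2) _ assms(3,4)] hom_comp[OF Q X_sbg[OF assms(1)] X_sbg[OF assms(2)] _ assms(3)]
  by (intro ext) (simp add: \<eta>_def fcon_def)

text \<open>Both sides are split over the same double cosets of \<psi>(Q) and \<alpha>(P) in R, the
  left by the Mackey formula in M, the right by \<open>csum_double_coset\<close>, and are compared
  term by term. A term survives only if \<psi>(Q) lies in the conjugate of \<alpha>(P) by x.\<close>

lemma \<eta>_cov:
  assumes P: "P \<in> X" and R: "R \<in> X" and \<alpha>: "\<alpha> \<in> F P R" and m: "m \<in> carrier (obj M P)"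
  shows "\<eta> R (mcov M P R \<alpha> m) = fcov P R \<alpha> (\<eta> P m)"
proof (rule fixc_eqI[OF \<eta>_in[OF R mcov_closed[OF P R \<alpha> m]]])
  note sP = X_sbg[OF P] and sR = X_sbg[OF R]
  note f = \<eta>_in[OF P m]
  show "fcov P R \<alpha> (\<eta> P m) \<in> fixc R" using fcov_in[OF sP sR \<alpha> f] .
  fix \<psi> assume \<psi>: "\<psi> \<in> F Q R"
  let ?A = "\<psi> ` Q" and ?B = "\<alpha> ` P"
  let ?h = "\<lambda>g. lift P \<alpha> (\<eta> P m) (cq (inv g) \<psi>)"
  have A: "sbg ?A" "?A \<in> X" "?A \<subseteq> R" using img_sbg[OF sR \<psi>] X_image[OF QX sR \<psi>] img(2)[OF sR \<psi>] by auto
  have B: "sbg ?B" "?B \<in> X" "?B \<subseteq> R"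
    using hom_image_sbg[OF sP sR \<alpha> sP] X_image[OF P sR \<alpha>] hom_image[OF sP sR \<alpha>] by auto
  have \<psi>A: "\<psi> \<in> F Q ?A" using hom_iso_image[OF Q sR \<psi>] .
  have \<alpha>B: "\<alpha> \<in> F P ?B" using hom_iso_image[OF sP sR \<alpha>] .
  have iA: "incl ?A \<in> F ?A R" "incl ?B \<in> F ?B R" using hom_incl A B sR by auto
  have cA: "compose Q (incl ?A) \<psi> = \<psi>" using compose_incl[OF extQ[OF sR \<psi>]] by simp
  have cB: "compose P (incl ?B) \<alpha> = \<alpha>" using compose_incl[OF hom_ext[OF sP sR \<alpha>]] by simp
  define m' where "m' = mcov M P ?B \<alpha> m"
  have m': "m' \<in> carrier (obj M ?B)" using mcov_closed[OF P B(2) \<alpha>B m] by (simp add: m'_def)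
  obtain T where T: "double_coset_reps S ?A R ?B T"
    using double_coset_reps_exist[OF A(1) B(1) sR A(3) B(3)] .
  let ?t = "\<lambda>x. mackey_term M ?A ?B x m'"
  let ?I = "{x \<in> T. ?A \<inter> cj S x ` ?B \<in> X}"
  let ?c = "\<lambda>x. csum (obj M Q) ?A (?A \<inter> cj S x ` ?B) (\<lambda>a. ?h (a \<otimes> x))"
  have TR: "T \<subseteq> R" and finT: "finite T"
    using T finite_sbg[OF sR] finite_subset by (auto simp: double_coset_reps_def)
  have hcl: "?h g \<in> carrier (obj M Q)" for g using lift_closed[OF sP sR \<alpha> f] .
  have AS: "?A \<subseteq> carrier S" using sbgD(5)[OF A(1)] .
  have key: "(x \<in> ?I \<longrightarrow> ?t x \<in> carrier (obj M ?A) \<and> mcon M Q ?A \<psi> (?t x) = ?c x) \<and> (x \<notin> ?I \<longrightarrow> ?c x = \<zero>\<^bsub>obj M Q\<^esub>)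
      \<and> ?c x \<in> carrier (obj M Q)" if x: "x \<in> T" for x
  proof -
    have xR: "x \<in> R" using TR x by auto
    have xS: "x \<in> carrier S" using sbgD(1)[OF sR xR] .
    let ?C = "cj S x ` ?B" and ?D = "?A \<inter> cj S x ` ?B" and ?cx = "restrict (cj S x) ?B"
    have C: "sbg ?C" "?C \<in> X" using cj_image_sbg[OF B(1) xS] X_cj[OF B(2) xS] by auto
    have D: "sbg ?D" using A(1) C(1) subgroups_Inter_pair by blast
    have cx: "?cx \<in> F ?B ?C" using cj_hom[OF B(1) xS] .
    have iD: "incl ?D \<in> F ?D ?A" "incl ?D \<in> F ?D ?C" using hom_incl[OF D] A C by auto
    have u: "mcov M ?B ?C ?cx m' \<in> carrier (obj M ?C)" using mcov_closed[OF B(2) C(2) cx m'] .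
    show ?thesis
    proof (cases "?A \<subseteq> ?C")
      case True
      \<comment> \<open>The intersection is all of \<psi>(Q): the Mackey term is a plain restriction
        of m, and the inner coset sum has a single coset.\<close>
      then have DA: "?D = ?A" by blast
      let ?\<gamma> = "compose P ?cx \<alpha>"
      have \<gamma>: "?\<gamma> \<in> F P ?C" using hom_comp[OF sP B(1) C(1) \<alpha>B cx] .
      have \<gamma>im: "?\<gamma> ` P = ?C" by (simp add: compose_image)
      note gi = hom_inv_map[OF sP C(1) \<gamma>, unfolded \<gamma>im]
      have "mcov M ?B ?C ?cx m' = mcov M P ?C ?\<gamma> m"
        unfolding m'_def using mcov_comp[OF P B(2) C(2) \<alpha>B cx m] .
      also have "\<dots> = mcon M ?C P (inv_map P ?\<gamma>) m"
        using mcon_iso[OF C(2) P gi(1) gi(5) m] inv_map_inv_map[OF sP C(1) \<gamma>] \<gamma>im by simp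
      finally have u': "mcov M ?B ?C ?cx m' = mcon M ?C P (inv_map P ?\<gamma>) m" .
      have iAC: "incl ?A \<in> F ?A ?C" using hom_incl[OF A(1) C(1) True] .
      have w: "mcon M ?A ?C (incl ?A) (mcov M ?B ?C ?cx m') \<in> carrier (obj M ?A)"
        using mcon_closed[OF A(2) C(2) iAC u] .
      have t: "?t x = mcon M ?A ?C (incl ?A) (mcov M ?B ?C ?cx m')"
        unfolding DA using mcov_id[OF A(2) w] .
      have \<psi>C: "\<psi> \<in> F Q ?C" using hom_iff_image[OF sR C(1) \<psi>] True by simp
      let ?\<phi> = "compose Q (inv_map P ?\<gamma>) \<psi>"
      have \<phi>: "?\<phi> \<in> F Q P" using hom_comp[OF Q C(1) sP \<psi>C gi(1)] .
      have "mcon M Q ?A \<psi> (?t x) = mcon M Q ?C \<psi> (mcov M ?B ?C ?cx m')"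
        unfolding t using mcon_comp[OF QX A(2) C(2) \<psi>A iAC u] cA by simp
      also have "\<dots> = mcon M Q P ?\<phi> m" unfolding u' using mcon_comp[OF QX C(2) P \<psi>C gi(1) m] .
      finally have lhs: "mcon M Q ?A \<psi> (?t x) = \<eta> P m ?\<phi>" using \<phi> by (simp add: \<eta>_def)
      \<comment> \<open>The morphism along which the Mackey term restricts m is also the
        factorisation of c_x^{-1} \<psi> through \<alpha>, so both sides are the same value of
        \<open>\<eta> P m\<close>.\<close>
      have "compose Q \<alpha> ?\<phi> = cq (inv x) \<psi>"
      proof (rule extensionalityI[of _ Q])
        fix u assume u: "u \<in> Q"
        have "\<psi> u \<in> ?C" using hom_mem[OF Q C(1) \<psi>C u] .
        then obtain y where y: "y \<in> P" "\<psi> u = cj S x (\<alpha> y)" by auto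
        have yS: "\<alpha> y \<in> carrier S" using hom_mem[OF sP sR \<alpha> y(1)] sbgD(1)[OF sR] by blast
        have "?\<gamma> y = \<psi> u" using y by (simp add: compose_def)
        then have "inv_map P ?\<gamma> (\<psi> u) = y" using gi(4)[OF y(1)] by simp
        then show "compose Q \<alpha> ?\<phi> u = cq (inv x) \<psi> u" using u y yS xS by (simp add: compose_eq)
      qed auto
      then have hx: "?h x = \<eta> P m ?\<phi>" using lift_comp[OF sP sR \<alpha> \<phi>, of "\<eta> P m"] by simp
      have "?c x = ?h (\<one> \<otimes> x)"
        unfolding DA
      proof (rule csum_self[OF abV A(1)])
        fix g b assume gb: "g \<in> ?A" "b \<in> ?A"
        have gS: "g \<in> carrier S" "b \<in> carrier S" using gb AS by auto
        have gR: "g \<otimes> x \<in> R" using sbgD(3)[OF sR _ xR] gb A(3) by blast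
        have "inv x \<otimes> b \<otimes> x \<in> ?B" using cj_image_mem[OF xS B(1) gS(2)] gb True by blast
        moreover have "g \<otimes> b \<otimes> x = (g \<otimes> x) \<otimes> (inv x \<otimes> b \<otimes> x)" using gS xS by (simp add: m_assoc)
        ultimately show "?h (g \<otimes> b \<otimes> x) = ?h (g \<otimes> x)"
          using lift_coset[OF sP sR \<alpha> f \<psi> gR] by simp
      qed (rule hcl)
      then have c: "?c x = ?h x" using xS by simp
      have "x \<in> ?I" using x DA A(2) by simp
      then show ?thesis using lhs hx c w t fixcD(1)[OF f] by auto
    next
      case False
      \<comment> \<open>\<psi>(Q) has the order of Q, so a proper subgroup of it falls below the
        minimal order: M vanishes there, or it lies outside X and contributes no Mackey
        term.\<close>
      have lt: "card ?D < card Q"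
      proof -
        have "?D \<subset> ?A" using False by blast
        then have "card ?D < card ?A" using finite_sbg[OF A(1)] by (intro psubset_card_mono)
        also have "\<dots> = card Q" using hom_inj[OF Q sR \<psi>] by (simp add: card_image)
        finally show ?thesis .
      qed
      \<comment> \<open>A factorisation through \<alpha> would put a^{-1} \<psi>(Q) a, which equals
        \<psi>(Q), inside the conjugate of \<alpha>(P) by x.\<close>
      have "?h (a \<otimes> x) = \<zero>\<^bsub>obj M Q\<^esub>" if a: "a \<in> ?A" for a
      proof (rule lift_out, rule notI)
        fix \<phi> assume \<phi>: "\<phi> \<in> F Q P" "compose Q \<alpha> \<phi> = cq (inv (a \<otimes> x)) \<psi>"
        have aS: "a \<in> carrier S" using a AS by auto
        have "cj S (inv (a \<otimes> x)) ` ?A \<subseteq> ?B"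
          using arg_cong[OF \<phi>(2), of "\<lambda>f. f ` Q", symmetric] image_mono[OF img(2)[OF sP \<phi>(1)], of \<alpha>]
          by (simp add: compose_image)
        then have "cj S x ` cj S (inv (a \<otimes> x)) ` ?A \<subseteq> ?C" by (rule image_mono)
        moreover have "cj S x ` cj S (inv (a \<otimes> x)) ` ?A = cj S (inv a) ` ?A"
          using cj_image_cj[OF xS _ AS, of "inv (a \<otimes> x)"] aS xS by (simp add: inv_mult_group)
        ultimately show False using False cj_image_self[OF A(1) sbgD(4)[OF A(1) a]] by simp
      qed
      then have c: "?c x = \<zero>\<^bsub>obj M Q\<^esub>" using csum_zero[OF abV D A(1)] by simp
      have "?t x = \<zero>\<^bsub>obj M ?A\<^esub>" if DX: "?D \<in> X"
      proof -
        have "mcon M ?D ?C (incl ?D) (mcov M ?B ?C ?cx m') \<in> carrier (obj M ?D)"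
          using mcon_closed[OF DX C(2) iD(2) u] .
        then show ?thesis using minimal[OF DX lt] mcov_zero[OF DX A(2) iD(1)] by simp
      qed
      moreover have "\<zero>\<^bsub>obj M ?A\<^esub> \<in> carrier (obj M ?A)"
        using submoduleD(2)[OF M.obj_module[OF A(2)] subfunctorD(1)[OF carrier_subfunctor A(2)]] .
      ultimately show ?thesis using c mcon_zero[OF QX A(2) \<psi>A] by auto
    qed
  qed
  have m1: "mcov M P R \<alpha> m = mcov M ?B R (incl ?B) m'"
    using mcov_comp[OF P B(2) R \<alpha>B iA(2) m] cB by (simp add: m'_def)
  have m2: "mcov M ?B R (incl ?B) m' \<in> carrier (obj M R)" using mcov_closed[OF B(2) R iA(2) m'] .
  have "\<eta> R (mcov M P R \<alpha> m) \<psi> = mcon M Q R \<psi> (mcov M ?B R (incl ?B) m')" using \<psi> m1 by (simp add: \<eta>_def)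
  also have "\<dots> = mcon M Q ?A \<psi> (mcon M ?A R (incl ?A) (mcov M ?B R (incl ?B) m'))"
    using mcon_comp[OF QX A(2) R \<psi>A iA(1) m2] cA by simp
  also have "\<dots> = mcon M Q ?A \<psi> (\<Oplus>\<^bsub>obj M ?A\<^esub> x\<in>?I. ?t x)"
    using mackey_formula'[OF R A(2) B(2) A(3) B(3) T m'] by simp
  also have "\<dots> = (\<Oplus>\<^bsub>obj M Q\<^esub> x\<in>?I. mcon M Q ?A \<psi> (?t x))"
    using key by (intro lin_maps_finsum[OF M.obj_module[OF A(2)] modV mcon_lin[OF QX A(2) \<psi>A]]) auto
  also have "\<dots> = (\<Oplus>\<^bsub>obj M Q\<^esub> x\<in>?I. ?c x)"
    using key by (intro V.finsum_cong') auto
  also have "\<dots> = (\<Oplus>\<^bsub>obj M Q\<^esub> x\<in>T. ?c x)"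
    using key finT by (intro V.M.add.finprod_mono_neutral_cong_left) auto
  also have "\<dots> = csum (obj M Q) R ?B ?h"
    using hcl lift_coset[OF sP sR \<alpha> f \<psi>] by (intro csum_double_coset[OF abV A(1) B(1) sR A(3) B(3) T, symmetric]) auto
  also have "\<dots> = fcov P R \<alpha> (\<eta> P m) \<psi>" using \<psi> by (simp add: fcov_def)
  finally show "\<eta> R (mcov M P R \<alpha> m) \<psi> = fcov P R \<alpha> (\<eta> P m) \<psi>" .
qed

lemma \<eta>_lin:
  assumes P: "P \<in> X"
  shows "\<eta> P \<in> lin_maps k (obj M P) (fixmod P)"
  using \<eta>_in[OF P] lin_mapsD[OF mcon_lin[OF QX P]] by (intro lin_mapsI) (auto simp: \<eta>_def)

lemma \<eta>_mor: "mackey_mor k S F X M fix_mackey \<eta>"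
proof (rule mackey_morI)
  fix P R \<phi> assume *: "P \<in> X" "R \<in> X" "\<phi> \<in> F P R"
  note sb = X_sbg[OF *(1)] X_sbg[OF *(2)]
  show "\<eta> P (mcon M P R \<phi> m) = mcon fix_mackey P R \<phi> (\<eta> R m)" if "m \<in> carrier (obj M R)" for m
    using \<eta>_con[OF * that] fcon_mcon(1)[OF sb *(3) \<eta>_in[OF *(2) that]] by simp
  show "\<eta> R (mcov M P R \<phi> m) = mcov fix_mackey P R \<phi> (\<eta> P m)" if "m \<in> carrier (obj M P)" for m
    using \<eta>_cov[OF * that] fcon_mcon(2)[OF sb *(3) \<eta>_in[OF *(1) that]] by simp
qed (simp add: \<eta>_lin)

lemma \<eta>_Q: "m \<in> carrier (obj M Q) \<Longrightarrow> \<eta> Q m (incl Q) = m"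
  using mcon_id[OF QX] incl_Q by (simp add: \<eta>_def)

lemma \<eta>_Q_surj: "fixc Q \<subseteq> \<eta> Q ` carrier (obj M Q)"
proof
  fix f assume f: "f \<in> fixc Q"
  let ?v = "f (incl Q)"
  have v: "?v \<in> carrier (obj M Q)" using fixcD(1)[OF f] .
  have "\<eta> Q ?v = f" using fixc_Q[OF \<eta>_in[OF QX v]] \<eta>_Q[OF v] fixc_Q[OF f] by simp
  then show "f \<in> \<eta> Q ` carrier (obj M Q)" using imageI[OF v, of "\<eta> Q"] by simp
qed

section \<open>Simple functors and their values at a subgroup of least order\<close>

context
  assumes simple: "mackey_simple k S F X M" and nz: "carrier (obj M Q) \<noteq> {\<zero>\<^bsub>obj M Q\<^esub>}"
begin

lemma subfunctor_cases:
  assumes "subfunctor k S F X M N"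
  shows "(\<forall>P\<in>X. N P = {\<zero>\<^bsub>obj M P\<^esub>}) \<or> (\<forall>P\<in>X. N P = carrier (obj M P))"
  using simple simple_iff assms by blast

lemma \<eta>_inj:
  assumes P: "P \<in> X"
  shows "inj_on (\<eta> P) (carrier (obj M P))"
proof (rule lin_maps_inj_on[OF M.obj_module[OF P] fixmod_module[OF X_sbg[OF P]] \<eta>_lin[OF P]])
  define K where "K P = {m \<in> carrier (obj M P). \<eta> P m \<in> {\<zero>\<^bsub>obj fix_mackey P\<^esub>}}" for P
  have K: "subfunctor k S F X M K"
    unfolding K_def by (rule preimage_subfunctor[OF M.mackey_functor_axioms fix_functor \<eta>_mor Fx.zero_subfunctor])
  \<comment> \<open>The value of \<open>\<eta> Q m\<close> at the identity is m, so the kernel is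
    trivial at Q and cannot be all of M.\<close>
  have "m = \<zero>\<^bsub>obj M Q\<^esub>" if "m \<in> K Q" for m using that \<eta>_Q[of m] by (auto simp: K_def)
  then have "K Q \<noteq> carrier (obj M Q)" using nz V.M.zero_closed by blast
  then have "\<forall>P\<in>X. K P = {\<zero>\<^bsub>obj M P\<^esub>}" using subfunctor_cases[OF K] QX by blast
  moreover fix m assume "m \<in> carrier (obj M P)" "\<eta> P m = \<zero>\<^bsub>fixmod P\<^esub>"
  then have "m \<in> K P" by (simp add: K_def)
  ultimately show "m = \<zero>\<^bsub>obj M P\<^esub>" using P by blast
qed

text \<open>The preimage of \<open>gen\<close> contains the nonzero M(Q), so by simplicity it is all
  of M. Conversely the image is a subfunctor with everything at Q, and \<open>gen_least\<close>
  gives the other inclusion.\<close>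

lemma \<eta>_image:
  assumes P: "P \<in> X"
  shows "\<eta> P ` carrier (obj M P) = gen P"
proof
  define K where "K P = {m \<in> carrier (obj M P). \<eta> P m \<in> gen P}" for P
  have K: "subfunctor k S F X M K"
    unfolding K_def by (rule preimage_subfunctor[OF M.mackey_functor_axioms fix_functor \<eta>_mor gen_subfunctor])
  have "K Q = carrier (obj M Q)" using \<eta>_in[OF QX] gen_Q by (auto simp: K_def)
  then have "K P = carrier (obj M P)" using subfunctor_cases[OF K] nz QX P by auto
  then show "\<eta> P ` carrier (obj M P) \<subseteq> gen P" by (auto simp: K_def)
  have "subfunctor k S F X fix_mackey (\<lambda>P. \<eta> P ` carrier (obj M P))"
    by (rule image_subfunctor[OF M.mackey_functor_axioms fix_functor \<eta>_mor carrier_subfunctor])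
  from gen_least[OF this \<eta>_Q_surj P] show "gen P \<subseteq> \<eta> P ` carrier (obj M P)" .
qed

lemma \<eta>_iso: "mackey_iso k S F X M G \<eta>"
proof (rule mackey_iso_of_bij[OF _ _ M.mackey_functor_axioms])
  note im = \<eta>_image
  show "bij_betw (\<eta> P) (carrier (obj M P)) (carrier (obj G P))" if "P \<in> X" for P
    using \<eta>_inj[OF that] im[OF that] by (simp add: bij_betw_def)
  show "mackey_mor k S F X M G \<eta>"
  proof (rule mackey_morI)
    fix P assume P: "P \<in> X"
    show "\<eta> P \<in> lin_maps k (obj M P) (obj G P)"
      using lin_mapsD[OF \<eta>_lin[OF P]] im[OF P] by (intro lin_mapsI) auto
  qed (simp_all add: mackey_morD[OF \<eta>_mor])
qed

text \<open>An invariant W extends to the subfunctor of those elements of M all of whose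
  restrictions along morphisms from Q lie in W. Its value at Q is W again, so simplicity of M
  decides W.\<close>

lemma value_simple:
  assumes W: "submodule W k (obj M Q)" and inv: "\<And>b w. \<lbrakk>b \<in> F Q Q; w \<in> W\<rbrakk> \<Longrightarrow> mcov M Q Q b w \<in> W"
  shows "W = {\<zero>\<^bsub>obj M Q\<^esub>} \<or> W = carrier (obj M Q)"
proof -
  note D = submoduleD[OF modV W]
  define N where "N P = {m \<in> carrier (obj M P). \<eta> P m \<in> {f \<in> fixc P. \<forall>\<phi>. f \<phi> \<in> W}}" for P
  have N: "subfunctor k S F X M N"
    unfolding N_def by (rule preimage_subfunctor[OF M.mackey_functor_axioms fix_functor \<eta>_mor values_subfunctor[OF W]])
  have "N Q = W"
  proof
    show "N Q \<subseteq> W"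
    proof
      fix m assume "m \<in> N Q"
      then have "m \<in> carrier (obj M Q)" "\<eta> Q m (incl Q) \<in> W" by (auto simp: N_def)
      then show "m \<in> W" using \<eta>_Q by simp
    qed
    show "W \<subseteq> N Q"
    proof
      fix w assume w: "w \<in> W"
      then have wV: "w \<in> carrier (obj M Q)" using D(1) by blast
      \<comment> \<open>Restriction along an automorphism is the action of its inverse, under which
        W is stable.\<close>
      have "\<eta> Q w \<phi> \<in> W" for \<phi>
        using mcon_iso[OF QX QX _ aut_image wV, of \<phi>] inv[OF aut_inv(1) w, of \<phi>] D(2) by (simp add: \<eta>_def)
      then show "w \<in> N Q" using wV \<eta>_in[OF QX wV] by (simp add: N_def)
    qed
  qed
  then show ?thesis using subfunctor_cases[OF N] QX by auto
qed

end

end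

text \<open>The maps are cut down to the carrier because the elements of \<open>BijGroup\<close> are
  extensional bijections.\<close>

lemma (in mackey_on) value_kG_module:
  assumes QX: "Q \<in> X"
  shows "kG_module k (fus_Out S F Q) (obj M Q) (\<lambda>c\<in>carrier (fus_Out S F Q). \<lambda>m\<in>carrier (obj M Q). cov M Q Q c m)"
    (is "kG_module k ?O ?V ?\<rho>")
proof -
  note Q = X_sbg[OF QX]
  have V: "module k ?V" by (rule M.obj_module[OF QX])
  have \<rho>: "?\<rho> (orbit_class S Q Q b) = restrict (mcov M Q Q b) (carrier ?V)" if "b \<in> F Q Q" for b
    using that fus_Out_carrier[OF Q] by simp
  have cl: "mcov M Q Q b m \<in> carrier ?V" if "b \<in> F Q Q" "m \<in> carrier ?V" for b m
    using mcov_closed[OF QX QX that] .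
  have Bij: "?\<rho> (orbit_class S Q Q b) \<in> Bij (carrier ?V)" if b: "b \<in> F Q Q" for b
  proof -
    have im: "b ` Q = Q" using endo_image[OF Q b] .
    note i = hom_inv_map[OF Q Q b, unfolded im]
    have "bij_betw (restrict (mcov M Q Q b) (carrier ?V)) (carrier ?V) (carrier ?V)"
      using i b cl mcov_comp[OF QX QX QX] mcov_id[OF QX]
      by (intro bij_betw_byWitness[of _ "restrict (mcov M Q Q (inv_map Q b)) (carrier ?V)"]) auto
    then show ?thesis unfolding \<rho>[OF b] Bij_def by simp
  qed
  have "group_hom ?O (BijGroup (carrier ?V)) ?\<rho>"
  proof (intro group_hom.intro group_hom_axioms.intro fus_Out_group[OF Q] group_BijGroup homI)
    fix c assume c: "c \<in> carrier ?O"
    then obtain b where b: "b \<in> F Q Q" "c = orbit_class S Q Q b" using fus_Out_carrier[OF Q] by auto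
    show "?\<rho> c \<in> carrier (BijGroup (carrier ?V))" unfolding b(2) using Bij[OF b(1)] by (simp only: BijGroup_def partial_object.simps)
    fix d assume d: "d \<in> carrier ?O"
    then obtain b' where b': "b' \<in> F Q Q" "d = orbit_class S Q Q b'" using fus_Out_carrier[OF Q] by auto
    have bb: "compose Q b b' \<in> F Q Q" using hom_comp[OF Q Q Q b'(1) b(1)] .
    have "?\<rho> (c \<otimes>\<^bsub>?O\<^esub> d) = restrict (mcov M Q Q (compose Q b b')) (carrier ?V)"
      unfolding b(2) b'(2) fus_Out_mult[OF Q b(1) b'(1)] \<rho>[OF bb] ..
    also have "\<dots> = compose (carrier ?V) (?\<rho> c) (?\<rho> d)"
      unfolding b(2) b'(2) \<rho>[OF b(1)] \<rho>[OF b'(1)]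
      using mcov_comp[OF QX QX QX b'(1) b(1)] cl[OF b'(1)] by (auto simp: compose_def restrict_def fun_eq_iff)
    also have "\<dots> = ?\<rho> c \<otimes>\<^bsub>BijGroup (carrier ?V)\<^esub> ?\<rho> d"
      unfolding b(2) b'(2) using Bij[OF b(1)] Bij[OF b'(1)]
      by (simp only: BijGroup_def monoid.simps partial_object.simps restrict_apply' if_True)
    finally show "?\<rho> (c \<otimes>\<^bsub>?O\<^esub> d) = ?\<rho> c \<otimes>\<^bsub>BijGroup (carrier ?V)\<^esub> ?\<rho> d" .
  qed
  then have "group_action ?O (carrier ?V) ?\<rho>" by (rule group_action.intro)
  moreover have "?\<rho> c \<in> lin_maps k ?V ?V" if c: "c \<in> carrier ?O" for c
  proof -
    interpret V: module k ?V by (rule V)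
    obtain b where b: "b \<in> F Q Q" "c = orbit_class S Q Q b" using c fus_Out_carrier[OF Q] by auto
    show ?thesis unfolding b(2) \<rho>[OF b(1)]
      using lin_mapsD[OF mcov_lin[OF QX QX b(1)]] by (intro lin_mapsI) auto
  qed
  ultimately show ?thesis using V by (simp add: kG_module_def)
qed

theorem proposition3p3:
  fixes S :: "'g monoid" and p :: nat and F :: "'g homs" and X :: "'g set set" and k :: "'k ring"
    and \<alpha> :: "'g set \<Rightarrow> 'g set \<Rightarrow> 'g \<Rightarrow> 'g" and reps :: "'g set \<Rightarrow> 'g set \<Rightarrow> 'g set set"
  assumes "fusion_system S p F"
    and "overconjugacy_closed S F X"
    and "cring k"
    and "\<And>Q. subgroup Q S \<Longrightarrow> webb_choice S F Q (\<alpha> Q) (reps Q)"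
  shows "(\<forall>Q (V :: ('k, 'v) module) \<rho>.
      subgroup Q S \<and> simple_kG_module k (fus_Out S F Q) V \<rho> \<longrightarrow>
        ((\<forall>P. subgroup P S \<and> P \<notin> X \<longrightarrow>
            carrier (obj (simple_mackey S F Q V \<rho> (\<alpha> Q) (reps Q)) P) =
              {\<zero>\<^bsub>obj (simple_mackey S F Q V \<rho> (\<alpha> Q) (reps Q)) P\<^esub>}) \<and>
          mackey_simple k S F X (simple_mackey S F Q V \<rho> (\<alpha> Q) (reps Q))
        \<longleftrightarrow> Q \<in> X)) \<and>
    (\<forall>M :: ('g, 'k, 'm) mackey. mackey_simple k S F X M \<longrightarrow>
      (\<exists>Q (V :: ('k, 'm) module) \<rho> \<eta>.
        Q \<in> X \<and> simple_kG_module k (fus_Out S F Q) V \<rho> \<and>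
        mackey_iso k S F X (simple_mackey S F Q V \<rho> (\<alpha> Q) (reps Q)) M \<eta>))"
proof (intro conjI allI impI)
  interpret fusion_collection S p F X
    using assms(1,2) by (simp add: fusion_collection_def fusion_collection_axioms_def)
  {
    fix Q and V :: "('k, 'v) module" and \<rho>
    assume *: "subgroup Q S \<and> simple_kG_module k (fus_Out S F Q) V \<rho>"
    then have Q: "subgroup Q S" and s: "simple_kG_module k (fus_Out S F Q) V \<rho>" by auto
    let ?\<sigma> = "\<lambda>b. \<rho> (orbit_class S Q Q b)"
    interpret aut_module S p F k V Q ?\<sigma>
      by (rule kG_module_aut[OF Q conjunct1[OF s[unfolded simple_kG_module_def]]])
    \<comment> \<open>This much is independent of X and is set up before Q is known to lie in X,
      since the only-if half also needs to know S_{Q,V} at Q.\<close>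
    interpret webb_setting S p F k V Q ?\<sigma> \<rho> "\<alpha> Q" "reps Q"
      by unfold_locales (simp_all add: Inn_coset assms(4) Q)
    have nz: "carrier V \<noteq> {\<zero>\<^bsub>V\<^esub>}" using s by (simp add: simple_kG_module_def)
    show "(\<forall>P. subgroup P S \<and> P \<notin> X \<longrightarrow>
            carrier (obj (simple_mackey S F Q V \<rho> (\<alpha> Q) (reps Q)) P) =
              {\<zero>\<^bsub>obj (simple_mackey S F Q V \<rho> (\<alpha> Q) (reps Q)) P\<^esub>}) \<and>
          mackey_simple k S F X (simple_mackey S F Q V \<rho> (\<alpha> Q) (reps Q))
        \<longleftrightarrow> Q \<in> X"
    proof
      assume "Q \<in> X"
      then interpret webb_fix S p F X k V Q ?\<sigma> \<rho> "\<alpha> Q" "reps Q" by unfold_locales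
      have "mackey_simple k S F X G"
      proof (rule gen_simple[OF nz])
        fix W assume W: "submodule W k V" "\<And>b w. \<lbrakk>b \<in> F Q Q; w \<in> W\<rbrakk> \<Longrightarrow> \<rho> (orbit_class S Q Q b) w \<in> W"
        then have "\<forall>g\<in>carrier (fus_Out S F Q). \<forall>w\<in>W. \<rho> g w \<in> W" using fus_Out_carrier[OF Q] by auto
        then show "W = {\<zero>\<^bsub>V\<^esub>} \<or> W = carrier V" using s W(1) by (simp add: simple_kG_module_def)
      qed
      then show "(\<forall>P. subgroup P S \<and> P \<notin> X \<longrightarrow>
            carrier (obj (simple_mackey S F Q V \<rho> (\<alpha> Q) (reps Q)) P) =
              {\<zero>\<^bsub>obj (simple_mackey S F Q V \<rho> (\<alpha> Q) (reps Q)) P\<^esub>}) \<and>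
          mackey_simple k S F X (simple_mackey S F Q V \<rho> (\<alpha> Q) (reps Q))"
        using G.simple_transport[OF _ webb_functor \<Psi>_mor \<Psi>_bij'] webb_vanishes by blast
    next
      assume "(\<forall>P. subgroup P S \<and> P \<notin> X \<longrightarrow>
            carrier (obj (simple_mackey S F Q V \<rho> (\<alpha> Q) (reps Q)) P) =
              {\<zero>\<^bsub>obj (simple_mackey S F Q V \<rho> (\<alpha> Q) (reps Q)) P\<^esub>}) \<and>
          mackey_simple k S F X (simple_mackey S F Q V \<rho> (\<alpha> Q) (reps Q))"
      then show "Q \<in> X" using webb_Q_nonzero[OF nz] Q by blast
    qed
  }
  fix M :: "('g, 'k, 'm) mackey"
  assume s: "mackey_simple k S F X M"
  interpret mackey_on S p F X k M
    using s by (simp add: mackey_on_def fusion_collection_axioms mackey_simple_def)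
  have "\<exists>Q. Q \<in> X \<and> carrier (obj M Q) \<noteq> {\<zero>\<^bsub>obj M Q\<^esub>}"
    using s by (auto simp: mackey_simple_def mackey_zero_def)
  then obtain Q where QM: "Q \<in> X \<and> carrier (obj M Q) \<noteq> {\<zero>\<^bsub>obj M Q\<^esub>}"
    and least: "\<And>P. P \<in> X \<and> carrier (obj M P) \<noteq> {\<zero>\<^bsub>obj M P\<^esub>} \<Longrightarrow> card Q \<le> card P"
    using ex_has_least_nat[of "\<lambda>Q. Q \<in> X \<and> carrier (obj M Q) \<noteq> {\<zero>\<^bsub>obj M Q\<^esub>}" _ card] by metis
  interpret minimal_value S p F X k M Q
    using QM least by unfold_locales (auto simp flip: not_le)
  let ?\<rho> = "\<lambda>c\<in>carrier (fus_Out S F Q). \<lambda>m\<in>carrier (obj M Q). cov M Q Q c m"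
  have sQ: "subgroup Q S" using X_sbg QM by blast
  have \<rho>: "?\<rho> (orbit_class S Q Q b) v = mcov M Q Q b v" if "b \<in> F Q Q" "v \<in> carrier (obj M Q)" for b v
    using that fus_Out_carrier[OF sQ] by simp
  have kG: "simple_kG_module k (fus_Out S F Q) (obj M Q) ?\<rho>"
    unfolding simple_kG_module_def
  proof (intro conjI allI impI)
    show "kG_module k (fus_Out S F Q) (obj M Q) ?\<rho>" using value_kG_module QM by blast
    show "carrier (obj M Q) \<noteq> {\<zero>\<^bsub>obj M Q\<^esub>}" using QM by blast
    fix W assume W: "submodule W k (obj M Q) \<and> (\<forall>g\<in>carrier (fus_Out S F Q). \<forall>w\<in>W. ?\<rho> g w \<in> W)"
    have "mcov M Q Q b w \<in> W" if "b \<in> F Q Q" "w \<in> W" for b w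
    proof -
      have "w \<in> carrier (obj M Q)" using submoduleD(1)[OF modV] W that by blast
      moreover have "?\<rho> (orbit_class S Q Q b) w \<in> W" using W that fus_Out_carrier[OF sQ] by blast
      ultimately show ?thesis using \<rho> that by simp
    qed
    then show "W = {\<zero>\<^bsub>obj M Q\<^esub>} \<or> W = carrier (obj M Q)" using value_simple[OF s] QM W by blast
  qed
  interpret webb_fix S p F X k "obj M Q" Q "mcov M Q Q" ?\<rho> "\<alpha> Q" "reps Q"
    by unfold_locales (use \<rho> assms(4)[OF sQ] in \<open>simp_all add: Inn_coset\<close>)
  \<comment> \<open>\<open>G\<close>, built from V = M(Q), is the common middle term: both S_{Q,V}
    and M are isomorphic to it.\<close>
  obtain \<theta> where "mackey_iso k S F X W.simple_mackey G \<theta>" using mackey_iso_sym[OF webb_iso] .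
  moreover obtain \<theta>' where "mackey_iso k S F X G M \<theta>'" using mackey_iso_sym[OF \<eta>_iso[OF s]] QM by blast
  ultimately have "mackey_iso k S F X W.simple_mackey M (\<lambda>P m. \<theta>' P (\<theta> P m))" by (rule mackey_iso_trans)
  then show "\<exists>Q (V :: ('k, 'm) module) \<rho> \<eta>. Q \<in> X \<and> simple_kG_module k (fus_Out S F Q) V \<rho> \<and>
        mackey_iso k S F X (simple_mackey S F Q V \<rho> (\<alpha> Q) (reps Q)) M \<eta>"
    using kG QM by blast
qed

end
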